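(* Let $1\le k\le n$ and suppose that $\mathcal{S}\subset\binom{[n]}{k}$ is a sort-closed set. Assume that $d(\mathcal{S})=n-1$. A subset $\mathcal{A}\subset\mathcal{S}$ is an arrangement of largest minors in $\mathcal{S}$ if and only if $\mathcal{A}$ is sorted. All maximal (by inclusion) arrangements of largest minors in $\mathcal{S}$ contain exactly $n$ elements. The number of maximal arrangements of largest minors in $\mathcal{S}$ equals $\mathrm{Vol}(P_{\mathcal{S}})$.
   Context: $[n]=\{1,\dots,n\}$ and $\binom{[n]}{k}$ is the set of $k$-element subsets of $[n]$. The positive Grassmannian $Gr^+(k,n)$ is the space of real $k\times n$ matrices of rank $k$, modulo row operations, all of whose maximal minors $\Delta_I$ ($I\in\binom{[n]}{k}$ the column set; defined up to a common nonzero factor) have the same nonzero sign; we choose representatives with all $\Delta_I>0$. For $\mathcal{S}\subset\binom{[n]}{k}$, a subset $\mathcal{A}\subset\mathcal{S}$ is an arrangement of largest minors in $\mathcal{S}$ if there exists $A\in Gr^+(k,n)$ such that all minors $\Delta_I(A)$, $I\in\mathcal{A}$, are equal to each other, and the minors $\Delta_J(A)$, $J\in\mathcal{S}\setminus\mathcal{A}$, are strictly less than the $\Delta_I(A)$, $I\in\mathcal{A}$. The sorting of a pair $I,J\in\binom{[n]}{k}$ with multiset union $I\cup J=\{a_1\le a_2\le\dots\le a_{2k}\}$ is the pair $I'=\{a_1,a_3,\dots,a_{2k-1}\}$, $J'=\{a_2,a_4,\dots,a_{2k}\}$. A set $\mathcal{S}\subset\binom{[n]}{k}$ is sort-closed if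 for any $I,J\in\mathcal{S}$ the elements $I',J'$ of the sorting are also in $\mathcal{S}$. Two sets $I,J\in\binom{[n]}{k}$ are sorted if, writing $I\setminus J=\{a_1<\dots<a_r\}$ and $J\setminus I=\{b_1<\dots<b_r\}$, one has $a_1<b_1<a_2<b_2<\dots<a_r<b_r$ or the same with the $a$'s and $b$'s switched. A subset of $\binom{[n]}{k}$ is sorted if every two elements in it are sorted. $P_{\mathcal{S}}\subset\mathbb{R}^n$ is the convex hull of the vectors $e_I=\sum_{i\in I}e_i$, $I\in\mathcal{S}$, where $e_1,\dots,e_n$ are the coordinate vectors; $d(\mathcal{S})$ is the dimension of $P_{\mathcal{S}}$. When $d(\mathcal{S})=n-1$, the normalized volume $\mathrm{Vol}(P_{\mathcal{S}})$ is $(n-1)!$ times the usual $(n-1)$-dimensional Euclidean volume of the projection of $P_{\mathcal{S}}$ to $\mathbb{R}^{n-1}$ under $(x_1,\dots,x_n)\mapsto(x_1,\dots,x_{n-1})$. *)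

theory Defs
  imports "HOL-Analysis.Analysis" "HOL-Library.Multiset"
begin

text \<open>
  The ground set [n] is the whole of a finite linearly ordered type \<open>'n\<close>, so n is \<open>CARD('n)\<close>,
  and k is \<open>CARD('k)\<close> for the finite linearly ordered type \<open>'k\<close> that indexes the rows.
\<close>

definition ksubsets :: "'k::finite itself \<Rightarrow> 'n::finite set set" where
  "ksubsets _ = {I. card I = CARD('k)}"


subsection \<open>Minors and the positive Grassmannian\<close>

text \<open>
  If \<open>card I = CARD('k)\<close>, then \<open>nth_column I\<close> is the increasing bijection from \<open>'k\<close> onto \<open>I\<close>
  (lemmas \<open>strict_mono_nth_column\<close> and \<open>range_nth_column\<close> below): \<open>card {..<j}\<close> is the position
  of \<open>j\<close> in \<open>'k\<close>, counted from 0.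
\<close>

definition nth_column :: "'n::{finite,linorder} set \<Rightarrow> 'k::{finite,linorder} \<Rightarrow> 'n" where
  "nth_column I j = sorted_list_of_set I ! card {..<j}"

lemma card_lessThan_less_CARD: "card {..<j} < CARD('k)" for j :: "'k::{finite,linorder}"
  by (intro psubset_card_mono) auto

lemma strict_mono_nth_column:
  fixes I :: "'n::{finite,linorder} set"
  assumes "card I = CARD('k)"
  shows "strict_mono (nth_column I :: 'k::{finite,linorder} \<Rightarrow> 'n)"
proof (rule strict_monoI)
  fix x y :: 'k assume "x < y"
  then have "card {..<x} < card {..<y}"
    by (intro psubset_card_mono) auto
  moreover have "card {..<y} < length (sorted_list_of_set I)"
    using assms card_lessThan_less_CARD[of y] by simp
  ultimately show "nth_column I x < nth_column I y"
    unfolding nth_column_def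
    using strict_sorted_list_of_set[of I] sorted_wrt_nth_less by blast
qed

lemma range_nth_column:
  fixes I :: "'n::{finite,linorder} set"
  assumes "card I = CARD('k)"
  shows "range (nth_column I :: 'k::{finite,linorder} \<Rightarrow> 'n) = I"
proof (rule card_subset_eq)
  show "range (nth_column I :: 'k \<Rightarrow> 'n) \<subseteq> I"
  proof
    fix x assume "x \<in> range (nth_column I :: 'k \<Rightarrow> 'n)"
    then obtain j :: 'k where "x = sorted_list_of_set I ! card {..<j}"
      by (auto simp: nth_column_def)
    moreover have "card {..<j} < length (sorted_list_of_set I)"
      using assms card_lessThan_less_CARD[of j] by simp
    ultimately show "x \<in> I"
      using nth_mem[of "card {..<j}" "sorted_list_of_set I"] by simp
  qed
  show "card (range (nth_column I :: 'k \<Rightarrow> 'n)) = card I"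
    using card_image[OF strict_mono_imp_inj_on[OF strict_mono_nth_column[OF assms]]] assms
    by simp
qed simp

definition maximal_minor :: "real^'n::{finite,linorder}^'k::{finite,linorder} \<Rightarrow> 'n set \<Rightarrow> real" where
  "maximal_minor A I = det (\<chi> i j. A $ i $ nth_column I j)"

text \<open>
  A point of the positive Grassmannian is a matrix modulo row operations; these multiply all
  maximal minors by a common nonzero factor. The set below consists of the representatives with
  positive minors; every point has such a representative, and any two representatives of the same
  point have minors that differ by a common positive factor.
\<close>

definition positive_grassmannian :: "(real^'n::{finite,linorder}^'k::{finite,linorder}) set" where
  "positive_grassmannian =
     {A. rank A = CARD('k) \<and> (\<forall>I\<in>ksubsets TYPE('k). maximal_minor A I > 0)}"

definition largest_minors_arrangement ::
    "'k::{finite,linorder} itself \<Rightarrow> 'n::{finite,linorder} set set \<Rightarrow> 'n set set \<Rightarrow> bool" where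
  "largest_minors_arrangement _ S \<A> \<longleftrightarrow>
     \<A> \<subseteq> S \<and>
     (\<exists>A \<in> (positive_grassmannian :: ((real, 'n) vec, 'k) vec set).
        (\<forall>I\<in>\<A>. \<forall>J\<in>\<A>. maximal_minor A I = maximal_minor A J) \<and>
        (\<forall>I\<in>\<A>. \<forall>J\<in>S - \<A>. maximal_minor A J < maximal_minor A I))"

definition maximal_largest_minors_arrangement ::
    "'k::{finite,linorder} itself \<Rightarrow> 'n::{finite,linorder} set set \<Rightarrow> 'n set set \<Rightarrow> bool" where
  "maximal_largest_minors_arrangement k S \<A> \<longleftrightarrow>
     largest_minors_arrangement k S \<A> \<and>
     (\<forall>\<B>. largest_minors_arrangement k S \<B> \<and> \<A> \<subseteq> \<B> \<longrightarrow> \<B> = \<A>)"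


subsection \<open>Sorting\<close>

text \<open>
  Lists are indexed from 0, so the entries \<open>a\<^sub>1, a\<^sub>3, \<dots>\<close> of the sorted multiset union are those at
  even positions.
\<close>

definition sorting :: "'n::linorder set \<Rightarrow> 'n set \<Rightarrow> 'n set \<times> 'n set" where
  "sorting I J =
     (let a = sorted_list_of_multiset (mset_set I + mset_set J)
      in ({a ! i | i. i < length a \<and> even i}, {a ! i | i. i < length a \<and> odd i}))"

definition sort_closed :: "'n::linorder set set \<Rightarrow> bool" where
  "sort_closed S \<longleftrightarrow> (\<forall>I\<in>S. \<forall>J\<in>S. fst (sorting I J) \<in> S \<and> snd (sorting I J) \<in> S)"

text \<open>
  For lists of equal length, \<open>splice [a\<^sub>1, \<dots>, a\<^sub>r] [b\<^sub>1, \<dots>, b\<^sub>r]\<close> is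
  \<open>[a\<^sub>1, b\<^sub>1, \<dots>, a\<^sub>r, b\<^sub>r]\<close>.
\<close>

definition interlacing :: "'n::linorder set \<Rightarrow> 'n set \<Rightarrow> bool" where
  "interlacing X Y \<longleftrightarrow>
     card X = card Y \<and> sorted_wrt (<) (splice (sorted_list_of_set X) (sorted_list_of_set Y))"

definition sorted_pair :: "'n::linorder set \<Rightarrow> 'n set \<Rightarrow> bool" where
  "sorted_pair I J \<longleftrightarrow> interlacing (I - J) (J - I) \<or> interlacing (J - I) (I - J)"

definition sorted_family :: "'n::linorder set set \<Rightarrow> bool" where
  "sorted_family \<A> \<longleftrightarrow> (\<forall>I\<in>\<A>. \<forall>J\<in>\<A>. sorted_pair I J)"


subsection \<open>The polytope and its normalized volume\<close>

definition subset_vec :: "'n::finite set \<Rightarrow> real^'n" where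
  "subset_vec I = (\<Sum>i\<in>I. axis i 1)"

definition subset_polytope :: "'n::finite set set \<Rightarrow> (real^'n) set" where
  "subset_polytope S = convex hull (subset_vec ` S)"

text \<open>
  The projection forgets the last coordinate \<open>Max UNIV\<close>. Its target is the space of functions on
  the remaining \<open>CARD('n) - 1\<close> indices with the product Lebesgue measure, rather than a
  \<open>real^_\<close> type, because those have no instance of dimension 0 (needed when \<open>CARD('n) = 1\<close>).
\<close>

definition drop_last_coord :: "real^'n::{finite,linorder} \<Rightarrow> ('n \<Rightarrow> real)" where
  "drop_last_coord x = (\<lambda>i\<in>UNIV - {Max UNIV}. x $ i)"

definition normalized_volume :: "(real^'n::{finite,linorder}) set \<Rightarrow> real" where
  "normalized_volume P =
     fact (CARD('n) - 1) *
     measure (\<Pi>\<^sub>M i\<in>UNIV - {Max (UNIV :: 'n set)}. (lborel :: real measure)) (drop_last_coord ` P)"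

end

theory Submission
  imports Defs
begin

text \<open>
  Everything is read off the counting functions \<open>cnt I j = |I \<inter> {..j}|\<close>. Two \<open>k\<close>-sets are sorted
  exactly when one counting function exceeds the other by 0 or 1 everywhere (\<open>sorted_pair_iff\<close>), and
  the sorting of \<open>I\<close> and \<open>J\<close> is the pair whose counting functions are the halves of
  \<open>cnt I + cnt J\<close>, rounded up and down (\<open>cnt_sorting\<close>).

  The analytic input is that, for a matrix with positive maximal minors, \<open>g = ln \<circ> maximal_minor M\<close>
  satisfies \<open>g I + g J < g I' + g J'\<close> whenever \<open>I\<close>, \<open>J\<close> are not sorted and \<open>I'\<close>, \<open>J'\<close> is their
  sorting (\<open>strictly_sort_concave_ln_minor\<close>). The three-term Pluecker relation gives this when \<open>I\<close>
  and \<open>J\<close> differ in two elements only. To reach all pairs, let the counting functions be shifted by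
  integer constants: they then form a distributive lattice, the three-term inequalities say that \<open>g\<close>
  is strictly supermodular on the unit squares of this lattice, and hence on all incomparable pairs
  (\<open>strict_supermodular\<close>). If \<open>I\<close>, \<open>J\<close> are not sorted, then
  \<open>cnt I - cnt J\<close> takes two values that differ by at least 2, so a suitable shift of \<open>cnt J\<close> is
  incomparable to \<open>cnt I\<close>, and their minimum and maximum are the counting functions of a strictly
  better pair with the same multiset union. The best pair with this multiset union is therefore
  sorted, and the only such pair is the sorting.

  Consequently a set of largest minors is sorted: otherwise sorting two of its members would yield a
  larger minor in the sort-closed set \<open>S\<close>.

  The rest is convex geometry with \<open>g\<close> as a height function. Among all ways to write a point of the
  polytope as a convex combination of vertices, one that maximizes the mean of \<open>g\<close> has sorted support,
  because weight on an unsorted pair can be moved to its sorting. Conversely a combination with sorted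
  support is determined by the point (\<open>sorted_combination_unique\<close>): the members of a sorted family
  form a chain of counting functions that differ by at most 1, so the lowest of them is the floor of
  the partial coordinate sums of the point. So the sorted subfamilies of \<open>S\<close> are the simplices of a
  triangulation of the polytope, the regular triangulation induced by \<open>g\<close>.

  As the polytope has dimension \<open>n - 1\<close>, the simplices with fewer than \<open>n\<close> vertices have measure zero
  in it, and every sorted family extends to one with \<open>n\<close> members (\<open>extend_to_full_simplex\<close>). Regularity
  yields, for each sorted family \<open>A\<close>, a linear functional \<open>T\<close> such that \<open>g I + T e\<^sub>I\<close> vanishes on \<open>A\<close>
  and is negative on the rest of \<open>S\<close> (\<open>supporting_functional\<close>). Multiplying column \<open>j\<close> by
  \<open>exp (T e\<^sub>j)\<close> turns any matrix with positive minors into one whose largest minors in \<open>S\<close> are those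
  of \<open>A\<close>.

  The maximal arrangements are thus the sorted families with \<open>n\<close> members. The corresponding simplices are
  unimodular (\<open>coefficient_in_Ints\<close>), so each of them has volume \<open>1 / (n - 1)!\<close>, and they overlap in null
  sets only; so the normalized volume counts them.
\<close>


section \<open>Counting functions and sorted pairs\<close>

definition cnt :: "'n::linorder set \<Rightarrow> 'n \<Rightarrow> int" where
  "cnt I j = int (card (I \<inter> {..j}))"

lemma set_splice: "set (splice xs ys) = set xs \<union> set ys"
  by (induction xs ys rule: splice.induct) auto

text \<open>
  The difference of the two counts goes up at each entry of the first list and down at each entry of
  the second, so it stays in \<open>{0, 1}\<close> exactly when the entries alternate.
\<close>

lemma sorted_wrt_splice_iff:
  fixes xs ys :: "'a::linorder list"
  assumes "length xs = length ys" "sorted_wrt (<) xs" "sorted_wrt (<) ys" "set xs \<inter> set ys = {}"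
  shows "sorted_wrt (<) (splice xs ys) \<longleftrightarrow>
    (\<forall>j. int (length (filter (\<lambda>x. x \<le> j) xs)) - int (length (filter (\<lambda>x. x \<le> j) ys)) \<in> {0, 1})"
  using assms
proof (induction xs ys rule: list_induct2)
  case Nil
  then show ?case by simp
next
  case (Cons x xs y ys)
  let ?c = "\<lambda>xs j. int (length (filter (\<lambda>x. x \<le> j) xs))"
  have IH: "sorted_wrt (<) (splice xs ys) \<longleftrightarrow> (\<forall>j. ?c xs j - ?c ys j \<in> {0, 1})"
    using Cons by auto
  have small: "?c zs j = 0" if "sorted_wrt (<) (z # zs)" "j \<le> z" for zs j and z :: 'a
    using that by (auto simp: filter_empty_conv)
  show ?case
  proof
    assume L: "sorted_wrt (<) (splice (x # xs) (y # ys))"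
    then have xy: "x < y" and tail: "sorted_wrt (<) (splice xs ys)" and y: "\<forall>z\<in>set xs. y < z"
      by (auto simp: set_splice)
    show "\<forall>j. ?c (x # xs) j - ?c (y # ys) j \<in> {0, 1}"
    proof
      fix j
      consider "y \<le> j" | "j < y" by fastforce
      then show "?c (x # xs) j - ?c (y # ys) j \<in> {0, 1}"
      proof cases
        case 1
        then show ?thesis using IH tail xy by auto
      next
        case 2
        then have "?c xs j = 0" "?c ys j = 0"
          using y small[of y ys j] Cons.prems by (auto simp: filter_empty_conv)
        moreover have "\<not> y \<le> j" using 2 by simp
        ultimately show ?thesis by (cases "x \<le> j") auto
      qed
    qed
  next
    assume R: "\<forall>j. ?c (x # xs) j - ?c (y # ys) j \<in> {0, 1}"
    have "x < y"
    proof (rule ccontr)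
      assume "\<not> x < y"
      then have "y < x" using Cons.prems by (auto simp: not_less le_less)
      then have "?c (x # xs) y = 0" "?c (y # ys) y = 1"
        using small[of x xs y] small[of y ys y] Cons.prems by auto
      then show False using R[rule_format, of y] by (simp only:) simp
    qed
    have yxs: "\<forall>z\<in>set xs. y < z"
    proof (rule ccontr)
      assume "\<not> (\<forall>z\<in>set xs. y < z)"
      then obtain z where z: "z \<in> set xs" "z < y"
        using Cons.prems by (force simp: not_less le_less)
      have "x < z" using Cons.prems z by auto
      have "z \<in> set (filter (\<lambda>x. x \<le> z) xs)" using z by auto
      then have "length (filter (\<lambda>x. x \<le> z) xs) > 0" by (rule length_pos_if_in_set)
      moreover have "?c (y # ys) z = 0" using small[of y ys z] Cons.prems z by auto
      moreover have "?c (x # xs) z = 1 + ?c xs z" using \<open>x < z\<close> by simp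
      ultimately show False using R[rule_format, of z] by (auto simp del: filter.simps)
    qed
    have "?c xs j - ?c ys j \<in> {0, 1}" for j
    proof (cases "y \<le> j")
      case True
      then have "x \<le> j" using \<open>x < y\<close> by simp
      then show ?thesis using R[rule_format, of j] True by simp
    next
      case False
      then have "?c xs j = 0" "?c ys j = 0"
        using yxs small[of y ys j] Cons.prems by (auto simp: filter_empty_conv)
      then show ?thesis by simp
    qed
    then have "sorted_wrt (<) (splice xs ys)" using IH by blast
    then show "sorted_wrt (<) (splice (x # xs) (y # ys))"
      using \<open>x < y\<close> yxs Cons.prems by (auto simp: set_splice)
  qed
qed

lemma length_filter_sorted_list_of_set:
  assumes "finite X"
  shows "int (length (filter (\<lambda>x. x \<le> j) (sorted_list_of_set X))) = cnt X j"
proof -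
  have "length (filter (\<lambda>x. x \<le> j) (sorted_list_of_set X))
      = card (set (filter (\<lambda>x. x \<le> j) (sorted_list_of_set X)))"
    using distinct_card[of "filter (\<lambda>x. x \<le> j) (sorted_list_of_set X)"] by simp
  also have "set (filter (\<lambda>x. x \<le> j) (sorted_list_of_set X)) = X \<inter> {..j}"
    using assms by auto
  finally show ?thesis by (simp add: cnt_def)
qed

lemma cnt_Diff:
  fixes I J :: "'n::linorder set"
  assumes "finite I" "finite J"
  shows "cnt (I - J) j - cnt (J - I) j = cnt I j - cnt J j"
proof -
  have *: "card (A \<inter> {..j}) = card ((A - B) \<inter> {..j}) + card (A \<inter> B \<inter> {..j})" if "finite A" for A B
    using card_Un_disjoint[of "(A - B) \<inter> {..j}" "A \<inter> B \<inter> {..j}"] that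
    by (auto simp: Int_Un_distrib2[symmetric] Un_Diff_Int intro: arg_cong[where f=card])
  show ?thesis
    using *[of I J] *[of J I] assms by (simp add: cnt_def Int_commute)
qed

lemma interlacing_iff:
  assumes "finite I" "finite J" "card I = card J"
  shows "interlacing (I - J) (J - I) \<longleftrightarrow> (\<forall>j. cnt I j - cnt J j \<in> {0, 1})"
proof -
  have c: "card (I - J) = card (J - I)"
    using assms card_le_sym_Diff[of I J] card_le_sym_Diff[of J I] by simp
  have "interlacing (I - J) (J - I) \<longleftrightarrow>
     (\<forall>j. cnt (I - J) j - cnt (J - I) j \<in> {0, 1})"
    unfolding interlacing_def
    using sorted_wrt_splice_iff[of "sorted_list_of_set (I - J)" "sorted_list_of_set (J - I)"] assms c
    by (auto simp: length_filter_sorted_list_of_set)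
  then show ?thesis using assms by (simp add: cnt_Diff)
qed

lemma sorted_pair_iff:
  assumes "finite I" "finite J" "card I = card J"
  shows "sorted_pair I J \<longleftrightarrow>
    (\<forall>j. cnt I j - cnt J j \<in> {0, 1}) \<or> (\<forall>j. cnt J j - cnt I j \<in> {0, 1})"
  using interlacing_iff[of I J] interlacing_iff[of J I] assms by (simp add: sorted_pair_def)

lemma cnt_Max:
  fixes I :: "'n::{finite,linorder} set"
  shows "cnt I (Max UNIV) = int (card I)"
proof -
  have "I \<inter> {..Max UNIV} = I" by auto
  then show ?thesis by (simp add: cnt_def)
qed

text \<open>
  The difference of the counting functions is 0 at the last position, so if it leaves both
  \<open>{0, 1}\<close> and \<open>{-1, 0}\<close>, then it spreads over at least 2.
\<close>

lemma not_sorted_pair_gap: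
  fixes I J :: "'n::{finite,linorder} set"
  assumes "card I = card J" "\<not> sorted_pair I J"
  obtains i j where "cnt I i - cnt J i \<ge> cnt I j - cnt J j + 2"
proof -
  obtain a where a: "cnt I a - cnt J a \<notin> {0, 1}" and b: "\<exists>b. cnt J b - cnt I b \<notin> {0, 1}"
    using assms by (auto simp: sorted_pair_iff)
  obtain b where b: "cnt J b - cnt I b \<notin> {0, 1}" using b by blast
  have e: "cnt I (Max UNIV) - cnt J (Max UNIV) = 0" using assms by (simp add: cnt_Max)
  consider "cnt I a - cnt J a \<ge> 2" | "cnt I b - cnt J b \<le> -2"
    | "cnt I a - cnt J a \<le> -1" "cnt I b - cnt J b \<ge> 1"
    using a b by fastforce
  then show thesis
  proof cases
    case 1 then show ?thesis using e by (intro that[of "Max UNIV" a]) linarith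
  next
    case 2 then show ?thesis using e by (intro that[of b "Max UNIV"]) linarith
  next
    case 3 then show ?thesis by (intro that[of a b]) linarith
  qed
qed

lemma eq_if_cnt_eq:
  fixes I J :: "'n::{finite,linorder} set"
  assumes "\<And>j. cnt I j = cnt J j"
  shows "I = J"
proof -
  have *: "A \<subseteq> B" if c: "\<And>j. cnt A j = cnt B j" for A B :: "'n set"
  proof (rule ccontr)
    assume "\<not> A \<subseteq> B"
    then have ne: "{x \<in> A. x \<notin> B} \<noteq> {}" by auto
    define x where "x = Min (A - B \<union> (B - A))"
    have x: "x \<in> A - B \<union> (B - A)" and x2: "\<forall>y\<in>A - B \<union> (B - A). x \<le> y"
      unfolding x_def using Min_in[of "A - B \<union> (B - A)"] ne by auto
    have below: "A \<inter> {..<x} = B \<inter> {..<x}" using x2 by force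
    have A: "A \<inter> {..x} = A \<inter> {..<x} \<union> A \<inter> {x}" for A by (auto simp: le_less)
    have "card (A \<inter> {..x}) = card (A \<inter> {..<x}) + card (A \<inter> {x})" for A :: "'n set"
      unfolding A by (rule card_Un_disjoint) auto
    then have "card (A \<inter> {x}) = card (B \<inter> {x})"
      using below c[of x] by (simp add: cnt_def)
    then show False using x by (auto simp: Int_insert_right split: if_splits)
  qed
  show ?thesis using *[of I J] *[of J I] assms by auto
qed

lemma card_even_below: "card {i. i < N \<and> even i} = (N + 1) div 2"
proof (induction N)
  case (Suc N)
  have "{i. i < Suc N \<and> even i} = (if even N then insert N {i. i < N \<and> even i} else {i. i < N \<and> even i})"
    by (auto simp: less_Suc_eq)
  then show ?case using Suc by auto
qed simp

lemma card_odd_below: "card {i. i < N \<and> odd i} = N div 2"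
proof (induction N)
  case (Suc N)
  have "{i. i < Suc N \<and> odd i} = (if odd N then insert N {i. i < N \<and> odd i} else {i. i < N \<and> odd i})"
    by (auto simp: less_Suc_eq)
  then show ?case using Suc by auto
qed simp

text \<open>
  Of the first \<open>N\<close> entries of the sorted multiset union, half stand at even positions and half at odd
  ones, up to rounding.
\<close>

lemma cnt_sorting:
  fixes I J :: "'n::{finite,linorder} set"
  shows "cnt (fst (sorting I J)) j = (cnt I j + cnt J j + 1) div 2"
    and "cnt (snd (sorting I J)) j = (cnt I j + cnt J j) div 2"
proof -
  define a where "a = sorted_list_of_multiset (mset_set I + mset_set J)"
  have srt: "sorted a" by (simp add: a_def)
  have ms: "mset a = mset_set I + mset_set J" by (simp add: a_def)
  define N where "N = length (filter (\<lambda>x. x \<le> j) a)"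
  have "N = size (filter_mset (\<lambda>x. x \<le> j) (mset a))" by (simp add: N_def flip: mset_filter)
  also have "\<dots> = card (I \<inter> {..j}) + card (J \<inter> {..j})"
    unfolding ms filter_union_mset size_union by (simp add: Int_def)
  finally have N: "int N = cnt I j + cnt J j" by (simp add: cnt_def)
  \<comment> \<open>an element occurs at most twice, so entries two places apart differ\<close>
  have two: "a ! p < a ! q" if pq: "p + 2 \<le> q" "q < length a" for p q
  proof (rule ccontr)
    assume "\<not> a ! p < a ! q"
    then have qp: "a ! q \<le> a ! p" by simp
    have const: "a ! r = a ! p" if "r \<in> {p..q}" for r
    proof (rule antisym)
      have "a ! r \<le> a ! q" using that pq by (intro sorted_nth_mono[OF srt]) auto
      then show "a ! r \<le> a ! p" using qp by simp
      show "a ! p \<le> a ! r" using that pq by (intro sorted_nth_mono[OF srt]) auto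
    qed
    have "{p..q} \<subseteq> {i. i < length a \<and> a ! i = a ! p}"
    proof
      fix r assume "r \<in> {p..q}"
      then show "r \<in> {i. i < length a \<and> a ! i = a ! p}" using const[of r] pq by simp
    qed
    then have "card {p..q} \<le> card {i. i < length a \<and> a ! i = a ! p}" by (intro card_mono) auto
    also have "\<dots> = card {i. i < length a \<and> a ! p = a ! i}"
      by (rule arg_cong[where f=card]) auto
    also have "\<dots> = count (mset a) (a ! p)"
      by (simp add: count_mset count_list_eq_length_filter length_filter_conv_card)
    also have "\<dots> \<le> 2" unfolding ms by (simp add: count_mset_set')
    finally show False using pq by simp
  qed
  have inj: "inj_on ((!) a) {i. i < length a \<and> P i}" if "\<And>p q. P p \<Longrightarrow> P q \<Longrightarrow> p < q \<Longrightarrow> p + 2 \<le> q" for P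
  proof (rule linorder_inj_onI)
    fix p q assume "p < q" "p \<in> {i. i < length a \<and> P i}" "q \<in> {i. i < length a \<and> P i}"
    then show "a ! p \<noteq> a ! q" using two[of p q] that[of p q] by auto
  qed auto
  have le: "a ! i \<le> j \<longleftrightarrow> i < N" if "i < length a" for i
  proof -
    have "filter (\<lambda>x. x \<le> j) a = takeWhile (\<lambda>x. x \<le> j) a"
      using srt
      by (induction a) (auto simp: filter_empty_conv takeWhile_eq_Nil_iff neq_Nil_conv; metis order_trans)+
    then have N': "N = length (takeWhile (\<lambda>x. x \<le> j) a)" by (simp add: N_def)
    show ?thesis
    proof
      assume "i < N"
      then show "a ! i \<le> j" unfolding N'
        by (metis nth_mem set_takeWhileD takeWhile_nth)
    next
      assume h: "a ! i \<le> j"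
      show "i < N"
      proof (rule ccontr)
        assume "\<not> i < N"
        then have "N < length a" "a ! N \<le> a ! i"
          using that sorted_nth_mono[OF srt, of N i] by auto
        moreover have "\<not> a ! N \<le> j"
          using nth_length_takeWhile[of "\<lambda>x. x \<le> j" a] \<open>N < length a\<close> unfolding N' by simp
        ultimately show False using h by simp
      qed
    qed
  qed
  have N_le: "N \<le> length a" by (simp add: N_def)
  have gen: "card ({a ! i | i. i < length a \<and> P i} \<inter> {..j}) = card {i. i < N \<and> P i}"
    if "\<And>p q. P p \<Longrightarrow> P q \<Longrightarrow> p < q \<Longrightarrow> p + 2 \<le> q" for P
  proof -
    have "{a ! i | i. i < length a \<and> P i} \<inter> {..j} = (!) a ` {i. i < N \<and> P i}"
      using le N_le by (auto simp: image_iff)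
    moreover have "inj_on ((!) a) {i. i < N \<and> P i}"
      by (rule inj_on_subset[OF inj[OF that]]) (use N_le in auto)
    ultimately show ?thesis by (simp add: card_image)
  qed
  have "card ({a ! i | i. i < length a \<and> even i} \<inter> {..j}) = (N + 1) div 2"
    by (subst gen) (auto simp: card_even_below elim!: evenE)
  then show "cnt (fst (sorting I J)) j = (cnt I j + cnt J j + 1) div 2"
    unfolding sorting_def Let_def a_def[symmetric] N[symmetric] by (simp add: cnt_def zdiv_int)
  have "card ({a ! i | i. i < length a \<and> odd i} \<inter> {..j}) = N div 2"
    by (subst gen) (auto simp: card_odd_below elim!: oddE)
  then show "cnt (snd (sorting I J)) j = (cnt I j + cnt J j) div 2"
    unfolding sorting_def Let_def a_def[symmetric] N[symmetric] by (simp add: cnt_def zdiv_int)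
qed

text \<open>
  Two integers that differ by at most 1 are determined, up to order, by their sum.
\<close>

lemma sorted_pair_is_sorting:
  fixes P Q I J :: "'n::{finite,linorder} set"
  assumes "card P = card Q" "sorted_pair P Q" "\<And>j. cnt P j + cnt Q j = cnt I j + cnt J j"
  shows "(P = fst (sorting I J) \<and> Q = snd (sorting I J)) \<or>
         (Q = fst (sorting I J) \<and> P = snd (sorting I J))"
proof -
  have *: "A = fst (sorting I J) \<and> B = snd (sorting I J)"
    if "\<forall>j. cnt A j - cnt B j \<in> {0, 1}" "\<And>j. cnt A j + cnt B j = cnt I j + cnt J j" for A B
  proof -
    have "cnt A j = cnt (fst (sorting I J)) j \<and> cnt B j = cnt (snd (sorting I J)) j" for j
      unfolding cnt_sorting using that(1)[rule_format, of j] that(2)[of j, symmetric] by auto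
    then show ?thesis using eq_if_cnt_eq by metis
  qed
  from assms(1,2) consider "\<forall>j. cnt P j - cnt Q j \<in> {0, 1}" | "\<forall>j. cnt Q j - cnt P j \<in> {0, 1}"
    by (auto simp: sorted_pair_iff)
  then show ?thesis
  proof cases
    case 1 show ?thesis using *[OF 1 assms(3)] by blast
  next
    case 2 show ?thesis using *[OF 2] assms(3) by (simp add: add.commute)
  qed
qed

section \<open>Supermodularity on the lattice of counting functions\<close>

text \<open>
  A vector \<open>z\<close> stands for the subset of \<open>{..<n}\<close> whose counting function is \<open>z\<close> up to an additive
  constant. The constant is recovered as \<open>z (n - 1) - k\<close>, which is the value to be placed before
  \<open>z 0\<close>; thus positions are treated cyclically and shifting \<open>z\<close> by a constant changes nothing.
\<close>

definition step :: "nat \<Rightarrow> nat \<Rightarrow> (nat \<Rightarrow> int) \<Rightarrow> nat \<Rightarrow> int" where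
  "step n k z j = (if j = 0 then z 0 + int k - z (n - 1) else z j - z (j - 1))"

definition admissible :: "nat \<Rightarrow> nat \<Rightarrow> (nat \<Rightarrow> int) \<Rightarrow> bool" where
  "admissible n k z \<longleftrightarrow> (\<forall>j<n. step n k z j \<in> {0, 1})"

definition step_set :: "nat \<Rightarrow> nat \<Rightarrow> (nat \<Rightarrow> int) \<Rightarrow> nat set" where
  "step_set n k z = {j. j < n \<and> step n k z j = 1}"

text \<open>
  Raising one entry of a counting function moves an element of the set to the position before it; at
  the last position it moves the element 0 to \<open>n - 1\<close>.
\<close>

definition bump :: "nat \<Rightarrow> (nat \<Rightarrow> int) \<Rightarrow> nat \<Rightarrow> int" where
  "bump i z = z(i := z i + 1)"

text \<open>
  Among the three ways to split \<open>a < b < c < d\<close> into two pairs, the crossing one is the best.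
\<close>

definition strict_three_term :: "nat \<Rightarrow> nat \<Rightarrow> (nat set \<Rightarrow> real) \<Rightarrow> bool" where
  "strict_three_term n k g \<longleftrightarrow>
    (\<forall>K a b c d. K \<subseteq> {..<n} \<longrightarrow> card K + 2 = k \<longrightarrow> K \<inter> {a, b, c, d} = {} \<longrightarrow>
       a < b \<longrightarrow> b < c \<longrightarrow> c < d \<longrightarrow> d < n \<longrightarrow>
       g (K \<union> {a, d}) + g (K \<union> {b, c}) < g (K \<union> {a, c}) + g (K \<union> {b, d}) \<and>
       g (K \<union> {a, b}) + g (K \<union> {c, d}) < g (K \<union> {a, c}) + g (K \<union> {b, d}))"

lemma sum_step:
  assumes "n > 0"
  shows "(\<Sum>j<n. step n k z j) = int k"
proof -
  have "(\<Sum>j<Suc m. step n k z j) = z m + int k - z (n - 1)" for m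
    by (induction m) (auto simp: step_def)
  from this[of "n - 1"] show ?thesis using assms by simp
qed

lemma card_step_set:
  assumes "n > 0" "admissible n k z"
  shows "card (step_set n k z) = k"
proof -
  have "int (card (step_set n k z)) = (\<Sum>j\<in>step_set n k z. 1)" by simp
  also have "\<dots> = (\<Sum>j<n. step n k z j)"
    using assms(2) by (intro sum.mono_neutral_cong_left) (auto simp: step_set_def admissible_def)
  finally show ?thesis using sum_step[OF assms(1)] by simp
qed

lemma step_cong:
  assumes "\<And>i. i < n \<Longrightarrow> z i = w i" "j < n"
  shows "step n k z j = step n k w j"
  using assms by (auto simp: step_def)

lemma diff_min_max_in_01:
  fixes a b c d :: int
  assumes "a - c \<in> {0, 1}" "b - d \<in> {0, 1}"
  shows "min a b - min c d \<in> {0, 1}" "max a b - max c d \<in> {0, 1}"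
proof -
  consider "a = c" "b = d" | "a = c" "b = d + 1" | "a = c + 1" "b = d" | "a = c + 1" "b = d + 1"
    using assms by fastforce
  then have "min a b - min c d \<in> {0, 1} \<and> max a b - max c d \<in> {0, 1}"
    by cases (auto simp: min_def max_def)
  then show "min a b - min c d \<in> {0, 1}" "max a b - max c d \<in> {0, 1}" by blast+
qed

text \<open>
  The conditions on \<open>z\<close> bound differences of two entries; such conditions always define a sublattice.
\<close>

lemma admissible_min_max:
  assumes "admissible n k p" "admissible n k q"
  shows "admissible n k (\<lambda>j. min (p j) (q j))" "admissible n k (\<lambda>j. max (p j) (q j))"
proof -
  have "step n k (\<lambda>j. min (p j) (q j)) j \<in> {0, 1} \<and> step n k (\<lambda>j. max (p j) (q j)) j \<in> {0, 1}"
    if j: "j < n" for j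
  proof (cases "j = 0")
    case True
    have "p 0 + int k - p (n - 1) \<in> {0, 1}" "q 0 + int k - q (n - 1) \<in> {0, 1}"
      using assms j True by (auto simp: admissible_def step_def)
    from diff_min_max_in_01[OF this] show ?thesis
      by (simp add: step_def True min_add_distrib_left max_add_distrib_left)
  next
    case False
    have "p j - p (j - 1) \<in> {0, 1}" "q j - q (j - 1) \<in> {0, 1}"
      using assms j False by (auto simp: admissible_def step_def)
    from diff_min_max_in_01[OF this] show ?thesis
      by (simp add: step_def False)
  qed
  then show "admissible n k (\<lambda>j. min (p j) (q j))" "admissible n k (\<lambda>j. max (p j) (q j))"
    by (auto simp: admissible_def)
qed

text \<open>
  Any two comparable admissible vectors are joined by a chain of single bumps. An entry that may not be
  raised first is blocked by one of its two cyclic neighbours, which must then also be raised; the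
  quantity \<open>n * m j - k * j\<close> strictly decreases along these blockings, around the cycle as well, so a
  position that minimizes it is not blocked.
\<close>

lemma exists_bump:
  assumes n: "0 < k" "k < n" and m: "admissible n k m" and p: "admissible n k p"
    and le: "\<And>j. j < n \<Longrightarrow> m j \<le> p j" and ne: "\<exists>j<n. m j < p j"
  obtains i where "i < n" "m i < p i" "admissible n k (bump i m)"
proof -
  define T where "T = {j. j < n \<and> m j < p j}"
  define phi where "phi j = int n * m j - int k * int j" for j
  have "finite T" "T \<noteq> {}" using ne by (auto simp: T_def)
  then obtain i where i: "i \<in> T" and min: "\<And>j. j \<in> T \<Longrightarrow> phi i \<le> phi j"
    using finite_has_minimal[of "phi ` T"]
    by (metis (no_types, lifting) arg_min_if_finite(1) arg_min_least)
  have i_n: "i < n" and mi: "m i < p i" using i by (auto simp: T_def)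
  have sm: "step n k m j \<in> {0, 1}" and sp: "step n k p j \<in> {0, 1}" if "j < n" for j
    using m p that by (auto simp: admissible_def)
  \<comment> \<open>otherwise the cyclic predecessor of \<open>i\<close> is in \<open>T\<close> as well, with a smaller \<open>phi\<close>\<close>
  have s0: "step n k m i = 0"
  proof (rule ccontr)
    assume "step n k m i \<noteq> 0"
    then have s1: "step n k m i = 1" using sm[OF i_n] by auto
    show False
    proof (cases "i = 0")
      case True
      have "m (n - 1) < p (n - 1)"
        using s1 sp[OF i_n] mi True by (auto simp: step_def)
      then have "n - 1 \<in> T" using n by (auto simp: T_def)
      then have "phi 0 \<le> phi (n - 1)" using min True by simp
      moreover have "m 0 = m (n - 1) + 1 - int k" using s1 True by (simp add: step_def)
      ultimately have "int n * (m (n - 1) + 1 - int k) \<le> int n * m (n - 1) - int k * int (n - 1)"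
        by (simp add: phi_def)
      then have "int n * (1 - int k) \<le> - (int k * int (n - 1))"
        by (simp add: algebra_simps)
      moreover have "int (n - 1) = int n - 1" using n by simp
      ultimately show False using n by (simp add: algebra_simps)
    next
      case False
      have "m (i - 1) < p (i - 1)"
        using s1 sp[OF i_n] mi False by (auto simp: step_def)
      then have "i - 1 \<in> T" using i_n by (auto simp: T_def)
      then have "phi i \<le> phi (i - 1)" using min by simp
      moreover have "m i = m (i - 1) + 1" using s1 False by (simp add: step_def)
      moreover have "int (i - 1) = int i - 1" using False by simp
      ultimately show False using n by (simp add: phi_def algebra_simps)
    qed
  qed
  define i' where "i' = (if i = n - 1 then 0 else i + 1)"
  have i': "i' < n" using i_n n by (auto simp: i'_def)
  \<comment> \<open>otherwise the cyclic successor of \<open>i\<close> is in \<open>T\<close> as well, with a smaller \<open>phi\<close>\<close>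
  have s1: "step n k m i' = 1"
  proof (rule ccontr)
    assume "step n k m i' \<noteq> 1"
    then have s1: "step n k m i' = 0" using sm[OF i'] by auto
    have "m i' < p i'"
      using s1 sp[OF i'] mi by (auto simp: step_def i'_def split: if_splits)
    then have le: "phi i \<le> phi i'" using min i' by (auto simp: T_def)
    show False
    proof (cases "i = n - 1")
      case True
      then have m: "m (n - 1) = m 0 + int k" using s1 by (simp add: step_def i'_def)
      have "int n * m (n - 1) - int k * int (n - 1) \<le> int n * m 0"
        using le True by (simp add: phi_def i'_def)
      then have "int n * int k \<le> int k * int (n - 1)"
        unfolding m by (simp add: algebra_simps)
      moreover have "int (n - 1) = int n - 1" using n by simp
      ultimately show False using n by (simp add: algebra_simps)
    next
      case False
      then have "m i' = m i" using s1 by (simp add: step_def i'_def)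
      then show False using le n False by (simp add: phi_def i'_def algebra_simps)
    qed
  qed
  have "i' \<noteq> i" using s0 s1 by auto
  have "step n k (bump i m) j = (if j = i then 1 else if j = i' then 0 else step n k m j)" if "j < n" for j
  proof -
    consider "j = i" | "j = i'" | "j \<noteq> i" "j \<noteq> i'" by blast
    then show ?thesis
    proof cases
      case 1
      then show ?thesis using s0 n \<open>i' \<noteq> i\<close> by (auto simp: step_def bump_def split: if_splits)
    next
      case 2
      then show ?thesis using s1 \<open>i' \<noteq> i\<close> by (auto simp: step_def bump_def i'_def split: if_splits)
    next
      case 3
      then show ?thesis using that by (auto simp: step_def bump_def i'_def split: if_splits)
    qed
  qed
  then have "admissible n k (bump i m)" using sm by (auto simp: admissible_def)
  then show thesis using that i_n mi by blast
qed

lemma step_bump: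
  assumes "i < n" "j < n" "n \<ge> 2"
  shows "step n k (bump i z) j = step n k z j + (if j = i then 1 else 0)
           - (if j = (if i = n - 1 then 0 else i + 1) then 1 else 0)"
proof (cases "j = 0")
  case True
  then show ?thesis using assms by (cases "i = 0"; cases "i = n - 1") (simp_all add: step_def bump_def)
next
  case False
  then have *: "(j = (if i = n - 1 then 0 else i + 1)) = (i = j - 1)" using assms by auto
  have "j - 1 \<noteq> j" using False by simp
  then show ?thesis
    unfolding * using False by (cases "i = j"; cases "i = j - 1") (simp_all add: step_def bump_def)
qed

lemma step_set_bump:
  assumes i: "i < n" and n: "n \<ge> 2" and adm: "admissible n k z" "admissible n k (bump i z)"
  defines "i' \<equiv> (if i = n - 1 then 0 else i + 1)"
  shows "i \<notin> step_set n k z" "i' \<in> step_set n k z"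
    "step_set n k (bump i z) = insert i (step_set n k z - {i'})"
proof -
  have i': "i' < n" "i' \<noteq> i" using i n by (auto simp: i'_def)
  have z: "step n k z l \<in> {0, 1}" "step n k (bump i z) l \<in> {0, 1}" if "l < n" for l
    using adm that unfolding admissible_def by simp_all
  have b: "step n k (bump i z) l = step n k z l + (if l = i then 1 else 0) - (if l = i' then 1 else 0)"
    if "l < n" for l
    using step_bump[OF i that n] unfolding i'_def .
  have si: "step n k z i = 0" using z[OF i] b[OF i] i' by auto
  have si': "step n k z i' = 1" using z[OF i'(1)] b[OF i'(1)] i' by auto
  show "i \<notin> step_set n k z" "i' \<in> step_set n k z"
    using si si' i' by (auto simp: step_set_def)
  show "step_set n k (bump i z) = insert i (step_set n k z - {i'})"
  proof (rule set_eqI)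
    fix l
    show "l \<in> step_set n k (bump i z) \<longleftrightarrow> l \<in> insert i (step_set n k z - {i'})"
    proof (cases "l < n")
      case True
      then show ?thesis using b[OF True] si si' i' by (simp add: step_set_def)
    next
      case False
      then show ?thesis using i by (auto simp: step_set_def)
    qed
  qed
qed

text \<open>
  On a unit square of the lattice the sets involve only the four elements \<open>i\<close>, \<open>i + 1\<close>, \<open>j\<close> and the
  cyclic successor of \<open>j\<close>. If \<open>j\<close> is the last position, this successor is 0 and the second three-term
  inequality is needed; otherwise the first.
\<close>

lemma local_supermodular:
  assumes g: "strict_three_term n k g" and n: "n \<ge> 2" and ij: "i < j" "j < n"
    and adm: "admissible n k z" "admissible n k (bump i z)" "admissible n k (bump j z)"
      "admissible n k (bump i (bump j z))"
  shows "g (step_set n k (bump i z)) + g (step_set n k (bump j z))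
       < g (step_set n k z) + g (step_set n k (bump i (bump j z)))"
proof -
  define j' where "j' = (if j = n - 1 then 0 else j + 1)"
  have i: "i < n" and i': "(if i = n - 1 then 0 else i + 1) = i + 1" using ij by auto
  have j'n: "j' < n" "j \<noteq> j'" using ij n by (auto simp: j'_def)
  note bi = step_set_bump[OF i n adm(1,2), unfolded i']
  note bj = step_set_bump[OF ij(2) n adm(1,3), folded j'_def]
  note bij = step_set_bump[OF i n adm(3,4), unfolded i']
  have ne: "i \<noteq> j" "i \<noteq> j'" "i + 1 \<noteq> j" using ij bi(1,2) bj(1,2) by auto
  have ne2: "i + 1 \<noteq> j'" using ne by (auto simp: j'_def split: if_splits)
  define K where "K = step_set n k z - {i + 1, j'}"
  have S: "step_set n k z = K \<union> {i + 1, j'}"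
    using bi(2) bj(2) by (auto simp: K_def)
  have Si: "step_set n k (bump i z) = K \<union> {i, j'}"
    unfolding bi(3) using bj(2) ne2 by (auto simp: K_def)
  have Sj: "step_set n k (bump j z) = K \<union> {i + 1, j}"
    unfolding bj(3) using bi(2) ne2 by (auto simp: K_def)
  have Sij: "step_set n k (bump i (bump j z)) = K \<union> {i, j}"
    unfolding bij(3) Sj using ne by (auto simp: K_def)
  have fK: "finite K" by (simp add: K_def step_set_def)
  have "card (step_set n k z) = card K + 2"
    unfolding S using ne2 fK by (subst card_Un_disjoint) (auto simp: K_def)
  then have cK: "card K + 2 = k" using card_step_set[OF _ adm(1)] n by simp
  have K: "K \<subseteq> {..<n}" "K \<inter> {i, i + 1, j, j'} = {}"
    using bi(1) bj(1) by (auto simp: K_def step_set_def)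
  show ?thesis
  proof (cases "j = n - 1")
    case True
    then have j': "j' = 0" by (simp add: j'_def)
    have o: "0 < i" "i + 1 < j" using ne j' ij by auto
    have "K \<inter> {0, i, i + 1, j} = {}" using K j' by auto
    then have "g (K \<union> {0, i}) + g (K \<union> {i + 1, j}) < g (K \<union> {0, i + 1}) + g (K \<union> {i, j})"
      using g[unfolded strict_three_term_def, rule_format, of K 0 i "i + 1" j] K(1) cK o ij by simp
    then show ?thesis unfolding S Si Sj Sij j' by (simp add: insert_commute)
  next
    case False
    then have j': "j' = j + 1" by (simp add: j'_def)
    have o: "i + 1 < j" "j + 1 < n" using ne ij j'n j' by auto
    then have "g (K \<union> {i, j + 1}) + g (K \<union> {i + 1, j}) < g (K \<union> {i, j}) + g (K \<union> {i + 1, j + 1})"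
      using g[unfolded strict_three_term_def, rule_format, of K i "i + 1" j "j + 1"] K cK ij j' by simp
    then show ?thesis unfolding S Si Sj Sij j' by (simp add: insert_commute)
  qed
qed

lemma step_set_cong:
  assumes "\<And>i. i < n \<Longrightarrow> z i = w i"
  shows "step_set n k z = step_set n k w"
  using step_cong[OF assms] by (auto simp: step_set_def)

lemma admissible_cong:
  assumes "\<And>i. i < n \<Longrightarrow> z i = w i"
  shows "admissible n k z \<longleftrightarrow> admissible n k w"
  using step_cong[OF assms] by (auto simp: admissible_def)

text \<open>
  A rectangle of the lattice that is not a unit square is cut into two smaller ones by a single bump on one
  of its sides; adding the two inequalities cancels the values on the cut.
\<close>

lemma strict_supermodular:
  assumes g: "strict_three_term n k g" and n: "0 < k" "k < n"
    and adm: "admissible n k p" "admissible n k q"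
    and inc: "\<exists>j<n. p j < q j" "\<exists>j<n. q j < p j"
  shows "g (step_set n k p) + g (step_set n k q)
    < g (step_set n k (\<lambda>j. min (p j) (q j))) + g (step_set n k (\<lambda>j. max (p j) (q j)))"
  using adm inc
proof (induction "nat (\<Sum>j<n. \<bar>p j - q j\<bar>)" arbitrary: p q rule: less_induct)
  case less
  let ?G = "\<lambda>z. g (step_set n k z)"
  let ?d = "\<lambda>p q. (\<Sum>j<n. \<bar>p j - q j :: int\<bar>)"
  have split: "?G p + ?G q < ?G (\<lambda>j. min (p j) (q j)) + ?G (\<lambda>j. max (p j) (q j))"
    if p: "admissible n k p" and q: "admissible n k q" and lt: "\<exists>j<n. p j < q j"
      and i: "i < n" "q i < p i" and b: "admissible n k (bump i (\<lambda>j. min (p j) (q j)))"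
      and ne: "\<exists>j<n. p j \<noteq> bump i (\<lambda>j. min (p j) (q j)) j"
      and size: "?d p q = ?d p0 q0"
      and IH: "\<And>p q. nat (?d p q) < nat (?d p0 q0) \<Longrightarrow> admissible n k p \<Longrightarrow> admissible n k q \<Longrightarrow>
          \<exists>j<n. p j < q j \<Longrightarrow> \<exists>j<n. q j < p j \<Longrightarrow>
          ?G p + ?G q < ?G (\<lambda>j. min (p j) (q j)) + ?G (\<lambda>j. max (p j) (q j))"
    for p q i p0 q0
  proof -
    define m where "m = (\<lambda>j. min (p j) (q j))"
    define p' where "p' = bump i m"
    define q' where "q' = (\<lambda>j. max (p' j) (q j))"
    have p'_le: "p' j \<le> p j" for j using i by (auto simp: p'_def m_def bump_def)
    have adm': "admissible n k p'" "admissible n k q'"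
      using b admissible_min_max[of n k p' q] q by (auto simp: p'_def q'_def m_def)
    obtain j where j: "j < n" "p' j < p j"
      using ne p'_le unfolding p'_def[symmetric] m_def[symmetric] by (metis le_less)
    obtain l where l: "l < n" "p l < q l" using lt by blast
    have nn: "0 \<le> ?d a b" for a b by (intro sum_nonneg) auto
    have "?d p' q < ?d p q"
    proof (rule sum_strict_mono_ex1)
      show "\<forall>x\<in>{..<n}. \<bar>p' x - q x\<bar> \<le> \<bar>p x - q x\<bar>"
        using i by (auto simp: p'_def m_def bump_def)
      show "\<exists>x\<in>{..<n}. \<bar>p' x - q x\<bar> < \<bar>p x - q x\<bar>"
        using j i by (intro bexI[of _ j]) (auto simp: p'_def m_def bump_def min_def split: if_splits)
    qed simp
    then have s1: "nat (?d p' q) < nat (?d p0 q0)" using size nn[of p' q] unfolding zless_nat_conj by linarith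
    have "?d p q' < ?d p q"
    proof (rule sum_strict_mono_ex1)
      show "\<forall>x\<in>{..<n}. \<bar>p x - q' x\<bar> \<le> \<bar>p x - q x\<bar>"
        using i by (auto simp: q'_def p'_def m_def bump_def)
      show "\<exists>x\<in>{..<n}. \<bar>p x - q' x\<bar> < \<bar>p x - q x\<bar>"
        using i by (intro bexI[of _ i]) (auto simp: q'_def p'_def m_def bump_def)
    qed simp
    then have s2: "nat (?d p q') < nat (?d p0 q0)" using size nn[of p q'] unfolding zless_nat_conj by linarith
    have "\<exists>j<n. p' j < q j" using l i p'_le[of l] by (intro exI[of _ l]) auto
    moreover have "\<exists>j<n. q j < p' j" using i by (intro exI[of _ i]) (auto simp: p'_def m_def bump_def)
    ultimately have 1: "?G p' + ?G q < ?G (\<lambda>j. min (p' j) (q j)) + ?G (\<lambda>j. max (p' j) (q j))"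
      using IH[OF s1 adm'(1) q] by blast
    have "\<exists>j<n. p j < q' j" using l by (intro exI[of _ l]) (auto simp: q'_def)
    moreover have "\<exists>j<n. q' j < p j"
      using j i by (intro exI[of _ j]) (auto simp: q'_def p'_def m_def bump_def min_def split: if_splits)
    ultimately have 2: "?G p + ?G q' < ?G (\<lambda>j. min (p j) (q' j)) + ?G (\<lambda>j. max (p j) (q' j))"
      using IH[OF s2 p adm'(2)] by blast
    have "(\<lambda>j. min (p' j) (q j)) = m" using i by (auto simp: p'_def m_def bump_def)
    moreover have "(\<lambda>j. min (p j) (q' j)) = p'"
    proof
      fix x show "min (p x) (q' x) = p' x"
        using i p'_le[of x] by (auto simp: q'_def p'_def m_def bump_def min_def max_def split: if_splits)
    qed
    moreover have "(\<lambda>j. max (p j) (q' j)) = (\<lambda>j. max (p j) (q j))"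
    proof
      fix x show "max (p x) (q' x) = max (p x) (q x)"
        using p'_le[of x] by (simp add: q'_def)
    qed
    ultimately show ?thesis using 1 2 by (simp add: m_def q'_def)
  qed
  define m where "m = (\<lambda>j. min (p j) (q j))"
  have m: "admissible n k m" using less.prems admissible_min_max by (simp add: m_def)
  obtain i where i: "i < n" "m i < p i" "admissible n k (bump i m)"
    using exists_bump[OF n m less.prems(1)] less.prems(4) by (force simp: m_def)
  obtain j where j: "j < n" "m j < q j" "admissible n k (bump j m)"
    using exists_bump[OF n m less.prems(2)] less.prems(3) by (force simp: m_def)
  have ij: "q i < p i" "p j < q j" using i j by (auto simp: m_def)
  have cm: "(\<lambda>j. min (q j) (p j)) = m" "(\<lambda>j. max (q j) (p j)) = (\<lambda>j. max (p j) (q j))"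
    by (auto simp: m_def min.commute max.commute)
  have dc: "?d q p = ?d p q" by (intro sum.cong) auto
  show ?case
  proof (cases "\<exists>l<n. p l \<noteq> bump i m l")
    case True
    show ?thesis
      by (rule split[OF less.prems(1,2,3) i(1) ij(1) i(3)[unfolded m_def] True[unfolded m_def] refl])
        (rule less.hyps; assumption)
  next
    case up: False
    show ?thesis
    proof (cases "\<exists>l<n. q l \<noteq> bump j m l")
      case True
      have "?G q + ?G p < ?G (\<lambda>j. min (q j) (p j)) + ?G (\<lambda>j. max (q j) (p j))"
        by (rule split[OF less.prems(2,1,4) j(1) ij(2) j(3)[folded cm(1)] True[folded cm(1)] dc])
          (rule less.hyps; assumption)
      then show ?thesis using cm by (simp add: m_def)
    next
      case False
      have mx: "(max (p l) (q l)) = bump i (bump j m) l" if "l < n" for l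
      proof -
        have "p l = bump i m l" "q l = bump j m l" "i \<noteq> j" using up False that ij by auto
        then show ?thesis by (auto simp: bump_def)
      qed
      have e: "?G p = ?G (bump i m)" "?G q = ?G (bump j m)" "?G (\<lambda>l. max (p l) (q l)) = ?G (bump i (bump j m))"
        using up False mx by (auto intro!: arg_cong[where f=g] step_set_cong)
      have "admissible n k (\<lambda>l. max (p l) (q l))"
        using less.prems admissible_min_max by blast
      then have adm: "admissible n k (bump i (bump j m))"
        using admissible_cong[of n "\<lambda>l. max (p l) (q l)" "bump i (bump j m)" k] mx by blast
      have c: "bump i (bump j m) = bump j (bump i m)" using ij by (auto simp: bump_def fun_upd_twist)
      have "i \<noteq> j" using ij by auto
      then consider "i < j" | "j < i" by linarith
      then have "?G (bump i m) + ?G (bump j m) < ?G m + ?G (bump i (bump j m))"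
      proof cases
        case 1
        show ?thesis using local_supermodular[OF g _ 1 j(1) m i(3) j(3) adm] n by simp
      next
        case 2
        show ?thesis using local_supermodular[OF g _ 2 i(1) m j(3) i(3)] adm c n by simp
      qed
      then show ?thesis using e by (simp add: m_def)
    qed
  qed
qed

section \<open>Three-term relations between maximal minors\<close>

text \<open>
  Columns are listed instead of collected in a set so that signs can be tracked: exchanging neighbours
  in the list flips the sign.
\<close>

definition col_det :: "real^'n^'k::{finite,linorder} \<Rightarrow> 'n list \<Rightarrow> real" where
  "col_det A xs = det (\<chi> i j. A $ i $ (xs ! card {..<j}) :: ((real, 'k) vec, 'k) vec)"

lemma maximal_minor_eq_col_det: "maximal_minor A I = col_det A (sorted_list_of_set I)"
  by (simp add: maximal_minor_def col_det_def nth_column_def)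

lemma position_eq_iff: "card {..<i} = card {..<j} \<longleftrightarrow> i = j" for i j :: "'k::{finite,linorder}"
proof
  assume eq: "card {..<i} = card {..<j}"
  show "i = j"
  proof (rule ccontr)
    assume "i \<noteq> j"
    then have "{..<i} \<subset> {..<j} \<or> {..<j} \<subset> {..<i}" by (cases i j rule: linorder_cases) auto
    then show False using eq psubset_card_mono[of "{..<i}" "{..<j}"] psubset_card_mono[of "{..<j}" "{..<i}"] by auto
  qed
qed simp

lemma exists_position:
  assumes "m < CARD('k::{finite,linorder})"
  shows "\<exists>j::'k. card {..<j} = m"
proof -
  have "inj (\<lambda>j::'k. card {..<j})" by (auto intro!: injI simp: position_eq_iff)
  then have "card (range (\<lambda>j::'k. card {..<j})) = CARD('k)" by (simp add: card_image)
  moreover have "range (\<lambda>j::'k. card {..<j}) \<subseteq> {..<CARD('k)}" using card_lessThan_less_CARD by auto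
  ultimately have "range (\<lambda>j::'k. card {..<j}) = {..<CARD('k)}" by (intro card_subset_eq) auto
  then show ?thesis using assms by (metis imageE lessThan_iff)
qed

lemma col_det_swap:
  fixes A :: "real^'n^'k::{finite,linorder}"
  assumes len: "length (xs @ u # v # ys) = CARD('k)"
  shows "col_det A (xs @ v # u # ys) = - col_det A (xs @ u # v # ys)"
proof -
  obtain p q :: 'k where p: "card {..<p} = length xs" and q: "card {..<q} = Suc (length xs)"
    using exists_position[where 'k='k, of "length xs"] exists_position[where 'k='k, of "Suc (length xs)"] len by auto
  have pq: "p \<noteq> q" using p q by auto
  let ?M = "\<chi> i j. A $ i $ ((xs @ u # v # ys) ! card {..<j}) :: ((real, 'k) vec, 'k) vec"
  have "(xs @ v # u # ys) ! card {..<j} = (xs @ u # v # ys) ! card {..<Transposition.transpose p q j}" for j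
  proof -
    consider "j = p" | "j = q" | "j \<noteq> p" "j \<noteq> q" by blast
    then show ?thesis
    proof cases
      case 3
      then have "card {..<j} \<noteq> length xs" "card {..<j} \<noteq> Suc (length xs)"
        using p q position_eq_iff by metis+
      then have "(xs @ v # u # ys) ! card {..<j} = (xs @ u # v # ys) ! card {..<j}"
        by (auto simp: nth_append nth_Cons split: nat.splits)
      then show ?thesis using 3 by (simp add: Transposition.transpose_def)
    qed (simp_all add: p q nth_append)
  qed
  then have "col_det A (xs @ v # u # ys) = det (\<chi> i j. ?M $ i $ Transposition.transpose p q j :: ((real, 'k) vec, 'k) vec)"
    by (simp add: col_det_def)
  also have "\<dots> = - det ?M"
    using pq by (subst det_permute_columns) (auto simp: permutes_swap_id sign_swap_id)
  finally show ?thesis by (simp add: col_det_def)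
qed

lemma col_det_move:
  fixes A :: "real^'n^'k::{finite,linorder}"
  assumes "length (xs @ ys @ u # zs) = CARD('k)"
  shows "col_det A (xs @ ys @ u # zs) = (-1) ^ length ys * col_det A (xs @ u # ys @ zs)"
  using assms
proof (induction ys arbitrary: xs)
  case (Cons y ys)
  have "col_det A (xs @ (y # ys) @ u # zs) = (-1) ^ length ys * col_det A (xs @ y # u # ys @ zs)"
    using Cons.IH[of "xs @ [y]"] Cons.prems by simp
  also have "col_det A (xs @ y # u # ys @ zs) = - col_det A (xs @ u # y # ys @ zs)"
    by (rule col_det_swap) (use Cons.prems in simp)
  finally show ?case by simp
qed simp

text \<open>
  With the two extra columns moved to the front, the sign is a product of one factor for \<open>u\<close> and one for
  \<open>v\<close>. In a product of two minors in which each of \<open>a\<close>, \<open>b\<close>, \<open>c\<close>, \<open>d\<close> occurs once, the total sign is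
  then the same for all three pairings.
\<close>

lemma maximal_minor_insert2:
  fixes A :: "real^'n::{finite,linorder}^'k::{finite,linorder}"
  assumes K: "card K + 2 = CARD('k)" and uv: "u < v" "u \<notin> K" "v \<notin> K"
  shows "maximal_minor A (K \<union> {u, v}) =
    (-1) ^ card (K \<inter> {..<u}) * (-1) ^ card (K \<inter> {..<v}) * col_det A (u # v # sorted_list_of_set K)"
proof -
  define X Y Z where "X = sorted_list_of_set (K \<inter> {..<u})"
    and "Y = sorted_list_of_set (K \<inter> {u<..<v})" and "Z = sorted_list_of_set (K \<inter> {v<..})"
  note d = X_def Y_def Z_def
  have *: "sorted_list_of_set S = xs" if "sorted_wrt (<) xs" "set xs = S" for S and xs :: "'n list"
    using strict_sorted_equal[of "sorted_list_of_set S" xs] that by auto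
  have eq1: "sorted_list_of_set (K \<union> {u, v}) = X @ u # Y @ v # Z"
    using uv by (intro *) (auto simp: d sorted_wrt_append)
  have eq2: "sorted_list_of_set K = X @ Y @ Z"
  proof (rule *)
    show "sorted_wrt (<) (X @ Y @ Z)" using uv by (auto simp: d sorted_wrt_append)
    have "x < u \<or> u < x \<and> x < v \<or> v < x" if "x \<in> K" for x
      using uv that by (metis linorder_neqE)
    then have "K \<subseteq> {..<u} \<union> {u<..<v} \<union> {v<..}" by fastforce
    then show "set (X @ Y @ Z) = K" by (auto simp: d)
  qed
  have "card (K \<inter> {..<v}) = length X + length Y"
    unfolding d length_sorted_list_of_set
  proof (subst card_Un_disjoint[symmetric])
    have "x < u \<or> u < x" if "x \<in> K" for x using uv that by (metis linorder_neqE)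
    then have "K \<inter> {..<v} = K \<inter> {..<u} \<union> K \<inter> {u<..<v}" using uv(1) by fastforce
    then show "card (K \<inter> {..<v}) = card (K \<inter> {..<u} \<union> K \<inter> {u<..<v})" by simp
  qed auto
  moreover have "card (K \<inter> {..<u}) = length X" by (simp add: d)
  moreover have len: "length (X @ u # Y @ v # Z) = CARD('k)"
    using K uv unfolding eq1[symmetric] length_sorted_list_of_set
    by (subst card_Un_disjoint) auto
  moreover have "col_det A (X @ u # Y @ v # Z) = (-1) ^ length X * col_det A ([] @ u # X @ Y @ v # Z)"
    using col_det_move[of "[]" X u "Y @ v # Z" A] len by simp
  moreover have "col_det A ([u] @ (X @ Y) @ v # Z) = (-1) ^ length (X @ Y) * col_det A ([u] @ v # (X @ Y) @ Z)"
    by (rule col_det_move) (use len in simp)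
  ultimately show ?thesis
    unfolding maximal_minor_eq_col_det eq1 eq2 by simp
qed

lemma det_column_linear:
  fixes N :: "real^'k^'k"
  shows "det (\<chi> i j. if j = p then v $ i + c * w $ i else N $ i $ j :: ((real, 'k) vec, 'k) vec)
    = det (\<chi> i j. if j = p then v $ i else N $ i $ j) + c * det (\<chi> i j. if j = p then w $ i else N $ i $ j)"
proof -
  let ?T = "\<lambda>u. (\<chi> j. if j = p then u else column j N) :: real^'k^'k"
  have T: "det (\<chi> i j. if j = p then u $ i else N $ i $ j) = det (?T u)" for u
  proof -
    have "transpose (\<chi> i j. if j = p then u $ i else N $ i $ j) = ?T u"
      by (simp add: transpose_def vec_eq_iff column_def)
    then show ?thesis by (subst det_transpose[symmetric]) (rule arg_cong[where f=det])
  qed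
  have "det (\<chi> i j. if j = p then v $ i + c * w $ i else N $ i $ j :: ((real, 'k) vec, 'k) vec) = det (?T (v + c *s w))"
    using T[of "v + c *s w"] by (simp cong: if_cong)
  also have "\<dots> = det (?T v) + det (?T (c *s w))" by (rule det_row_add)
  also have "det (?T (c *s w)) = c * det (?T w)" by (rule det_row_mul)
  finally show ?thesis by (simp add: T)
qed

text \<open>
  Modulo the columns in \<open>zs\<close>, the column \<open>c\<close> is a combination \<open>x\<^sub>p a + x\<^sub>q b\<close>. Cramer's rule expresses
  both coefficients as quotients of determinants, and expanding the determinant of \<open>c\<close>, \<open>d\<close>, \<open>zs\<close> in its
  first column gives the relation.
\<close>

lemma pluecker_col_det:
  fixes A :: "real^'n^'k::{finite,linorder}"
  assumes len: "length zs + 2 = CARD('k)" and ne: "col_det A (a # b # zs) \<noteq> 0"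
  shows "col_det A (a # b # zs) * col_det A (c # d # zs) =
    col_det A (a # c # zs) * col_det A (b # d # zs) - col_det A (b # c # zs) * col_det A (a # d # zs)"
proof -
  let ?B = "\<lambda>u v. col_det A (u # v # zs)"
  define M :: "'n \<Rightarrow> 'n \<Rightarrow> ((real, 'k) vec, 'k) vec"
    where "M u v = (\<chi> i j. A $ i $ ((u # v # zs) ! card {..<j}))" for u v
  define C :: "'n \<Rightarrow> (real, 'k) vec" where "C u = (\<chi> i. A $ i $ u)" for u
  define R :: "(real, 'k) vec \<Rightarrow> 'k \<Rightarrow> ((real, 'k) vec, 'k) vec \<Rightarrow> ((real, 'k) vec, 'k) vec"
    where "R w l N = (\<chi> i j. if j = l then w $ i else N $ i $ j)" for w l N
  have B: "?B u v = det (M u v)" for u v by (simp add: col_det_def M_def)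
  obtain p q :: 'k where p: "card {..<p} = 0" and q: "card {..<q} = 1"
    using exists_position[where 'k='k, of 0] exists_position[where 'k='k, of 1] len by auto
  have pq: "p \<noteq> q" using p q by auto
  have pos: "card {..<j} = 0 \<longleftrightarrow> j = p" "card {..<j} = 1 \<longleftrightarrow> j = q" for j :: 'k
    using p q position_eq_iff[of j p] position_eq_iff[of j q] by auto
  have M: "M u v $ i $ j = (if j = p then A $ i $ u else if j = q then A $ i $ v else A $ i $ (zs ! (card {..<j} - 2)))"
    for u v i j
    using pos[of j] by (auto simp: M_def nth_Cons split: nat.splits)
  have R: "R w l N $ i $ j = (if j = l then w $ i else N $ i $ j)" for w l N i j
    by (simp add: R_def)
  have cramer_R: "det (R (N *v w) l N) = w $ l * det N" for N w l
    unfolding R_def by (rule cramer_lemma)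
  obtain x where x: "M a b *v x = C c"
    using cramer[of "M a b"] ne unfolding B by blast
  have x_i: "(\<Sum>j\<in>UNIV. M a b $ i $ j * x $ j) = A $ i $ c" for i
    using x by (simp add: vec_eq_iff matrix_vector_mult_def C_def)
  have "R (C c) p (M a b) = M c b" by (simp add: vec_eq_iff R M C_def)
  then have 1: "?B c b = x $ p * ?B a b"
    using cramer_R[of "M a b" x p] unfolding B x by simp
  have "R (C c) q (M a b) = M a c" using pq by (simp add: vec_eq_iff R M C_def)
  then have 2: "?B a c = x $ q * ?B a b"
    using cramer_R[of "M a b" x q] unfolding B x by simp
  define y where "y = (\<chi> j. if j = q then 0 else x $ j)"
  have col_c: "A $ i $ c = (M a d *v y) $ i + x $ q * A $ i $ b" for i
  proof -
    have "(M a d *v y) $ i = (\<Sum>j\<in>UNIV. M a d $ i $ j * y $ j)" by (simp add: matrix_vector_mult_def)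
    also have "\<dots> = (\<Sum>j\<in>UNIV - {q}. M a d $ i $ j * y $ j)"
      by (rule sum.mono_neutral_right) (auto simp: y_def)
    also have "\<dots> = (\<Sum>j\<in>UNIV - {q}. M a b $ i $ j * x $ j)"
      by (rule sum.cong) (auto simp: M y_def)
    finally have "(M a d *v y) $ i + x $ q * A $ i $ b = (\<Sum>j\<in>UNIV. M a b $ i $ j * x $ j)"
      using pq by (subst sum.remove[of _ q]) (auto simp: M)
    then show ?thesis using x_i[of i] by simp
  qed
  have "M c d = (\<chi> i j. if j = p then (M a d *v y) $ i + x $ q * C b $ i else M a d $ i $ j)"
    using col_c by (simp add: vec_eq_iff M C_def)
  then have "?B c d = det (R (M a d *v y) p (M a d)) + x $ q * det (R (C b) p (M a d))"
    unfolding B R_def using det_column_linear[of p "M a d *v y" "x $ q" "C b" "M a d"] by simp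
  also have "det (R (M a d *v y) p (M a d)) = x $ p * ?B a d"
    using cramer_R[of "M a d" y p] pq unfolding B by (simp add: y_def)
  also have "R (C b) p (M a d) = M b d"
    by (simp add: vec_eq_iff R M C_def)
  finally have 3: "?B c d = x $ p * ?B a d + x $ q * ?B b d" unfolding B .
  have 4: "?B c b = - ?B b c"
    using col_det_swap[of "[]" b c zs A] len by simp
  have 5: "?B b c = - (x $ p * ?B a b)" using 1 4 by simp
  show ?thesis unfolding 3 2 5 by (simp add: algebra_simps)
qed

lemma three_term_relation:
  fixes A :: "real^'n::{finite,linorder}^'k::{finite,linorder}"
  assumes K: "card K + 2 = CARD('k)" and disj: "K \<inter> {a, b, c, d} = {}"
    and abcd: "a < b" "b < c" "c < d" and ne: "maximal_minor A (K \<union> {a, b}) \<noteq> 0"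
  shows "maximal_minor A (K \<union> {a, c}) * maximal_minor A (K \<union> {b, d}) =
    maximal_minor A (K \<union> {a, b}) * maximal_minor A (K \<union> {c, d}) +
    maximal_minor A (K \<union> {a, d}) * maximal_minor A (K \<union> {b, c})"
proof -
  let ?s = "\<lambda>u. (-1::real) ^ card (K \<inter> {..<u})"
  let ?B = "\<lambda>u v. col_det A (u # v # sorted_list_of_set K)"
  have nK: "a \<notin> K" "b \<notin> K" "c \<notin> K" "d \<notin> K" using disj by auto
  have lt: "a < c" "b < d" "a < d" using abcd by auto
  note mm = maximal_minor_insert2[OF K]
  note mms = mm[OF abcd(1) nK(1,2), of A] mm[OF lt(1) nK(1,3), of A] mm[OF lt(3) nK(1,4), of A]
    mm[OF abcd(2) nK(2,3), of A] mm[OF lt(2) nK(2,4), of A] mm[OF abcd(3) nK(3,4), of A]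
  have len: "length (sorted_list_of_set K) + 2 = CARD('k)" using K by simp
  have "?B a b \<noteq> 0" using ne unfolding mms by auto
  from pluecker_col_det[OF len this, of c d]
  have pl: "?B a c * ?B b d = ?B a b * ?B c d + ?B b c * ?B a d" by simp
  have "maximal_minor A (K \<union> {a, c}) * maximal_minor A (K \<union> {b, d})
    = (?s a * ?s b * ?s c * ?s d) * (?B a c * ?B b d)"
    unfolding mms by (simp only: mult_ac)
  also have "\<dots> = (?s a * ?s b * ?B a b) * (?s c * ?s d * ?B c d) + (?s a * ?s d * ?B a d) * (?s b * ?s c * ?B b c)"
    unfolding pl by (simp only: algebra_simps)
  also have "\<dots> = maximal_minor A (K \<union> {a, b}) * maximal_minor A (K \<union> {c, d}) +
    maximal_minor A (K \<union> {a, d}) * maximal_minor A (K \<union> {b, c})"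
    unfolding mms ..
  finally show ?thesis .
qed

lemma three_term_ln:
  fixes A :: "real^'n::{finite,linorder}^'k::{finite,linorder}"
  assumes A: "A \<in> positive_grassmannian" and K: "card K + 2 = CARD('k)" and disj: "K \<inter> {a, b, c, d} = {}"
    and abcd: "a < b" "b < c" "c < d"
  shows "ln (maximal_minor A (K \<union> {a, d})) + ln (maximal_minor A (K \<union> {b, c}))
       < ln (maximal_minor A (K \<union> {a, c})) + ln (maximal_minor A (K \<union> {b, d}))"
    and "ln (maximal_minor A (K \<union> {a, b})) + ln (maximal_minor A (K \<union> {c, d}))
       < ln (maximal_minor A (K \<union> {a, c})) + ln (maximal_minor A (K \<union> {b, d}))"
proof -
  have pos: "maximal_minor A (K \<union> {u, v}) > 0" if "u < v" "u \<notin> K" "v \<notin> K" for u v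
  proof -
    have "card (K \<union> {u, v}) = CARD('k)"
      using K that by (subst card_Un_disjoint) auto
    then show ?thesis using A by (simp add: positive_grassmannian_def ksubsets_def)
  qed
  have nK: "a \<notin> K" "b \<notin> K" "c \<notin> K" "d \<notin> K" using disj by auto
  have lt: "a < c" "b < d" "a < d" using abcd by auto
  note p = pos[OF abcd(1) nK(1,2)] pos[OF lt(1) nK(1,3)] pos[OF lt(3) nK(1,4)]
    pos[OF abcd(2) nK(2,3)] pos[OF lt(2) nK(2,4)] pos[OF abcd(3) nK(3,4)]
  note rel = three_term_relation[OF K disj abcd, of A]
  have "maximal_minor A (K \<union> {a, d}) * maximal_minor A (K \<union> {b, c})
      < maximal_minor A (K \<union> {a, c}) * maximal_minor A (K \<union> {b, d})"
    using rel p(1) mult_pos_pos[OF p(1,6)] by linarith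
  then show "ln (maximal_minor A (K \<union> {a, d})) + ln (maximal_minor A (K \<union> {b, c}))
       < ln (maximal_minor A (K \<union> {a, c})) + ln (maximal_minor A (K \<union> {b, d}))"
    using p by (subst (1 2) ln_mult_pos[symmetric]) (simp_all only: ln_less_cancel_iff mult_pos_pos)
  have "maximal_minor A (K \<union> {a, b}) * maximal_minor A (K \<union> {c, d})
      < maximal_minor A (K \<union> {a, c}) * maximal_minor A (K \<union> {b, d})"
    using rel p(1) mult_pos_pos[OF p(3,4)] by linarith
  then show "ln (maximal_minor A (K \<union> {a, b})) + ln (maximal_minor A (K \<union> {c, d}))
       < ln (maximal_minor A (K \<union> {a, c})) + ln (maximal_minor A (K \<union> {b, d}))"
    using p by (subst (1 2) ln_mult_pos[symmetric]) (simp_all only: ln_less_cancel_iff mult_pos_pos)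
qed

section \<open>Sorting strictly increases the product of two minors\<close>

text \<open>
  The order isomorphism from the positions to the ground set; it transports the lattice argument, where
  cyclic neighbours are taken by arithmetic on positions.
\<close>

definition nth_elem :: "nat \<Rightarrow> 'n::{finite,linorder}" where
  "nth_elem i = sorted_list_of_set UNIV ! i"

lemma nth_elem_less:
  assumes "i < j" "j < CARD('n)"
  shows "(nth_elem i :: 'n::{finite,linorder}) < nth_elem j"
  unfolding nth_elem_def using assms strict_sorted_list_of_set[of "UNIV :: 'n set"]
  by (intro sorted_wrt_nth_less[of "(<)"]) auto

lemma bij_betw_nth_elem: "bij_betw nth_elem {..<CARD('n)} (UNIV :: 'n::{finite,linorder} set)"
proof -
  have "bij_betw ((!) (sorted_list_of_set UNIV)) {..<length (sorted_list_of_set (UNIV :: 'n set))}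
          (set (sorted_list_of_set (UNIV :: 'n set)))"
    by (rule bij_betw_nth) auto
  then show ?thesis by (simp add: nth_elem_def[abs_def])
qed

lemma obtain_nth_elem:
  fixes x :: "'n::{finite,linorder}"
  obtains i where "x = nth_elem i" "i < CARD('n)"
proof -
  have "x \<in> nth_elem ` {..<CARD('n)}"
    using bij_betw_nth_elem[where 'n='n] by (simp add: bij_betw_def)
  then show thesis using that by blast
qed

lemma nth_elem_le_iff:
  assumes "i < CARD('n)" "j < CARD('n)"
  shows "(nth_elem i :: 'n::{finite,linorder}) \<le> nth_elem j \<longleftrightarrow> i \<le> j"
  using nth_elem_less[of i j, where 'n='n] nth_elem_less[of j i, where 'n='n] assms
  by (cases i j rule: linorder_cases) (auto simp: not_le)

lemma atMost_nth_elem: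
  assumes "j < CARD('n)"
  shows "{..nth_elem j :: 'n::{finite,linorder}} = nth_elem ` {..j}"
proof -
  have "x \<in> nth_elem ` {..j}" if "x \<le> nth_elem j" for x :: 'n
  proof -
    obtain i where "x = nth_elem i" "i < CARD('n)" by (rule obtain_nth_elem)
    then show ?thesis using that nth_elem_le_iff[of i j, where 'n='n] assms by auto
  qed
  then show ?thesis using assms by (auto simp: nth_elem_le_iff)
qed

lemma cnt_nth_elem:
  fixes I :: "'n::{finite,linorder} set"
  assumes "j < CARD('n)"
  shows "cnt I (nth_elem j) = (\<Sum>i\<le>j. of_bool (nth_elem i \<in> I))"
proof -
  have inj: "inj_on (nth_elem :: nat \<Rightarrow> 'n) {..j}"
    using bij_betw_nth_elem[where 'n='n] assms by (auto simp: bij_betw_def intro: inj_on_subset)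
  have "cnt I (nth_elem j) = (\<Sum>x\<in>{..nth_elem j}. of_bool (x \<in> I))"
    by (simp add: cnt_def Int_commute)
  also have "\<dots> = (\<Sum>i\<le>j. of_bool (nth_elem i \<in> I))"
    unfolding atMost_nth_elem[OF assms] by (simp only: sum.reindex[OF inj] o_def)
  finally show ?thesis .
qed

lemma step_cnt:
  fixes I :: "'n::{finite,linorder} set"
  assumes "card I = k" "j < CARD('n)"
  shows "step CARD('n) k (\<lambda>i. cnt I (nth_elem i) + c) j = of_bool (nth_elem j \<in> I)"
proof -
  have "{..nth_elem (CARD('n) - 1) :: 'n} = UNIV"
    using bij_betw_nth_elem[where 'n='n] by (subst atMost_nth_elem) (auto simp: bij_betw_def lessThan_Suc_atMost[symmetric])
  then have last: "cnt I (nth_elem (CARD('n) - 1)) = int k" using assms by (simp add: cnt_def)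
  show ?thesis
  proof (cases j)
    case 0
    then show ?thesis using last assms(2) by (simp add: step_def cnt_nth_elem)
  next
    case (Suc i)
    then show ?thesis using assms(2) by (simp add: step_def cnt_nth_elem)
  qed
qed

text \<open>
  Strict discrete midpoint concavity of \<open>g\<close> as a function of the counting function.
\<close>

definition strictly_sort_concave :: "nat \<Rightarrow> ('n::linorder set \<Rightarrow> real) \<Rightarrow> bool" where
  "strictly_sort_concave k g \<longleftrightarrow>
     (\<forall>I J. card I = k \<longrightarrow> card J = k \<longrightarrow> \<not> sorted_pair I J \<longrightarrow>
        g I + g J < g (fst (sorting I J)) + g (snd (sorting I J)))"

text \<open>
  Shifting \<open>cnt Q\<close> by a value strictly between two values of \<open>cnt P - cnt Q\<close> makes it incomparable to
  \<open>cnt P\<close>, so strict supermodularity applies. Minimum and maximum have the same sum as the original two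
  functions, which keeps the multiset union.
\<close>

lemma exists_improved_pair:
  fixes g :: "'n::{finite,linorder} set \<Rightarrow> real" and P Q :: "'n set"
  assumes g: "strict_three_term CARD('n) k (\<lambda>X. g (nth_elem ` X))"
    and k: "0 < k" "k < CARD('n)"
    and PQ: "card P = k" "card Q = k" "\<not> sorted_pair P Q"
  shows "\<exists>P' Q'. card P' = k \<and> card Q' = k \<and> (\<forall>x. cnt P' x + cnt Q' x = cnt P x + cnt Q x) \<and>
     g P + g Q < g P' + g Q'"
proof -
  let ?n = "CARD('n)"
  obtain i j where ij: "cnt P i - cnt Q i \<ge> cnt P j - cnt Q j + 2"
    using not_sorted_pair_gap[of P Q] PQ by metis
  obtain i' j' where i': "i = nth_elem i'" "i' < ?n" and j': "j = nth_elem j'" "j' < ?n"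
    using obtain_nth_elem[of i] obtain_nth_elem[of j] by metis
  define c where "c = cnt P i - cnt Q i - 1"
  define p where "p = (\<lambda>l. cnt P (nth_elem l) + 0)"
  define q where "q = (\<lambda>l. cnt Q (nth_elem l) + c)"
  define lo where "lo = (\<lambda>l. min (p l) (q l))"
  define hi where "hi = (\<lambda>l. max (p l) (q l))"
  have sp: "step ?n k p l = of_bool (nth_elem l \<in> P)" and sq: "step ?n k q l = of_bool (nth_elem l \<in> Q)"
    if "l < ?n" for l
    using step_cnt[of P k l 0] step_cnt[of Q k l c] PQ that by (auto simp: p_def q_def)
  have adm: "admissible ?n k p" "admissible ?n k q" using sp sq by (auto simp: admissible_def)
  have adm': "admissible ?n k lo" "admissible ?n k hi"
    unfolding lo_def hi_def using adm admissible_min_max by blast+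
  have img: "nth_elem ` {l. l < ?n \<and> nth_elem l \<in> X} = X" for X :: "'n set"
    using obtain_nth_elem[where 'n='n] by (auto simp: image_iff) metis
  have ss: "step_set ?n k p = {l. l < ?n \<and> nth_elem l \<in> P}" "step_set ?n k q = {l. l < ?n \<and> nth_elem l \<in> Q}"
    using sp sq by (auto simp: step_set_def)
  have inj: "inj_on (nth_elem :: nat \<Rightarrow> 'n) {..<?n}" using bij_betw_nth_elem by (auto simp: bij_betw_def)
  define P' where "P' = (nth_elem ` step_set ?n k lo :: 'n set)"
  define Q' where "Q' = (nth_elem ` step_set ?n k hi :: 'n set)"
  have sub: "step_set ?n k z \<subseteq> {..<?n}" for z by (auto simp: step_set_def)
  have "card P' = k" "card Q' = k"
    unfolding P'_def Q'_def using card_step_set[of ?n k] adm' card_image[OF inj_on_subset[OF inj sub]] by auto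
  moreover have "cnt P' x + cnt Q' x = cnt P x + cnt Q x" for x
  proof -
    obtain x' where x': "x = nth_elem x'" "x' < ?n"
      by (rule obtain_nth_elem)
    have mem: "of_bool (nth_elem l \<in> (nth_elem ` step_set ?n k z :: 'n set)) = step ?n k z l"
      if "l < ?n" "admissible ?n k z" for l z
    proof -
      have "(nth_elem l \<in> (nth_elem ` step_set ?n k z :: 'n set)) \<longleftrightarrow> l \<in> step_set ?n k z"
        using inj_on_image_mem_iff[OF inj _ sub] that by auto
      then show ?thesis using that by (auto simp: step_set_def admissible_def)
    qed
    have "of_bool (nth_elem l \<in> P') + of_bool (nth_elem l \<in> Q') =
       (of_bool (nth_elem l \<in> P) + of_bool (nth_elem l \<in> Q) :: int)" if "l < ?n" for l
    proof -
      have "step ?n k lo l + step ?n k hi l = step ?n k p l + step ?n k q l"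
      proof -
        have "lo i + hi i = p i + q i" for i by (simp add: lo_def hi_def)
        from this[of l] this[of "l - 1"] this[of "?n - 1"] this[of 0] show ?thesis
          unfolding step_def by (smt (verit))
      qed
      then show ?thesis
        unfolding P'_def Q'_def using mem[OF that adm'(1)] mem[OF that adm'(2)] sp[OF that] sq[OF that] by simp
    qed
    then show ?thesis
      unfolding x' cnt_nth_elem[OF x'(2)] sum.distrib[symmetric] using x'(2) by (intro sum.cong) auto
  qed
  moreover have "g P + g Q < g P' + g Q'"
  proof -
    have "p j' < q j'" "q i' < p i'" using ij i' j' by (auto simp: p_def q_def c_def)
    then have "g (nth_elem ` step_set ?n k p) + g (nth_elem ` step_set ?n k q) < g P' + g Q'"
      unfolding P'_def Q'_def lo_def hi_def
      by (intro strict_supermodular[OF g k adm]) (use i' j' in auto)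
    then show ?thesis by (simp add: ss img)
  qed
  ultimately show ?thesis by blast
qed

text \<open>
  A pair with the given multiset union that maximizes the sum of \<open>g\<close> cannot be improved; so it is sorted
  and hence equal to the sorting.
\<close>

lemma strictly_sort_concave_if_three_term:
  fixes g :: "'n::{finite,linorder} set \<Rightarrow> real"
  assumes g: "strict_three_term CARD('n) k (\<lambda>X. g (nth_elem ` X))" and k: "0 < k"
  shows "strictly_sort_concave k g"
  unfolding strictly_sort_concave_def
proof (intro allI impI)
  fix I J :: "'n set" assume IJ: "card I = k" "card J = k" "\<not> sorted_pair I J"
  have "k < CARD('n)"
  proof (rule ccontr)
    assume "\<not> k < CARD('n)"
    then have "card I = CARD('n)" "card J = CARD('n)" using IJ card_mono[of UNIV I] by auto
    then have "I = UNIV" "J = UNIV" using card_subset_eq[of UNIV I] card_subset_eq[of UNIV J] by simp_all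
    then show False using IJ by (auto simp: sorted_pair_def interlacing_def)
  qed
  note improve = exists_improved_pair[OF g k this]
  define W where "W = {(P, Q). card P = k \<and> card Q = k \<and> (\<forall>x. cnt P x + cnt Q x = cnt I x + cnt J x)}"
  have fin: "finite W" by simp
  obtain P1 Q1 where PQ1: "(P1, Q1) \<in> W" "g I + g J < g P1 + g Q1"
    using improve[OF IJ] by (auto simp: W_def)
  obtain P Q where PQ: "(P, Q) \<in> W" and max: "\<And>P' Q'. (P', Q') \<in> W \<Longrightarrow> g P' + g Q' \<le> g P + g Q"
  proof -
    let ?f = "\<lambda>w. g (fst w) + g (snd w)"
    have "Max (?f ` W) \<in> ?f ` W" using fin PQ1 by (intro Max_in) auto
    then obtain w where w: "w \<in> W" "Max (?f ` W) = ?f w" by blast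
    have "?f v \<le> ?f w" if "v \<in> W" for v
      unfolding w(2)[symmetric] using fin that by (intro Max_ge) auto
    then show thesis using w(1) that[of "fst w" "snd w"] by fastforce
  qed
  have "sorted_pair P Q"
  proof (rule ccontr)
    assume ns: "\<not> sorted_pair P Q"
    obtain P' Q' where "(P', Q') \<in> W" "g P + g Q < g P' + g Q'"
      using improve[OF _ _ ns] PQ by (auto simp: W_def)
    then show False using max by fastforce
  qed
  then have "g P + g Q = g (fst (sorting I J)) + g (snd (sorting I J))"
    using sorted_pair_is_sorting[of P Q I J] PQ by (auto simp: W_def)
  then show "g I + g J < g (fst (sorting I J)) + g (snd (sorting I J))"
    using max[OF PQ1(1)] PQ1(2) by simp
qed

lemma strictly_sort_concave_ln_minor:
  fixes A :: "real^'n::{finite,linorder}^'k::{finite,linorder}"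
  assumes A: "A \<in> positive_grassmannian"
  shows "strictly_sort_concave CARD('k) (\<lambda>I. ln (maximal_minor A I))"
proof (rule strictly_sort_concave_if_three_term)
  let ?g = "\<lambda>X. ln (maximal_minor A (nth_elem ` X))"
  show "strict_three_term CARD('n) CARD('k) ?g"
    unfolding strict_three_term_def
  proof (intro allI impI)
    fix K :: "nat set" and a b c d :: nat
    assume K: "K \<subseteq> {..<CARD('n)}" "card K + 2 = CARD('k)" "K \<inter> {a, b, c, d} = {}"
      and abcd: "a < b" "b < c" "c < d" "d < CARD('n)"
    have inj: "inj_on (nth_elem :: nat \<Rightarrow> 'n) {..<CARD('n)}"
      using bij_betw_nth_elem by (auto simp: bij_betw_def)
    have "card (nth_elem ` K :: 'n set) + 2 = CARD('k)"
      using K card_image[OF inj_on_subset[OF inj K(1)]] by simp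
    moreover have "(nth_elem ` K :: 'n set) \<inter> {nth_elem a, nth_elem b, nth_elem c, nth_elem d} = {}"
    proof -
      have "nth_elem ` K \<inter> nth_elem ` {a, b, c, d} = (nth_elem ` (K \<inter> {a, b, c, d}) :: 'n set)"
        using inj_on_image_Int[OF inj, of K "{a, b, c, d}"] K(1) abcd by auto
      then show ?thesis using K(3) by simp
    qed
    moreover have "(nth_elem a :: 'n) < nth_elem b" "(nth_elem b :: 'n) < nth_elem c" "(nth_elem c :: 'n) < nth_elem d"
      using abcd by (auto intro!: nth_elem_less)
    ultimately show "?g (K \<union> {a, d}) + ?g (K \<union> {b, c}) < ?g (K \<union> {a, c}) + ?g (K \<union> {b, d}) \<and>
        ?g (K \<union> {a, b}) + ?g (K \<union> {c, d}) < ?g (K \<union> {a, c}) + ?g (K \<union> {b, d})"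
      using three_term_ln[OF A, of "nth_elem ` K" "nth_elem a" "nth_elem b" "nth_elem c" "nth_elem d"]
      unfolding image_Un image_insert image_empty by blast
  qed
qed simp

section \<open>Existence of totally positive matrices and column scaling\<close>

definition vandermonde :: "('k::{finite,linorder} \<Rightarrow> real) \<Rightarrow> ((real, 'k) vec, 'k) vec" where
  "vandermonde x = (\<chi> i j. x j ^ card {..<i})"

text \<open>
  A linear dependency between the rows is a nonzero polynomial of degree less than \<open>k\<close> that vanishes at the
  \<open>k\<close> distinct nodes.
\<close>

lemma det_vandermonde_nonzero:
  fixes x :: "'k::{finite,linorder} \<Rightarrow> real"
  assumes "inj x"
  shows "det (vandermonde x) \<noteq> 0"
proof
  assume "det (vandermonde x) = 0"
  then have "det (transpose (vandermonde x)) = 0" by simp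
  then obtain v where v: "v \<noteq> 0" "transpose (vandermonde x) *v v = 0"
    using invertible_det_nz[of "transpose (vandermonde x)"] invertible_left_inverse[of "transpose (vandermonde x)"]
      matrix_left_invertible_ker[of "transpose (vandermonde x)"] by blast
  define p where "p = (\<Sum>i\<in>UNIV. monom (v $ i) (card {..<i}))"
  have root: "poly p (x j) = 0" for j
  proof -
    have "poly p (x j) = (\<Sum>i\<in>UNIV. x j ^ card {..<i} * v $ i)"
      by (simp add: p_def poly_sum poly_monom mult.commute)
    also have "\<dots> = (transpose (vandermonde x) *v v) $ j"
      by (simp add: matrix_vector_mult_def transpose_def vandermonde_def)
    finally show ?thesis using v by simp
  qed
  obtain i where i: "v $ i \<noteq> 0" using v(1) by (auto simp: vec_eq_iff)
  have "coeff p (card {..<i}) = (\<Sum>j\<in>UNIV. if j = i then v $ j else 0)"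
    by (simp add: p_def coeff_sum position_eq_iff)
  then have "p \<noteq> 0" using i by auto
  have "degree p \<le> CARD('k) - 1"
    unfolding p_def
  proof (intro degree_sum_le)
    fix i :: 'k
    have "degree (monom (v $ i) (card {..<i})) \<le> card {..<i}" by (rule degree_monom_le)
    then show "degree (monom (v $ i) (card {..<i})) \<le> CARD('k) - 1"
      using card_lessThan_less_CARD[of i] by linarith
  qed simp
  have "CARD('k) = card (range x)" using assms by (simp add: card_image)
  also have "\<dots> \<le> card {y. poly p y = 0}"
    using root \<open>p \<noteq> 0\<close> by (intro card_mono poly_roots_finite) auto
  also have "\<dots> \<le> degree p" using \<open>p \<noteq> 0\<close> by (rule card_poly_roots_bound)
  finally show False using \<open>degree p \<le> CARD('k) - 1\<close> zero_less_card_finite[where 'a='k] by linarith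
qed

text \<open>
  The increasing tuples of nodes form a convex set on which the determinant does not vanish, so its sign is
  constant there by the intermediate value theorem.
\<close>

lemma det_vandermonde_same_sign:
  fixes x y :: "'k::{finite,linorder} \<Rightarrow> real"
  assumes "strict_mono x" "strict_mono y"
  shows "det (vandermonde x) > 0 \<longleftrightarrow> det (vandermonde y) > 0"
proof -
  define z where "z s j = (1 - s) * x j + s * y j" for s j
  define f where "f s = det (vandermonde (z s))" for s
  have "inj (z s)" if "0 \<le> s" "s \<le> 1" for s
  proof -
    have "z s i < z s j" if "i < j" for i j
    proof (cases "s = 0")
      case False
      then show ?thesis
        unfolding z_def using \<open>0 \<le> s\<close> \<open>s \<le> 1\<close> strict_monoD[OF assms(1) that] strict_monoD[OF assms(2) that]
        by (intro add_le_less_mono mult_left_mono mult_strict_left_mono) auto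
    qed (use strict_monoD[OF assms(1) that] in \<open>simp add: z_def\<close>)
    then show ?thesis by (intro strict_mono_imp_inj_on strict_monoI)
  qed
  then have nz: "f s \<noteq> 0" if "0 \<le> s" "s \<le> 1" for s
    unfolding f_def using that det_vandermonde_nonzero by blast
  have cont: "continuous_on {0..1} f"
    unfolding f_def det_def vandermonde_def z_def by (intro continuous_intros)
  have "\<not> (f 0 \<le> 0 \<and> 0 \<le> f 1)" using IVT'[of f 0 0 1] cont nz by force
  moreover have "\<not> (f 1 \<le> 0 \<and> 0 \<le> f 0)" using IVT2'[of f 1 0 0] cont nz by force
  ultimately have "f 0 > 0 \<longleftrightarrow> f 1 > 0" by linarith
  moreover have "z 0 = x" "z 1 = y" by (auto simp: z_def)
  ultimately show ?thesis by (simp add: f_def)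
qed

lemma rank_if_minor_nonzero:
  fixes A :: "real^'n::{finite,linorder}^'k::{finite,linorder}"
  assumes "maximal_minor A I \<noteq> 0"
  shows "rank A = CARD('k)"
  unfolding full_rank_surjective
proof -
  let ?M = "\<chi> i j. A $ i $ nth_column I j :: ((real, 'k) vec, 'k) vec"
  obtain B where inv: "?M ** B = mat 1"
    using assms unfolding maximal_minor_def invertible_det_nz[symmetric] invertible_def by blast
  define x :: "(real, 'k) vec \<Rightarrow> (real, 'n) vec" where "x y = (\<Sum>j\<in>UNIV. (B *v y) $ j *\<^sub>R axis (nth_column I j) 1)" for y
  have "A *v x y = y" for y
  proof -
    have "A *v x y = (\<Sum>j\<in>UNIV. (B *v y) $ j *\<^sub>R (A *v axis (nth_column I j) 1))"
      unfolding x_def by (simp add: linear_sum[OF matrix_vector_mul_linear] linear_scale[OF matrix_vector_mul_linear])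
    also have "\<dots> = ?M *v (B *v y)"
      by (simp add: vec_eq_iff matrix_vector_mult_basis column_def matrix_vector_mult_def[of ?M] mult.commute)
    also have "\<dots> = y" using inv by (simp add: matrix_vector_mul_assoc)
    finally show ?thesis .
  qed
  then show "surj ((*v) A)" by (metis surjI)
qed

lemma exists_ksubset:
  assumes "CARD('k) \<le> CARD('n)"
  obtains I where "I \<in> (ksubsets TYPE('k::finite) :: 'n::finite set set)"
  using obtain_subset_with_card_n[of "CARD('k)" "UNIV :: 'n set"] assms by (auto simp: ksubsets_def)

text \<open>
  The maximal minors of the rectangular Vandermonde matrix with increasing nodes all have the same sign;
  one row is multiplied by that sign.
\<close>

lemma positive_grassmannian_nonempty:
  assumes "CARD('k) \<le> CARD('n)"
  obtains A where "A \<in> (positive_grassmannian :: ((real, 'n::{finite,linorder}) vec, 'k::{finite,linorder}) vec set)"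
proof -
  obtain I0 where I0: "I0 \<in> (ksubsets TYPE('k) :: 'n set set)" using exists_ksubset[OF assms] .
  let ?x = "\<lambda>I j. real (card {..<nth_column I (j :: 'k) :: 'n})"
  have mono: "strict_mono (?x I)" if "I \<in> ksubsets TYPE('k)" for I
  proof (rule strict_monoI)
    fix i j :: 'k assume "i < j"
    then have "nth_column I i < nth_column I j"
      using strict_mono_nth_column[of I] that strict_monoD by (fastforce simp: ksubsets_def)
    then have "card {..<nth_column I i} < card {..<nth_column I j}" by (intro psubset_card_mono) auto
    then show "?x I i < ?x I j" by simp
  qed
  define c :: real where "c = sgn (det (vandermonde (?x I0)))"
  define i0 :: 'k where "i0 = undefined"
  define A :: "((real, 'n) vec, 'k) vec"
    where "A = (\<chi> i. if i = i0 then c *s (\<chi> j. real (card {..<j}) ^ card {..<i}) else (\<chi> j. real (card {..<j}) ^ card {..<i}))"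
  have A: "maximal_minor A I = c * det (vandermonde (?x I))" for I
  proof -
    have "maximal_minor A I = det (\<chi> i. if i = i0 then c *s (vandermonde (?x I) $ i) else vandermonde (?x I) $ i)"
      unfolding maximal_minor_def
      by (rule arg_cong[where f=det]) (simp add: vec_eq_iff A_def vandermonde_def)
    also have "\<dots> = c * det (\<chi> i. if i = i0 then vandermonde (?x I) $ i else vandermonde (?x I) $ i)"
      by (rule det_row_mul)
    also have "(\<chi> i. if i = i0 then vandermonde (?x I) $ i else vandermonde (?x I) $ i) = vandermonde (?x I)"
      by (simp add: vec_eq_iff)
    finally show ?thesis .
  qed
  have pos: "maximal_minor A I > 0" if I: "I \<in> ksubsets TYPE('k)" for I
  proof -
    have "det (vandermonde (?x I)) > 0 \<longleftrightarrow> det (vandermonde (?x I0)) > 0"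
      by (rule det_vandermonde_same_sign[OF mono[OF I] mono[OF I0]])
    moreover have "det (vandermonde (?x J)) \<noteq> 0" if "J \<in> ksubsets TYPE('k)" for J
      by (intro det_vandermonde_nonzero strict_mono_imp_inj_on mono that)
    ultimately show ?thesis
      unfolding A c_def using I I0 by (cases "det (vandermonde (?x I0)) > 0") (auto simp: sgn_if not_less le_less)
  qed
  moreover have "rank A = CARD('k)" using rank_if_minor_nonzero pos[OF I0] by (metis less_irrefl)
  ultimately show thesis using that by (auto simp: positive_grassmannian_def)
qed

text \<open>
  The torus action: on the logarithms of the minors it adds a linear functional of the vertex \<open>subset_vec I\<close>.
\<close>

lemma minor_scale_columns:
  fixes A :: "real^'n::{finite,linorder}^'k::{finite,linorder}"
  assumes "I \<in> ksubsets TYPE('k)"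
  shows "maximal_minor (\<chi> i j. c j * A $ i $ j) I = (\<Prod>i\<in>I. c i) * maximal_minor A I"
proof -
  let ?f = "nth_column I :: 'k \<Rightarrow> 'n"
  have bij: "bij_betw ?f UNIV I"
    using assms strict_mono_nth_column[of I, where 'k='k] range_nth_column[of I, where 'k='k]
    by (auto simp: bij_betw_def ksubsets_def intro: strict_mono_imp_inj_on)
  have "maximal_minor (\<chi> i j. c j * A $ i $ j) I = det (transpose (\<chi> i j. c (?f j) * A $ i $ ?f j))"
    by (simp add: maximal_minor_def)
  also have "transpose (\<chi> i j. c (?f j) * A $ i $ ?f j) = (\<chi> j. c (?f j) *s (\<chi> i. A $ i $ ?f j))"
    by (simp add: transpose_def vec_eq_iff)
  also have "det \<dots> = (\<Prod>j\<in>UNIV. c (?f j)) * det (\<chi> j. \<chi> i. A $ i $ ?f j)"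
    by (rule det_rows_mul)
  also have "(\<chi> j. \<chi> i. A $ i $ ?f j) = transpose (\<chi> i j. A $ i $ ?f j)"
    by (simp add: transpose_def vec_eq_iff)
  also have "(\<Prod>j\<in>UNIV. c (?f j)) = (\<Prod>i\<in>I. c i)" by (rule prod.reindex_bij_betw[OF bij])
  finally show ?thesis by (simp add: maximal_minor_def)
qed

lemma positive_grassmannian_scale_columns:
  fixes A :: "real^'n::{finite,linorder}^'k::{finite,linorder}"
  assumes A: "A \<in> positive_grassmannian" and "CARD('k) \<le> CARD('n)" and c: "\<And>j. c j > 0"
  shows "(\<chi> i j. c j * A $ i $ j) \<in> positive_grassmannian"
proof -
  have pos: "maximal_minor (\<chi> i j. c j * A $ i $ j) I > 0" if "I \<in> ksubsets TYPE('k)" for I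
    using A c that by (simp add: minor_scale_columns prod_pos positive_grassmannian_def)
  obtain I0 where "I0 \<in> (ksubsets TYPE('k) :: 'n set set)" using exists_ksubset[OF assms(2)] .
  then have "rank (\<chi> i j. c j * A $ i $ j :: ((real, 'n) vec, 'k) vec) = CARD('k)"
    using rank_if_minor_nonzero pos by (metis less_irrefl)
  then show ?thesis using pos by (simp add: positive_grassmannian_def)
qed

section \<open>Sorted barycentric representations\<close>

lemma subset_vec_nth: "subset_vec I $ i = of_bool (i \<in> I)"
  by (simp add: subset_vec_def axis_def of_bool_def)

lemma inj_subset_vec: "inj (subset_vec :: 'n::finite set \<Rightarrow> _)"
proof (rule injI)
  fix I J :: "'n set" assume "subset_vec I = subset_vec J"
  then have "i \<in> I \<longleftrightarrow> i \<in> J" for i by (metis subset_vec_nth of_bool_eq_iff)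
  then show "I = J" by blast
qed

lemma sum_subset_vec: "(\<Sum>i\<in>B. subset_vec I $ i) = real (card (I \<inter> B))"
  by (simp add: subset_vec_nth Int_commute)

lemma sum_atMost_subset_vec: "(\<Sum>i\<le>j. subset_vec I $ i) = real_of_int (cnt I j)"
  by (simp add: sum_subset_vec cnt_def)

lemma sum_combination:
  "(\<Sum>i\<in>B. (\<Sum>I\<in>F. c I *\<^sub>R subset_vec I) $ i) = (\<Sum>I\<in>F. c I * real (card (I \<inter> B)))"
  by (simp add: sum.swap[of _ F B] sum_distrib_left[symmetric] sum_subset_vec)

lemma vec_eq_if_partial_sums_eq:
  fixes x y :: "(real, 'n::{finite,linorder}) vec"
  assumes "\<And>j. (\<Sum>i\<le>j. x $ i) = (\<Sum>i\<le>j. y $ i)"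
  shows "x = y"
proof (rule ccontr)
  assume "x \<noteq> y"
  then have ne: "{i. x $ i \<noteq> y $ i} \<noteq> {}" by (auto simp: vec_eq_iff)
  define m where "m = Min {i. x $ i \<noteq> y $ i}"
  have m: "x $ m \<noteq> y $ m" using Min_in[OF _ ne] by (auto simp: m_def)
  have below: "x $ i = y $ i" if "i < m" for i
  proof (rule ccontr)
    assume "x $ i \<noteq> y $ i"
    then have "m \<le> i" by (auto simp: m_def)
    then show False using that by simp
  qed
  have split: "(\<Sum>i\<le>m. z $ i) = z $ m + (\<Sum>i<m. z $ i)" for z :: "(real, 'n) vec"
    using sum.insert[of "{..<m}" m "\<lambda>i. z $ i"] by (simp flip: ivl_disj_un_singleton(2))
  have "(\<Sum>i<m. x $ i) = (\<Sum>i<m. y $ i)" using below by (intro sum.cong) auto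
  then show False using assms[of m] m by (simp add: split)
qed

text \<open>
  Any strictly monotone function of the counting function would do; it orders the chain formed by a sorted
  family.
\<close>

definition height :: "'n::{finite,linorder} set \<Rightarrow> int" where
  "height I = (\<Sum>j\<in>UNIV. cnt I j)"

lemma sorted_pair_height:
  fixes I J :: "'n::{finite,linorder} set"
  assumes "sorted_pair I J" "card I = card J" "height I \<le> height J"
  shows "cnt J j - cnt I j \<in> {0, 1}"
proof -
  consider "\<forall>j. cnt I j - cnt J j \<in> {0, 1}" | "\<forall>j. cnt J j - cnt I j \<in> {0, 1}"
    using assms(1,2) by (auto simp: sorted_pair_iff)
  then show ?thesis
  proof cases
    case 1
    have "cnt I j = cnt J j"
    proof (rule ccontr)
      assume "cnt I j \<noteq> cnt J j"
      then have "cnt J j < cnt I j" using 1[rule_format, of j] by auto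
      moreover have "cnt J i \<le> cnt I i" for i using 1[rule_format, of i] by auto
      ultimately have "height J < height I" unfolding height_def by (intro sum_strict_mono_ex1) auto
      then show False using assms(3) by simp
    qed
    then show ?thesis by simp
  qed auto
qed

lemma sorted_family_minimum:
  fixes F :: "'n::{finite,linorder} set set"
  assumes "F \<noteq> {}" "sorted_family F" "\<And>I. I \<in> F \<Longrightarrow> card I = k"
  obtains I where "I \<in> F" "\<And>J j. J \<in> F \<Longrightarrow> cnt J j - cnt I j \<in> {0, 1}"
proof -
  have "finite (height ` F)" "height ` F \<noteq> {}" using assms(1) by auto
  then have "Min (height ` F) \<in> height ` F" by (rule Min_in)
  then obtain I where I: "I \<in> F" "height I = Min (height ` F)" by auto
  have "cnt J j - cnt I j \<in> {0, 1}" if J: "J \<in> F" for J j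
    using assms(2,3) I J by (intro sorted_pair_height) (auto simp: sorted_family_def)
  then show thesis using that I(1) by blast
qed

text \<open>
  The partial coordinate sums of the weighted mean lie at or above the lowest counting function of the chain,
  and strictly below it plus 1, because the lowest member itself has positive weight.
\<close>

lemma minimum_is_floor:
  fixes w :: "'n::{finite,linorder} set \<Rightarrow> real"
  assumes pos: "\<And>I. 0 \<le> w I" and ne: "0 < sum w UNIV" and srt: "sorted_family {I. w I \<noteq> 0}"
    and k: "\<And>I. w I \<noteq> 0 \<Longrightarrow> card I = k"
  obtains I where "w I > 0"
    "\<And>j. cnt I j = \<lfloor>(\<Sum>J\<in>UNIV. w J * cnt J j) / sum w UNIV\<rfloor>"
proof -
  have "{I. w I \<noteq> 0} \<noteq> {}" using ne by (metis (mono_tags, lifting) empty_Collect_eq less_irrefl sum.neutral)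
  then obtain I where I: "w I \<noteq> 0" and min: "\<And>J j. w J \<noteq> 0 \<Longrightarrow> cnt J j - cnt I j \<in> {0, 1}"
    using sorted_family_minimum[OF _ srt, of k] k by auto
  have "cnt I j = \<lfloor>(\<Sum>J\<in>UNIV. w J * cnt J j) / sum w UNIV\<rfloor>" for j
  proof -
    have "w J * cnt I j \<le> w J * cnt J j" for J
      using min[of J j] pos[of J] by (cases "w J = 0") (auto intro!: mult_left_mono)
    then have lo: "(\<Sum>J\<in>UNIV. w J) * cnt I j \<le> (\<Sum>J\<in>UNIV. w J * cnt J j)"
      unfolding sum_distrib_right by (intro sum_mono) auto
    have "w J * cnt J j \<le> w J * (cnt I j + 1)" for J
      using min[of J j] pos[of J] by (cases "w J = 0") (auto intro!: mult_left_mono)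
    moreover have "w I * cnt I j < w I * (cnt I j + 1)" using I pos[of I] by simp
    ultimately have "(\<Sum>J\<in>UNIV. w J * cnt J j) < (\<Sum>J\<in>UNIV. w J * (cnt I j + 1))"
      by (intro sum_strict_mono_ex1) auto
    then have hi: "(\<Sum>J\<in>UNIV. w J * cnt J j) < (\<Sum>J\<in>UNIV. w J) * (cnt I j + 1)"
      by (simp add: sum_distrib_right)
    show ?thesis
      by (rule floor_unique[symmetric]) (use lo hi ne in \<open>simp_all add: field_simps\<close>)
  qed
  then show thesis using that I pos[of I] by force
qed

text \<open>
  After cancelling the common part of the two weight functions, their supports are disjoint. But the lowest
  members of both supports are the floor of the same vector, so they coincide.
\<close>

lemma sorted_combination_unique:
  fixes v w :: "'n::{finite,linorder} set \<Rightarrow> real"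
  assumes "\<And>I. 0 \<le> v I" "\<And>I. 0 \<le> w I"
    and "sorted_family {I. v I \<noteq> 0}" "sorted_family {I. w I \<noteq> 0}"
    and kv: "\<And>I. v I \<noteq> 0 \<Longrightarrow> card I = k" and kw: "\<And>I. w I \<noteq> 0 \<Longrightarrow> card I = k" and k: "0 < k"
    and eq: "(\<Sum>I\<in>UNIV. v I *\<^sub>R subset_vec I) = (\<Sum>I\<in>UNIV. w I *\<^sub>R subset_vec I)"
  shows "v = w"
proof (rule ccontr)
  assume "v \<noteq> w"
  define v' where "v' I = v I - min (v I) (w I)" for I
  define w' where "w' I = w I - min (v I) (w I)" for I
  have pos: "0 \<le> v' I" "0 \<le> w' I" for I by (auto simp: v'_def w'_def)
  have supp: "v' I \<noteq> 0 \<Longrightarrow> v I \<noteq> 0" "w' I \<noteq> 0 \<Longrightarrow> w I \<noteq> 0" for I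
    using assms(1,2)[of I] by (auto simp: v'_def w'_def min_def split: if_splits)
  have srt: "sorted_family {I. v' I \<noteq> 0}" "sorted_family {I. w' I \<noteq> 0}"
    using assms(3,4) supp by (auto simp: sorted_family_def)
  have eq': "(\<Sum>I\<in>UNIV. v' I *\<^sub>R subset_vec I) = (\<Sum>I\<in>UNIV. w' I *\<^sub>R subset_vec I)"
    using eq by (simp add: v'_def w'_def scaleR_left_diff_distrib sum_subtractf)
  have cnt_eq: "(\<Sum>I\<in>UNIV. v' I * cnt I j) = (\<Sum>I\<in>UNIV. w' I * cnt I j)" for j
    using sum_combination[of v' UNIV "{..j}"] sum_combination[of w' UNIV "{..j}"] eq'
    by (simp add: cnt_def)
  have "(\<Sum>I\<in>UNIV. v' I * real k) = (\<Sum>I\<in>UNIV. v' I * real (card (I \<inter> UNIV)))"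
    by (intro sum.cong refl) (use kv supp in force)
  also have "\<dots> = (\<Sum>I\<in>UNIV. w' I * real (card (I \<inter> UNIV)))"
    using sum_combination[of v' UNIV UNIV] sum_combination[of w' UNIV UNIV] eq' by simp
  also have "\<dots> = (\<Sum>I\<in>UNIV. w' I * real k)"
    by (intro sum.cong refl) (use kw supp in force)
  finally have sum_eq: "sum v' UNIV = sum w' UNIV"
    using k by (simp add: sum_distrib_right[symmetric])
  obtain I where I: "v I \<noteq> w I" using \<open>v \<noteq> w\<close> by blast
  then have "v' I > 0 \<or> w' I > 0" by (auto simp: v'_def w'_def min_def)
  then have "0 < sum v' UNIV \<or> 0 < sum w' UNIV"
    using pos by (metis UNIV_I finite sum_pos2)
  then have s: "0 < sum v' UNIV" "0 < sum w' UNIV" using sum_eq by auto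
  obtain P where P: "v' P > 0" "\<And>j. cnt P j = \<lfloor>(\<Sum>J\<in>UNIV. v' J * cnt J j) / sum v' UNIV\<rfloor>"
    using minimum_is_floor[OF pos(1) s(1) srt(1)] kv supp by metis
  obtain Q where Q: "w' Q > 0" "\<And>j. cnt Q j = \<lfloor>(\<Sum>J\<in>UNIV. w' J * cnt J j) / sum w' UNIV\<rfloor>"
    using minimum_is_floor[OF pos(2) s(2) srt(2)] kw supp by metis
  have "P = Q" by (rule eq_if_cnt_eq) (simp add: P Q cnt_eq sum_eq)
  then show False using P(1) Q(1) by (auto simp: v'_def w'_def min_def split: if_splits)
qed

text \<open>
  The positive and the negative part of a linear relation are two sorted combinations of the same vector.
\<close>

lemma sorted_independent:
  fixes c :: "'n::{finite,linorder} set \<Rightarrow> real"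
  assumes srt: "sorted_family F" and F: "\<And>I. I \<in> F \<Longrightarrow> card I = k" and k: "0 < k"
    and zero: "(\<Sum>I\<in>F. c I *\<^sub>R subset_vec I) = 0" and I: "I \<in> F"
  shows "c I = 0"
proof -
  define v where "v I = (if I \<in> F then max (c I) 0 else 0)" for I
  define w where "w I = (if I \<in> F then max (- c I) 0 else 0)" for I
  have "v = w"
  proof (rule sorted_combination_unique)
    have "(\<Sum>I\<in>UNIV. v I *\<^sub>R subset_vec I) - (\<Sum>I\<in>UNIV. w I *\<^sub>R subset_vec I)
        = (\<Sum>I\<in>UNIV. if I \<in> F then c I *\<^sub>R subset_vec I else 0)"
      unfolding sum_subtractf[symmetric] scaleR_left_diff_distrib[symmetric]
      by (intro sum.cong) (auto simp: v_def w_def)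
    also have "\<dots> = 0" using zero by (simp add: sum.If_cases)
    finally show "(\<Sum>I\<in>UNIV. v I *\<^sub>R subset_vec I) = (\<Sum>I\<in>UNIV. w I *\<^sub>R subset_vec I)" by simp
    show "sorted_family {I. v I \<noteq> 0}" "sorted_family {I. w I \<noteq> 0}"
      using srt by (auto simp: sorted_family_def v_def w_def split: if_splits)
  qed (use F k in \<open>auto simp: v_def w_def split: if_splits\<close>)
  then have "v I = w I" by simp
  then show ?thesis using I by (simp add: v_def w_def max_def split: if_splits)
qed

lemma independent_sorted:
  fixes F :: "'n::{finite,linorder} set set"
  assumes "sorted_family F" "\<And>I. I \<in> F \<Longrightarrow> card I = k" "0 < k"
  shows "independent (subset_vec ` F)"
proof -
  have "u v = 0" if u: "(\<Sum>v\<in>subset_vec ` F. u v *\<^sub>R v) = 0" and v: "v \<in> subset_vec ` F" for u :: "(real, 'n) vec \<Rightarrow> real" and v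
  proof -
    have "(\<Sum>I\<in>F. u (subset_vec I) *\<^sub>R subset_vec I) = 0"
      using u by (subst (asm) sum.reindex) (auto intro: inj_on_subset[OF inj_subset_vec])
    then show ?thesis using sorted_independent[OF assms, of "\<lambda>I. u (subset_vec I)"] v by auto
  qed
  then show ?thesis by (subst independent_explicit) auto
qed

lemma card_sorted_family_le:
  fixes F :: "'n::{finite,linorder} set set"
  assumes "sorted_family F" "\<And>I. I \<in> F \<Longrightarrow> card I = k" "0 < k"
  shows "card F \<le> CARD('n)"
  using independent_bound[OF independent_sorted[OF assms]] card_image[OF inj_on_subset[OF inj_subset_vec subset_UNIV], of F]
  by simp

text \<open>
  Weights are indexed by all sets, and vanish outside \<open>S\<close>, so that representations over different families
  can be compared.
\<close>

definition represents :: "'n::finite set set \<Rightarrow> real^'n \<Rightarrow> ('n set \<Rightarrow> real) \<Rightarrow> bool" where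
  "represents S x w \<longleftrightarrow> (\<forall>I. 0 \<le> w I) \<and> (\<forall>I. I \<notin> S \<longrightarrow> w I = 0) \<and> sum w UNIV = 1 \<and>
     (\<Sum>I\<in>UNIV. w I *\<^sub>R subset_vec I) = x"

lemma mem_subset_polytope_iff: "x \<in> subset_polytope S \<longleftrightarrow> (\<exists>w. represents S x w)"
proof
  assume "x \<in> subset_polytope S"
  then obtain u where u: "\<And>y. y \<in> subset_vec ` S \<Longrightarrow> 0 \<le> u y" "sum u (subset_vec ` S) = 1"
    "(\<Sum>y\<in>subset_vec ` S. u y *\<^sub>R y) = x"
    unfolding subset_polytope_def by (subst (asm) convex_hull_finite) auto
  have inj: "inj_on subset_vec S" by (rule inj_on_subset[OF inj_subset_vec]) simp
  define w where "w I = (if I \<in> S then u (subset_vec I) else 0)" for I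
  have "(\<Sum>I\<in>UNIV. w I *\<^sub>R subset_vec I) = (\<Sum>I\<in>UNIV. if I \<in> S then u (subset_vec I) *\<^sub>R subset_vec I else 0)"
    by (intro sum.cong) (auto simp: w_def)
  also have "\<dots> = x" using u(3) inj by (simp add: sum.If_cases sum.reindex)
  finally have "represents S x w"
    using u(1,2) inj by (auto simp: represents_def w_def sum.If_cases sum.reindex)
  then show "\<exists>w. represents S x w" by blast
next
  assume "\<exists>w. represents S x w"
  then obtain w where w: "represents S x w" by blast
  have "(\<Sum>I\<in>S. w I *\<^sub>R subset_vec I) \<in> subset_polytope S"
    unfolding subset_polytope_def
  proof (rule convex_sum)
    have "sum w S = sum w UNIV"
      using w by (intro sum.mono_neutral_left) (auto simp: represents_def)
    then show "sum w S = 1" using w by (simp add: represents_def)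
  qed (use w in \<open>auto simp: represents_def hull_inc\<close>)
  moreover have "(\<Sum>I\<in>S. w I *\<^sub>R subset_vec I) = (\<Sum>I\<in>UNIV. w I *\<^sub>R subset_vec I)"
    using w by (intro sum.mono_neutral_left) (auto simp: represents_def)
  ultimately show "x \<in> subset_polytope S" using w by (simp add: represents_def)
qed

lemma subset_vec_sorting:
  fixes I J :: "'n::{finite,linorder} set"
  shows "subset_vec (fst (sorting I J)) + subset_vec (snd (sorting I J)) = subset_vec I + subset_vec J"
proof (rule vec_eq_if_partial_sums_eq)
  fix j
  have "(m + 1) div 2 + m div 2 = m" for m :: int by presburger
  then have "cnt (fst (sorting I J)) j + cnt (snd (sorting I J)) j = cnt I j + cnt J j"
    by (simp add: cnt_sorting)
  then have "real_of_int (cnt (fst (sorting I J)) j) + real_of_int (cnt (snd (sorting I J)) j)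
      = real_of_int (cnt I j) + real_of_int (cnt J j)"
    by (metis of_int_add)
  then show "(\<Sum>i\<le>j. (subset_vec (fst (sorting I J)) + subset_vec (snd (sorting I J))) $ i) =
        (\<Sum>i\<le>j. (subset_vec I + subset_vec J) $ i)"
    by (simp add: sum.distrib sum_atMost_subset_vec)
qed

text \<open>
  Moving a small weight from an unsorted pair to its sorting keeps the represented point and increases the
  mean of \<open>g\<close>.
\<close>

lemma sorted_if_maximal:
  fixes S :: "'n::{finite,linorder} set set"
  assumes S: "sort_closed S" "\<And>I. I \<in> S \<Longrightarrow> card I = k" and g: "strictly_sort_concave k g"
    and w: "represents S x w"
    and max: "\<And>v. represents S x v \<Longrightarrow> (\<Sum>I\<in>UNIV. v I * g I) \<le> (\<Sum>I\<in>UNIV. w I * g I)"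
  shows "sorted_family {I. w I \<noteq> 0}"
  unfolding sorted_family_def
proof (intro ballI, rule ccontr)
  fix I J assume "I \<in> {I. w I \<noteq> 0}" "J \<in> {I. w I \<noteq> 0}" and ns: "\<not> sorted_pair I J"
  then have pos: "w I > 0" "w J > 0" using w by (auto simp: represents_def le_less)
  have IJ: "I \<in> S" "J \<in> S" using pos w by (auto simp: represents_def)
  have "I \<noteq> J" using ns by (auto simp: sorted_pair_def interlacing_def)
  define P where "P = fst (sorting I J)"
  define Q where "Q = snd (sorting I J)"
  have PQ: "P \<in> S" "Q \<in> S" using S IJ by (auto simp: sort_closed_def P_def Q_def)
  have better: "g I + g J < g P + g Q"
    using g ns S(2)[OF IJ(1)] S(2)[OF IJ(2)] unfolding strictly_sort_concave_def P_def Q_def by blast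
  define e where "e = min (w I) (w J)"
  have e: "e > 0" "e \<le> w I" "e \<le> w J" using pos by (auto simp: e_def)
  define \<delta> where "\<delta> X Y = (if Y = X then e else 0)" for X Y :: "'n set"
  define v where "v X = w X + (\<delta> P X + \<delta> Q X - \<delta> I X - \<delta> J X)" for X
  have lin: "(\<Sum>X\<in>UNIV. v X *\<^sub>R f X) = (\<Sum>X\<in>UNIV. w X *\<^sub>R f X) + e *\<^sub>R (f P + f Q - f I - f J)"
    for f :: "'n set \<Rightarrow> 'a::real_vector"
  proof -
    have "(\<Sum>X\<in>UNIV. \<delta> Z X *\<^sub>R f X) = e *\<^sub>R f Z" for Z
    proof -
      have "(\<Sum>X\<in>UNIV. \<delta> Z X *\<^sub>R f X) = (\<Sum>X\<in>UNIV. if X = Z then e *\<^sub>R f X else 0)"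
        by (intro sum.cong) (auto simp: \<delta>_def)
      then show ?thesis by simp
    qed
    then show ?thesis
      by (simp add: v_def scaleR_left_distrib scaleR_left_diff_distrib sum.distrib sum_subtractf
          scaleR_right_distrib scaleR_right_diff_distrib)
  qed
  have "represents S x v"
    unfolding represents_def
  proof (intro conjI allI impI)
    fix X
    have "0 \<le> \<delta> P X" "0 \<le> \<delta> Q X" using e by (auto simp: \<delta>_def)
    moreover have "\<delta> I X + \<delta> J X \<le> w X"
      using \<open>I \<noteq> J\<close> e w by (auto simp: \<delta>_def represents_def)
    ultimately show "0 \<le> v X" by (simp add: v_def)
    show "v X = 0" if "X \<notin> S"
      using that IJ PQ w by (auto simp: v_def \<delta>_def represents_def)
  next
    show "sum v UNIV = 1" using lin[of "\<lambda>_. 1::real"] w by (simp add: represents_def)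
    show "(\<Sum>X\<in>UNIV. v X *\<^sub>R subset_vec X) = x"
      using lin[of subset_vec] subset_vec_sorting[of I J] w by (simp add: represents_def P_def Q_def algebra_simps)
  qed
  then have "(\<Sum>I\<in>UNIV. v I * g I) \<le> (\<Sum>I\<in>UNIV. w I * g I)" by (rule max)
  moreover have "(\<Sum>X\<in>UNIV. v X * g X) = (\<Sum>X\<in>UNIV. w X * g X) + e * (g P + g Q - g I - g J)"
    using lin[of g] by simp
  moreover have "0 < e * (g P + g Q - g I - g J)" using e better by simp
  ultimately show False by linarith
qed

text \<open>
  The representations of a point form a compact set, here inside a Euclidean space with one coordinate for
  each subset.
\<close>

lemma exists_maximal_representation:
  fixes S :: "'n::{finite,linorder} set set" and g :: "'n set \<Rightarrow> real"
  assumes "represents S x u"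
  obtains w where "represents S x w"
    "\<And>v. represents S x v \<Longrightarrow> (\<Sum>I\<in>UNIV. v I * g I) \<le> (\<Sum>I\<in>UNIV. w I * g I)"
proof -
  let ?W = "{w :: real^('n set). represents S x (\<lambda>I. w $ I)}"
  have "?W = {w. \<forall>I. 0 \<le> w $ I} \<inter> {w. \<forall>I. I \<notin> S \<longrightarrow> w $ I = 0} \<inter> {w. (\<Sum>I\<in>UNIV. w $ I) = 1} \<inter>
      {w. (\<Sum>I\<in>UNIV. w $ I *\<^sub>R subset_vec I) = x}"
    by (auto simp: represents_def)
  moreover have "closed {w :: real^('n set). \<forall>I. 0 \<le> w $ I}"
    by (intro closed_Collect_all closed_Collect_le continuous_intros)
  moreover have "closed {w :: real^('n set). \<forall>I. I \<notin> S \<longrightarrow> w $ I = 0}"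
    by (intro closed_Collect_all closed_Collect_imp closed_Collect_eq continuous_intros) auto
  moreover have "closed {w :: real^('n set). (\<Sum>I\<in>UNIV. w $ I) = 1}"
    by (intro closed_Collect_eq continuous_intros)
  moreover have "closed {w :: real^('n set). (\<Sum>I\<in>UNIV. w $ I *\<^sub>R subset_vec I) = x}"
    by (intro closed_Collect_eq continuous_intros)
  ultimately have "closed ?W" by (auto intro!: closed_Int)
  moreover have "bounded ?W"
    unfolding bounded_iff
  proof (intro exI ballI)
    fix w assume w: "w \<in> ?W"
    have "norm w \<le> (\<Sum>I\<in>UNIV. \<bar>w $ I\<bar>)" by (rule norm_le_l1_cart)
    also have "\<dots> = 1" using w by (simp add: represents_def)
    finally show "norm w \<le> 1" .
  qed
  ultimately have "compact ?W" by (simp add: compact_eq_bounded_closed)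
  moreover have "(\<chi> I. u I) \<in> ?W" using assms by (simp add: represents_def)
  moreover have "continuous_on ?W (\<lambda>w. \<Sum>I\<in>UNIV. w $ I * g I)" by (intro continuous_intros)
  ultimately obtain w where w: "w \<in> ?W" "\<And>v. v \<in> ?W \<Longrightarrow> (\<Sum>I\<in>UNIV. v $ I * g I) \<le> (\<Sum>I\<in>UNIV. w $ I * g I)"
    using continuous_attains_sup[of ?W "\<lambda>w. \<Sum>I\<in>UNIV. w $ I * g I"] by blast
  show thesis
  proof (rule that[of "\<lambda>I. w $ I"])
    fix v assume "represents S x v"
    then show "(\<Sum>I\<in>UNIV. v I * g I) \<le> (\<Sum>I\<in>UNIV. w $ I * g I)"
      using w(2)[of "\<chi> I. v I"] by (simp add: represents_def)
  qed (use w in simp)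
qed

lemma exists_sorted_representation:
  fixes S :: "'n::{finite,linorder} set set" and g :: "'n set \<Rightarrow> real"
  assumes S: "sort_closed S" "\<And>I. I \<in> S \<Longrightarrow> card I = k" and g: "strictly_sort_concave k g"
    and x: "x \<in> subset_polytope S"
  obtains w where "represents S x w" "sorted_family {I. w I \<noteq> 0}"
proof -
  obtain u where u: "represents S x u" using x by (auto simp: mem_subset_polytope_iff)
  obtain w where w: "represents S x w"
    "\<And>v. represents S x v \<Longrightarrow> (\<Sum>I\<in>UNIV. v I * g I) \<le> (\<Sum>I\<in>UNIV. w I * g I)"
    using exists_maximal_representation[OF u, of g] by blast
  have "sorted_family {I. w I \<noteq> 0}" by (rule sorted_if_maximal[OF S g w])
  then show thesis using that w(1) by blast
qed

lemma sorted_representation_unique: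
  fixes S :: "'n::{finite,linorder} set set"
  assumes S: "\<And>I. I \<in> S \<Longrightarrow> card I = k" and k: "0 < k"
    and "represents S x v" "represents S x w"
    and "sorted_family {I. v I \<noteq> 0}" "sorted_family {I. w I \<noteq> 0}"
  shows "v = w"
proof (rule sorted_combination_unique[of _ _ k])
  show "card I = k" if "v I \<noteq> 0" for I
    using S[of I] assms(3) that unfolding represents_def by blast
  show "card I = k" if "w I \<noteq> 0" for I
    using S[of I] assms(4) that unfolding represents_def by blast
qed (use assms in \<open>auto simp: represents_def\<close>)

text \<open>
  A maximizer has sorted support, so by uniqueness it is \<open>w\<close>; and \<open>w\<close> is the only maximizer.
\<close>

lemma sorted_representation_strict_max:
  fixes S :: "'n::{finite,linorder} set set"
  assumes S: "sort_closed S" "\<And>I. I \<in> S \<Longrightarrow> card I = k" and k: "0 < k" and g: "strictly_sort_concave k g"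
    and v: "represents S x v" and w: "represents S x w" "sorted_family {I. w I \<noteq> 0}" and ne: "v \<noteq> w"
  shows "(\<Sum>I\<in>UNIV. v I * g I) < (\<Sum>I\<in>UNIV. w I * g I)"
proof -
  obtain m where m: "represents S x m"
    and max: "\<And>u. represents S x u \<Longrightarrow> (\<Sum>I\<in>UNIV. u I * g I) \<le> (\<Sum>I\<in>UNIV. m I * g I)"
    using exists_maximal_representation[OF v, of g] by blast
  have "m = w"
    by (rule sorted_representation_unique[OF S(2) k m w(1) sorted_if_maximal[OF S g m max] w(2)])
  show ?thesis
  proof (rule ccontr)
    assume "\<not> ?thesis"
    then have v_max: "(\<Sum>I\<in>UNIV. u I * g I) \<le> (\<Sum>I\<in>UNIV. v I * g I)" if "represents S x u" for u
      using max[OF that] \<open>m = w\<close> by simp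
    have "sorted_family {I. v I \<noteq> 0}" by (rule sorted_if_maximal[OF S g v v_max])
    then show False using sorted_representation_unique[OF S(2) k v w(1) _ w(2)] ne by blast
  qed
qed

section \<open>Simplices of sorted families cover the polytope\<close>

lemma sorted_family_subset: "sorted_family B \<Longrightarrow> A \<subseteq> B \<Longrightarrow> sorted_family A"
  by (auto simp: sorted_family_def)

lemma sum_subset_polytope:
  fixes S :: "'n::finite set set"
  assumes "\<And>I. I \<in> S \<Longrightarrow> card I = k" "x \<in> subset_polytope S"
  shows "(\<Sum>i\<in>UNIV. x $ i) = real k"
proof -
  obtain w where w: "represents S x w" using assms(2) by (auto simp: mem_subset_polytope_iff)
  then have "(\<Sum>i\<in>UNIV. x $ i) = (\<Sum>I\<in>UNIV. w I * real (card I))"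
    using sum_combination[of w UNIV UNIV] by (simp add: represents_def)
  also have "\<dots> = (\<Sum>I\<in>UNIV. w I * real k)"
    using w assms(1) by (intro sum.cong refl) (auto simp: represents_def)
  also have "\<dots> = real k" using w by (simp add: represents_def flip: sum_distrib_right)
  finally show ?thesis .
qed

lemma inner_axis_sum: "(\<chi> i. 1) \<bullet> (x :: real^'n::finite) = (\<Sum>i\<in>UNIV. x $ i)"
  by (simp add: inner_vec_def)

lemma sum_add_axis: "(\<Sum>i\<in>UNIV. (x + t *\<^sub>R axis j 1 :: real^'n::finite) $ i) = (\<Sum>i\<in>UNIV. x $ i) + t"
  unfolding inner_axis_sum[symmetric] by (simp add: inner_add_right inner_axis)

abbreviation last_axis :: "(real, 'n::{finite,linorder}) vec" where
  "last_axis \<equiv> axis (Max UNIV) 1"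

text \<open>
  The polytope lies in the hyperplane of vectors with coordinate sum \<open>k\<close>. Extending it along the last axis
  gives a set of full dimension, for which interior and Lebesgue measure on the whole space are available.
\<close>

definition cylinder :: "((real, 'n::{finite,linorder}) vec) set \<Rightarrow> ((real, 'n) vec) set" where
  "cylinder P = {x + t *\<^sub>R last_axis | x t. x \<in> P}"

lemma cylinder_eq_sums: "cylinder P = (\<Union>x\<in>P. \<Union>y\<in>span {last_axis}. {x + y})"
  by (auto simp: cylinder_def span_singleton)

lemma mem_cylinder_iff:
  assumes "\<And>y. y \<in> P \<Longrightarrow> (\<Sum>i\<in>UNIV. y $ i) = c" "(\<Sum>i\<in>UNIV. x $ i) = c"
  shows "x \<in> cylinder P \<longleftrightarrow> x \<in> P"
proof
  assume "x \<in> cylinder P"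
  then obtain y t where y: "y \<in> P" "x = y + t *\<^sub>R last_axis" by (auto simp: cylinder_def)
  have "(\<Sum>i\<in>UNIV. (y + t *\<^sub>R last_axis) $ i) = c + t"
    unfolding sum_add_axis using assms(1)[OF y(1)] by simp
  then have "t = 0" using assms(2) y(2) by simp
  then show "x \<in> P" using y by simp
next
  assume "x \<in> P"
  then have "x + 0 *\<^sub>R last_axis \<in> cylinder P" unfolding cylinder_def by blast
  then show "x \<in> cylinder P" by simp
qed

lemma subset_cylinder: "P \<subseteq> cylinder P"
proof
  fix x assume "x \<in> P"
  then have "x + 0 *\<^sub>R last_axis \<in> cylinder P" unfolding cylinder_def by blast
  then show "x \<in> cylinder P" by simp
qed

lemma convex_cylinder: "convex P \<Longrightarrow> convex (cylinder P)"
  unfolding cylinder_eq_sums using convex_sums[of P "span {last_axis}"] subspace_imp_convex subspace_span by blast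

lemma compact_subset_polytope: "compact (subset_polytope S)"
  unfolding subset_polytope_def by (intro finite_imp_compact_convex_hull) auto

lemma closed_cylinder: "compact P \<Longrightarrow> closed (cylinder P)"
  unfolding cylinder_eq_sums using compact_closed_sums[of P "span {last_axis}"] closed_subspace subspace_span by blast

text \<open>
  Otherwise the cylinder lies in a hyperplane, whose normal vector \<open>a\<close> has last entry 0 because the cylinder
  contains lines along the last axis. The polytope affinely spans all vectors with sum \<open>k\<close>, and
  differences of unit vectors then force all other entries of \<open>a\<close> to vanish as well.
\<close>

lemma interior_cylinder_nonempty:
  fixes S :: "'n::{finite,linorder} set set"
  assumes S: "\<And>I. I \<in> S \<Longrightarrow> card I = k" and dim: "aff_dim (subset_polytope S) = int CARD('n) - 1"
  shows "interior (cylinder (subset_polytope S)) \<noteq> {}"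
proof
  let ?P = "subset_polytope S" and ?one = "\<chi> i. 1 :: (real, 'n) vec"
  let ?H = "{x. ?one \<bullet> x = real k}"
  assume "interior (cylinder ?P) = {}"
  moreover have "convex (cylinder ?P)" by (intro convex_cylinder) (simp add: subset_polytope_def)
  ultimately obtain a b where a: "a \<noteq> 0" "cylinder ?P \<subseteq> {x. a \<bullet> x = b}"
    using empty_interior_subset_hyperplane by metis
  have "?P \<noteq> {}" using dim by auto
  then obtain p where p: "p \<in> ?P" by blast
  have "p + 1 *\<^sub>R last_axis \<in> cylinder ?P" using p unfolding cylinder_def by blast
  then have "a \<bullet> (p + last_axis) = b" using a(2) by auto
  moreover have "a \<bullet> p = b" using a(2) p subset_cylinder by blast
  ultimately have last: "a $ Max UNIV = 0" by (simp add: inner_add_right inner_axis)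
  have PH: "?P \<subseteq> ?H" using sum_subset_polytope[OF S] by (auto simp: inner_axis_sum)
  have "?one \<noteq> 0" by (simp add: vec_eq_iff)
  have "affine hull ?P = affine hull ?H"
  proof (rule ccontr)
    assume "affine hull ?P \<noteq> affine hull ?H"
    then have "affine hull ?P \<subset> affine hull ?H" using hull_mono[OF PH, of affine] by blast
    then have "aff_dim ?P < aff_dim ?H" by (rule aff_dim_psubset)
    then show False using dim aff_dim_hyperplane[OF \<open>?one \<noteq> 0\<close>, of "real k"] by simp
  qed
  moreover have "affine hull ?P \<subseteq> {x. a \<bullet> x = b}"
    using a(2) subset_cylinder[of ?P] by (intro hull_minimal affine_hyperplane) auto
  ultimately have H: "?H \<subseteq> {x. a \<bullet> x = b}" using hull_subset[of ?H affine] by blast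
  have "a $ i = 0" for i
  proof -
    have "?one \<bullet> p = real k" unfolding inner_axis_sum by (rule sum_subset_polytope[OF S p])
    then have "p + axis i 1 - last_axis \<in> ?H"
      by (simp add: inner_add_right inner_diff_right inner_axis)
    then have "a \<bullet> (p + axis i 1 - last_axis) = b" using H by blast
    then show ?thesis using \<open>a \<bullet> p = b\<close> last by (simp add: inner_add_right inner_diff_right inner_axis)
  qed
  then show False using a(1) by (simp add: vec_eq_iff)
qed

text \<open>
  With fewer than \<open>n\<close> vertices, some \<open>c \<noteq> 0\<close> is orthogonal to all of them. Subtracting a multiple of the all-ones
  vector makes it orthogonal to the last axis, too, and constant on the vertices; the result is nonzero because
  the all-ones vector is not orthogonal to any vertex.
\<close>

lemma negligible_cylinder:
  fixes F :: "'n::{finite,linorder} set set"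
  assumes F: "\<And>I. I \<in> F \<Longrightarrow> card I = k" and k: "0 < k" and card: "card F < CARD('n)"
  shows "negligible (cylinder (subset_polytope F))"
proof (cases "F = {}")
  case True
  then show ?thesis by (simp add: cylinder_def subset_polytope_def)
next
  case False
  then obtain I0 where I0: "I0 \<in> F" by blast
  have "dim (subset_vec ` F) \<le> card (subset_vec ` F)" by (rule dim_le_card') simp
  also have "\<dots> < DIM((real, 'n) vec)" using card card_image_le[of F subset_vec] by simp
  finally obtain c where c: "c \<noteq> 0" "span (subset_vec ` F) \<subseteq> {x. c \<bullet> x = 0}"
    using lowdim_subset_hyperplane by metis
  have cI: "c \<bullet> subset_vec I = 0" if "I \<in> F" for I
    using c(2) that span_base[of "subset_vec I" "subset_vec ` F"] by blast
  let ?one = "\<chi> i. 1 :: (real, 'n) vec"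
  define l where "l = c $ Max UNIV"
  define c' where "c' = c - l *\<^sub>R ?one"
  have one: "?one \<bullet> subset_vec I = real k" if "I \<in> F" for I
    using F[OF that] sum_subset_vec[of I UNIV] by (simp add: inner_axis_sum)
  have "c' \<noteq> 0"
  proof
    assume "c' = 0"
    then have "c = l *\<^sub>R ?one" by (simp add: c'_def)
    then have "l * real k = 0" using cI[OF I0] one[OF I0] by simp
    then show False using k c(1) \<open>c = l *\<^sub>R ?one\<close> by simp
  qed
  moreover have "cylinder (subset_polytope F) \<subseteq> {x. c' \<bullet> x = - l * real k}"
  proof -
    have "subset_polytope F \<subseteq> {x. c' \<bullet> x = - l * real k}"
      unfolding subset_polytope_def
    proof (rule hull_minimal)
      show "subset_vec ` F \<subseteq> {x. c' \<bullet> x = - l * real k}"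
        using cI one by (auto simp: c'_def inner_diff_left)
    qed (rule convex_hyperplane)
    moreover have "c' \<bullet> last_axis = 0"
      by (simp add: c'_def inner_diff_left inner_axis l_def)
    ultimately show ?thesis by (auto simp: cylinder_def inner_add_right)
  qed
  ultimately show ?thesis using negligible_hyperplane negligible_subset by blast
qed

text \<open>
  The height function \<open>g\<close> singles out the sorted representations as maximizers. Logarithms of minors provide
  such a function.
\<close>

locale sort_closed_family =
  fixes S :: "'n::{finite,linorder} set set" and k :: nat and g :: "'n set \<Rightarrow> real"
  assumes closed: "sort_closed S" and card_S: "\<And>I. I \<in> S \<Longrightarrow> card I = k" and k: "0 < k"
    and g: "strictly_sort_concave k g"
    and full_dim: "aff_dim (subset_polytope S) = int CARD('n) - 1"
begin

text \<open>
  The simplices with \<open>n\<close> vertices form a closed set. If it missed a point of the polytope, it would miss an open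
  set of interior points of the cylinder; but these would be covered by finitely many null sets.
\<close>

lemma mem_full_simplex:
  assumes x: "x \<in> subset_polytope S"
  obtains B where "B \<subseteq> S" "sorted_family B" "card B = CARD('n)" "x \<in> subset_polytope B"
proof -
  let ?C = "\<lambda>F. cylinder (subset_polytope F)"
  define full where "full = {B. B \<subseteq> S \<and> sorted_family B \<and> card B = CARD('n)}"
  define thin where "thin = {B. B \<subseteq> S \<and> sorted_family B \<and> card B < CARD('n)}"
  have cover: "subset_polytope S \<subseteq> (\<Union>F\<in>full \<union> thin. subset_polytope F)"
  proof
    fix y assume "y \<in> subset_polytope S"
    then obtain w where w: "represents S y w" "sorted_family {I. w I \<noteq> 0}"
      using exists_sorted_representation[OF closed card_S g] by blast
    let ?F = "{I. w I \<noteq> 0}"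
    have "?F \<subseteq> S" using w(1) by (auto simp: represents_def)
    moreover have "card ?F \<le> CARD('n)"
      using card_sorted_family_le[OF w(2) _ k] card_S \<open>?F \<subseteq> S\<close> by blast
    moreover have "y \<in> subset_polytope ?F"
      using w(1) by (auto simp: mem_subset_polytope_iff represents_def)
    ultimately show "y \<in> (\<Union>F\<in>full \<union> thin. subset_polytope F)"
      using w(2) by (auto simp: full_def thin_def le_less)
  qed
  have "\<exists>B\<in>full. x \<in> subset_polytope B"
  proof (rule ccontr)
    assume "\<not> (\<exists>B\<in>full. x \<in> subset_polytope B)"
    then have none: "x \<notin> subset_polytope B" if "B \<in> full" for B
      using that by blast
    have "x \<notin> ?C B" if "B \<in> full" for B
    proof -
      have "(\<Sum>i\<in>UNIV. y $ i) = real k" if "y \<in> subset_polytope B" for y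
        using sum_subset_polytope[of B k y] \<open>B \<in> full\<close> card_S that by (auto simp: full_def)
      then show ?thesis
        using none[OF that] mem_cylinder_iff[of "subset_polytope B" "real k" x] sum_subset_polytope[OF card_S x] by blast
    qed
    moreover have "closed (\<Union>B\<in>full. ?C B)"
      by (intro closed_UN) (auto intro: closed_cylinder compact_subset_polytope)
    ultimately have "open (- (\<Union>B\<in>full. ?C B))" "x \<in> - (\<Union>B\<in>full. ?C B)" by (blast intro: open_Compl)+
    moreover have "x \<in> closure (interior (?C S))"
    proof -
      have "convex (?C S)" by (intro convex_cylinder) (simp add: subset_polytope_def)
      then have "closure (interior (?C S)) = closure (?C S)"
        using convex_closure_interior interior_cylinder_nonempty[OF card_S full_dim] by blast
      then show ?thesis using x subset_cylinder closure_subset by blast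
    qed
    ultimately have "- (\<Union>B\<in>full. ?C B) \<inter> interior (?C S) \<noteq> {}"
      by (meson open_Int_closure_eq_empty disjoint_iff)
    moreover have "open (- (\<Union>B\<in>full. ?C B) \<inter> interior (?C S))"
      using \<open>open (- (\<Union>B\<in>full. ?C B))\<close> by (intro open_Int open_interior)
    moreover have "negligible (- (\<Union>B\<in>full. ?C B) \<inter> interior (?C S))"
    proof (rule negligible_subset)
      show "negligible (\<Union>F\<in>thin. ?C F)"
        by (intro negligible_Union) (use card_S k in \<open>auto simp: thin_def intro!: negligible_cylinder\<close>)
      have "?C S \<subseteq> (\<Union>F\<in>full \<union> thin. ?C F)"
        using cover unfolding cylinder_def by blast
      then show "- (\<Union>B\<in>full. ?C B) \<inter> interior (?C S) \<subseteq> (\<Union>F\<in>thin. ?C F)"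
        using interior_subset[of "?C S"] by blast
    qed
    ultimately show False using open_not_negligible by blast
  qed
  then show thesis using that by (auto simp: full_def)
qed

text \<open>
  The barycentre of \<open>A\<close> lies in a full simplex, and by uniqueness its representation there has support \<open>A\<close>.
\<close>

lemma extend_to_full_simplex:
  assumes A: "A \<subseteq> S" "sorted_family A"
  obtains B where "A \<subseteq> B" "B \<subseteq> S" "sorted_family B" "card B = CARD('n)"
proof (cases "A = {}")
  case True
  have "subset_polytope S \<noteq> {}" using full_dim by auto
  then obtain x where "x \<in> subset_polytope S" by blast
  then obtain B where "B \<subseteq> S" "sorted_family B" "card B = CARD('n)" by (rule mem_full_simplex)
  then show thesis using that True by blast
next
  case False
  define w where "w I = (if I \<in> A then 1 / real (card A) else 0)" for I
  define x where "x = (\<Sum>I\<in>UNIV. w I *\<^sub>R subset_vec I)"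
  have "card A \<noteq> 0" using False by simp
  then have w: "represents S x w" using A by (auto simp: represents_def x_def w_def sum.If_cases)
  then have "x \<in> subset_polytope S" by (auto simp: mem_subset_polytope_iff)
  then obtain B where B: "B \<subseteq> S" "sorted_family B" "card B = CARD('n)" "x \<in> subset_polytope B"
    by (rule mem_full_simplex)
  then obtain v where v: "represents B x v" by (auto simp: mem_subset_polytope_iff)
  have v': "represents S x v" and vB: "{I. v I \<noteq> 0} \<subseteq> B" using v B(1) by (auto simp: represents_def)
  have wA: "{I. w I \<noteq> 0} = A" using \<open>card A \<noteq> 0\<close> by (auto simp: w_def)
  have "v = w"
    using sorted_representation_unique[OF card_S k v' w] sorted_family_subset[OF B(2) vB] wA A(2) by simp
  then have "A \<subseteq> B" using vB wA by simp
  then show thesis using that B by blast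
qed

text \<open>
  The value at \<open>J\<close> lies below the affine function that interpolates \<open>g\<close> on the simplex \<open>B\<close>. To see this, move from
  the barycentre of \<open>B\<close> slightly towards \<open>J\<close>: the point is still in the simplex, its sorted representation
  has mean value 0 for \<open>g + T\<close>, and the representation that uses \<open>J\<close> has a strictly smaller one.
\<close>

lemma neg_off_full_simplex:
  assumes B: "B \<subseteq> S" "sorted_family B" "card B = CARD('n)" and T: "linear T"
    and TB: "\<And>I. I \<in> B \<Longrightarrow> g I + T (subset_vec I) = 0" and J: "J \<in> S" "J \<notin> B"
  shows "g J + T (subset_vec J) < (0 :: real)"
proof -
  have B_k: "\<And>I. I \<in> B \<Longrightarrow> card I = k" using B(1) card_S by blast
  have inj: "inj_on subset_vec B" using inj_subset_vec by (rule inj_on_subset) simp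
  have "UNIV \<subseteq> span (subset_vec ` B)"
    using independent_sorted[OF B(2) B_k k] B(3) card_image[OF inj]
    by (intro card_ge_dim_independent) auto
  then have "subset_vec J \<in> range (\<lambda>u. \<Sum>v\<in>subset_vec ` B. u v *\<^sub>R v)"
    by (subst span_finite[symmetric]) auto
  then obtain u where u': "subset_vec J = (\<Sum>v\<in>subset_vec ` B. u v *\<^sub>R v)"
    by (rule imageE)
  note u = u'[symmetric]
  define c where "c I = (if I \<in> B then u (subset_vec I) else 0)" for I
  have c: "(\<Sum>I\<in>UNIV. c I *\<^sub>R subset_vec I) = subset_vec J"
  proof -
    have "(\<Sum>I\<in>UNIV. c I *\<^sub>R subset_vec I) = (\<Sum>I\<in>UNIV. if I \<in> B then u (subset_vec I) *\<^sub>R subset_vec I else 0)"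
      by (intro sum.cong) (auto simp: c_def)
    then show ?thesis using u inj by (simp add: sum.If_cases sum.reindex)
  qed
  have "(\<Sum>I\<in>UNIV. c I * real k) = (\<Sum>I\<in>UNIV. c I * real (card (I \<inter> UNIV)))"
    by (intro sum.cong refl) (auto simp: c_def B_k)
  also have "\<dots> = real k"
    using sum_combination[of c UNIV UNIV] c sum_subset_vec[of J UNIV] card_S[OF J(1)] by simp
  finally have sum_c: "sum c UNIV = 1" using k by (simp add: sum_distrib_right[symmetric])
  define n where "n = real CARD('n)"
  define M where "M = (\<Sum>I\<in>UNIV. \<bar>c I\<bar>)"
  define e where "e = 1 / (1 + n * M)"
  have n: "n > 0" by (simp add: n_def)
  have M: "M \<ge> 0" by (simp add: M_def sum_nonneg)
  have e: "e > 0" using n M by (simp add: e_def add_pos_nonneg)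
  have "e * (1 + n * M) = 1" using n M by (simp add: e_def add_pos_nonneg less_imp_neq[symmetric])
  then have e1: "1 - e = e * (n * M)" by (simp add: algebra_simps)
  \<comment> \<open>two representations of the barycentre of \<open>B\<close> moved towards \<open>J\<close>; the choice of \<open>e\<close> keeps the weights \<open>w\<close> nonnegative\<close>
  define v where "v I = (if I \<in> B then (1 - e) / n else 0) + (if I = J then e else 0)" for I
  define w where "w I = (if I \<in> B then (1 - e) / n else 0) + e * c I" for I
  define x where "x = (\<Sum>I\<in>UNIV. w I *\<^sub>R subset_vec I)"
  have lin_v: "(\<Sum>I\<in>UNIV. v I *\<^sub>R f I) = (\<Sum>I\<in>B. ((1 - e) / n) *\<^sub>R f I) + e *\<^sub>R f J"
    for f :: "'n set \<Rightarrow> 'b::real_vector"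
  proof -
    have "(\<Sum>I\<in>UNIV. v I *\<^sub>R f I) = (\<Sum>I\<in>UNIV. (if I \<in> B then ((1 - e) / n) *\<^sub>R f I else 0) + (if I = J then e *\<^sub>R f I else 0))"
      using J(2) by (intro sum.cong) (auto simp: v_def)
    then show ?thesis by (simp add: sum.distrib sum.If_cases)
  qed
  have lin_w: "(\<Sum>I\<in>UNIV. w I *\<^sub>R f I) = (\<Sum>I\<in>B. ((1 - e) / n) *\<^sub>R f I) + e *\<^sub>R (\<Sum>I\<in>UNIV. c I *\<^sub>R f I)"
    for f :: "'n set \<Rightarrow> 'b::real_vector"
  proof -
    have "(\<Sum>I\<in>UNIV. w I *\<^sub>R f I) = (\<Sum>I\<in>UNIV. (if I \<in> B then ((1 - e) / n) *\<^sub>R f I else 0) + e *\<^sub>R (c I *\<^sub>R f I))"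
      by (intro sum.cong) (auto simp: w_def scaleR_add_left)
    then show ?thesis by (simp add: sum.distrib sum.If_cases scaleR_right.sum)
  qed
  have total: "(\<Sum>I\<in>B. (1 - e) / n) = 1 - e" using B(3) n by (simp add: n_def)
  have w_pos: "0 \<le> w I" for I
  proof (cases "I \<in> B")
    case True
    have "\<bar>c I\<bar> \<le> M" unfolding M_def by (rule member_le_sum) auto
    then have "- M \<le> c I" by linarith
    then have "e * (- M) \<le> e * c I" using e by (intro mult_left_mono) auto
    moreover have "(1 - e) / n = e * M" using e1 n by (simp add: field_simps)
    ultimately show ?thesis using True by (simp add: w_def)
  qed (simp add: w_def c_def)
  have "represents S x w"
    using w_pos B(1) lin_w[of "\<lambda>_. 1::real"] total sum_c
    by (auto simp: represents_def x_def w_def c_def subset_iff)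
  moreover have "sorted_family {I. w I \<noteq> 0}"
    by (rule sorted_family_subset[OF B(2)]) (auto simp: w_def c_def)
  moreover have "represents S x v"
  proof -
    have "0 \<le> v I" for I using e e1 n M by (simp add: v_def)
    moreover have "(\<Sum>I\<in>UNIV. v I *\<^sub>R subset_vec I) = x"
      unfolding x_def lin_v lin_w c ..
    ultimately show ?thesis
      using B(1) J lin_v[of "\<lambda>_. 1::real"] total by (auto simp: represents_def v_def)
  qed
  moreover have "v \<noteq> w"
  proof
    assume "v = w"
    then have "v J = w J" by simp
    then show False using J(2) e by (simp add: v_def w_def c_def)
  qed
  ultimately have lt: "(\<Sum>I\<in>UNIV. v I * g I) < (\<Sum>I\<in>UNIV. w I * g I)"
    using sorted_representation_strict_max[OF closed card_S k g] by blast
  have Tx: "(\<Sum>I\<in>UNIV. u I * T (subset_vec I)) = T x" if "(\<Sum>I\<in>UNIV. u I *\<^sub>R subset_vec I) = x" for u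
    using that[symmetric] by (simp add: linear_sum[OF T] linear_scale[OF T])
  have "(\<Sum>I\<in>UNIV. v I * (g I + T (subset_vec I))) < (\<Sum>I\<in>UNIV. w I * (g I + T (subset_vec I)))"
    using lt Tx[of v] Tx[of w] \<open>represents S x v\<close> \<open>represents S x w\<close>
    by (simp add: distrib_left sum.distrib represents_def)
  also have "\<dots> = 0"
    by (rule sum.neutral) (auto simp: w_def c_def TB)
  finally have "e * (g J + T (subset_vec J)) < 0"
    using lin_v[of "\<lambda>I. g I + T (subset_vec I)"] TB by simp
  then show ?thesis using e by (simp add: mult_less_0_iff)
qed

text \<open>
  On a full simplex that contains \<open>A\<close>, let \<open>T\<close> interpolate \<open>-g\<close> on \<open>A\<close> and values slightly below \<open>-g\<close> on the
  other vertices. The strict inequalities off the simplex survive a small perturbation.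
\<close>

lemma supporting_functional:
  assumes A: "A \<subseteq> S" "sorted_family A"
  obtains T :: "(real, 'n) vec \<Rightarrow> real" where "linear T"
    "\<And>I. I \<in> A \<Longrightarrow> g I + T (subset_vec I) = 0"
    "\<And>J. J \<in> S - A \<Longrightarrow> g J + T (subset_vec J) < 0"
proof -
  obtain B where B: "A \<subseteq> B" "B \<subseteq> S" "sorted_family B" "card B = CARD('n)"
    using extend_to_full_simplex[OF A] .
  have ind: "independent (subset_vec ` B)"
    using independent_sorted[OF B(3) _ k] B(2) card_S by blast
  have interpolate: "\<exists>T :: (real, 'n) vec \<Rightarrow> real. linear T \<and> (\<forall>I\<in>B. T (subset_vec I) = r I)"
    for r :: "'n set \<Rightarrow> real"
  proof -
    obtain T :: "(real, 'n) vec \<Rightarrow> real" where "linear T" "\<forall>x\<in>subset_vec ` B. T x = r (inv subset_vec x)"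
      using linear_independent_extend[OF ind, of "\<lambda>x. r (inv subset_vec x)"] by blast
    then show ?thesis by (intro exI[of _ T]) (auto simp: inv_f_f[OF inj_subset_vec])
  qed
  obtain T0 :: "(real, 'n) vec \<Rightarrow> real" where T0: "linear T0" "\<forall>I\<in>B. T0 (subset_vec I) = - g I"
    using interpolate[of "\<lambda>I. - g I"] by blast
  obtain T1 :: "(real, 'n) vec \<Rightarrow> real" where T1: "linear T1" "\<forall>I\<in>B. T1 (subset_vec I) = (if I \<in> A then 0 else 1)"
    using interpolate[of "\<lambda>I. if I \<in> A then 0 else 1"] by blast
  have neg: "g J + T0 (subset_vec J) < 0" if "J \<in> S - B" for J
    using neg_off_full_simplex[OF B(2-4) T0(1)] T0(2) that by auto
  have "\<forall>\<^sub>F d in at_right 0. \<forall>J\<in>S - B. g J + T0 (subset_vec J) - d * T1 (subset_vec J) < 0"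
  proof (rule eventually_ball_finite)
    show "\<forall>J\<in>S - B. \<forall>\<^sub>F d in at_right 0. g J + T0 (subset_vec J) - d * T1 (subset_vec J) < 0"
    proof
      fix J assume "J \<in> S - B"
      have "((\<lambda>d. g J + T0 (subset_vec J) - d * T1 (subset_vec J)) \<longlongrightarrow>
            g J + T0 (subset_vec J) - 0 * T1 (subset_vec J)) (at_right 0)"
        by (intro tendsto_intros)
      then show "\<forall>\<^sub>F d in at_right 0. g J + T0 (subset_vec J) - d * T1 (subset_vec J) < 0"
        using neg[OF \<open>J \<in> S - B\<close>] by (intro order_tendstoD(2)) auto
    qed
  qed simp
  then have "\<forall>\<^sub>F d in at_right (0::real). d > 0 \<and> (\<forall>J\<in>S - B. g J + T0 (subset_vec J) - d * T1 (subset_vec J) < 0)"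
    using eventually_at_right_less[of "0::real"] by eventually_elim auto
  then obtain d where d: "d > 0" "\<And>J. J \<in> S - B \<Longrightarrow> g J + T0 (subset_vec J) - d * T1 (subset_vec J) < 0"
    using eventually_happens'[OF trivial_limit_at_right_real] by blast
  show thesis
  proof (rule that[of "\<lambda>x. T0 x - d * T1 x"])
    show "linear (\<lambda>x. T0 x - d * T1 x)"
      using linear_compose_sub[OF T0(1) linear_compose_scale_right[OF T1(1), of d]] by simp
    show "g I + (T0 (subset_vec I) - d * T1 (subset_vec I)) = 0" if "I \<in> A" for I
      using that B(1) T0(2) T1(2) by auto
    show "g J + (T0 (subset_vec J) - d * T1 (subset_vec J)) < 0" if "J \<in> S - A" for J
      using d(2)[of J] d(1) T0(2) T1(2) that by (cases "J \<in> B") auto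
  qed
qed

end

section \<open>Lebesgue measure of prisms\<close>

text \<open>
  A copy of a finite linearly ordered type that is an instance of the class \<open>wellorder\<close>. The change of variables
  formula for linear maps is stated for index types of that class.
\<close>

typedef 'a fin_wo = "UNIV :: 'a set" morphisms of_wo to_wo ..

lemma bij_of_wo: "bij of_wo"
  using of_wo_inject to_wo_inverse by (intro bijI injI) (auto intro!: surjI[of _ to_wo])

instance fin_wo :: (finite) finite
proof
  show "finite (UNIV :: 'a fin_wo set)"
    using bij_of_wo[where 'a='a] by (auto simp: bij_def intro: finite_imageD[of of_wo])
qed

instantiation fin_wo :: (linorder) linorder
begin

definition "x \<le> y \<longleftrightarrow> of_wo x \<le> of_wo y" for x y :: "'a fin_wo"

definition "x < y \<longleftrightarrow> of_wo x < of_wo y" for x y :: "'a fin_wo"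

instance
proof
  fix x y z :: "'a fin_wo"
  show "x < y \<longleftrightarrow> x \<le> y \<and> \<not> y \<le> x" "x \<le> x" "x \<le> y \<or> y \<le> x"
    by (auto simp: less_eq_fin_wo_def less_fin_wo_def)
  show "x \<le> z" if "x \<le> y" "y \<le> z"
    using that by (auto simp: less_eq_fin_wo_def)
  show "x = y" if "x \<le> y" "y \<le> x"
    using that by (auto simp: less_eq_fin_wo_def of_wo_inject[symmetric])
qed

end

instance fin_wo :: ("{finite,linorder}") wellorder
proof
  fix P :: "'a fin_wo \<Rightarrow> bool" and a
  assume step: "\<And>x. (\<And>y. y < x \<Longrightarrow> P y) \<Longrightarrow> P x"
  show "P a"
  proof (induction "card {..<a}" arbitrary: a rule: less_induct)
    case less
    show ?case
    proof (rule step)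
      fix y assume "y < a"
      then have "card {..<y} < card {..<a}" by (intro psubset_card_mono) auto
      then show "P y" by (rule less)
    qed
  qed
qed

lemma prod_Basis_cart: "(\<Prod>b\<in>(Basis :: (real^'m::finite) set). f b) = (\<Prod>i\<in>UNIV. f (axis i 1))"
proof -
  have "(Basis :: (real^'m) set) = (\<lambda>i. axis i 1) ` UNIV" by (auto simp: Basis_vec_def)
  moreover have "inj (\<lambda>i :: 'm. axis i (1::real))" by (auto simp: inj_def axis_eq_axis)
  ultimately show ?thesis using prod.reindex[of "\<lambda>i :: 'm. axis i (1::real)" UNIV f] by (simp only: o_def)
qed

interpretation lborel_product: product_sigma_finite "\<lambda>_. lborel :: real measure"
  by standard

lemma measurable_vec_PiM:
  fixes e :: "'m::finite \<Rightarrow> 'n"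
  assumes "\<And>i. e i \<in> A"
  shows "(\<lambda>f. \<chi> i. f (e i)) \<in> borel_measurable (Pi\<^sub>M A (\<lambda>_. lborel :: real measure))"
proof (subst borel_measurable_euclidean_space, intro ballI)
  fix b :: "real^'m" assume "b \<in> Basis"
  then obtain i where b: "b = axis i 1" by (auto simp: Basis_vec_def)
  show "(\<lambda>f. (\<chi> i. f (e i)) \<bullet> b) \<in> borel_measurable (Pi\<^sub>M A (\<lambda>_. lborel :: real measure))"
    unfolding b using assms[of i] by (simp add: inner_axis measurable_component_singleton)
qed

text \<open>
  The bijection \<open>e\<close> serves two purposes: with the identity this identifies the product measure over the index type
  with Lebesgue measure, and with \<open>of_wo\<close> it compares the spaces over an index type and over its copy.
\<close>

lemma lborel_eq_distr_PiM:
  fixes e :: "'m::finite \<Rightarrow> 'n::finite"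
  assumes e: "bij e"
  shows "(lborel :: (real^'m) measure) = distr (Pi\<^sub>M (UNIV :: 'n set) (\<lambda>_. lborel)) borel (\<lambda>f. \<chi> i. f (e i))"
proof (rule lborel_eqI)
  fix l u :: "real^'m" assume lu: "\<And>b. b \<in> Basis \<Longrightarrow> l \<bullet> b \<le> u \<bullet> b"
  let ?d = "inv e"
  have le: "l $ i \<le> u $ i" for i using lu[of "axis i 1"] by (auto simp: inner_axis Basis_vec_def)
  have "(\<lambda>f. \<chi> i. f (e i)) -` box l u \<inter> space (Pi\<^sub>M UNIV (\<lambda>_. lborel :: real measure))
      = (\<Pi>\<^sub>E j\<in>UNIV. {l $ ?d j<..<u $ ?d j})"
    using bij_is_surj[OF e] by (auto simp: box_def Basis_vec_def inner_axis space_PiM PiE_iff inv_f_f[OF bij_is_inj[OF e]])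
      (metis e bij_inv_eq_iff)+
  then have "emeasure (distr (Pi\<^sub>M UNIV (\<lambda>_. lborel)) borel (\<lambda>f. \<chi> i. f (e i))) (box l u)
      = emeasure (Pi\<^sub>M UNIV (\<lambda>_. lborel :: real measure)) (\<Pi>\<^sub>E j\<in>UNIV. {l $ ?d j<..<u $ ?d j})"
    by (subst emeasure_distr) (auto intro!: measurable_vec_PiM)
  also have "\<dots> = (\<Prod>j\<in>UNIV. emeasure lborel {l $ ?d j<..<u $ ?d j})"
    by (rule lborel_product.emeasure_PiM) auto
  also have "\<dots> = (\<Prod>j\<in>UNIV. ennreal (u $ ?d j - l $ ?d j))"
    using le by simp
  also have "\<dots> = (\<Prod>i\<in>UNIV. ennreal (u $ i - l $ i))"
    by (rule prod.reindex_bij_betw[OF bij_imp_bij_inv[OF e]])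
  also have "\<dots> = ennreal (\<Prod>i\<in>UNIV. u $ i - l $ i)"
    using le by (intro prod_ennreal) simp
  finally show "emeasure (distr (Pi\<^sub>M UNIV (\<lambda>_. lborel)) borel (\<lambda>f. \<chi> i. f (e i))) (box l u)
      = (\<Prod>b\<in>Basis. (u - l) \<bullet> b)"
    by (simp add: prod_Basis_cart inner_axis)
qed simp

lemma emeasure_lborel_eq_PiM:
  fixes e :: "'m::finite \<Rightarrow> 'n::finite"
    and X :: "(real, 'm) vec set"
  assumes "bij e" "X \<in> sets borel"
  shows "emeasure lborel X = emeasure (Pi\<^sub>M (UNIV :: 'n set) (\<lambda>_. lborel)) {f. (\<chi> i. f (e i)) \<in> X}"
proof -
  have "emeasure lborel X = emeasure (distr (Pi\<^sub>M (UNIV :: 'n set) (\<lambda>_. lborel)) borel (\<lambda>f. \<chi> i. f (e i))) X"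
    using arg_cong[OF lborel_eq_distr_PiM[OF assms(1)], of "\<lambda>M. emeasure M X"] by simp
  also have "\<dots> = emeasure (Pi\<^sub>M (UNIV :: 'n set) (\<lambda>_. lborel))
      ((\<lambda>f. \<chi> i. f (e i)) -` X \<inter> space (Pi\<^sub>M (UNIV :: 'n set) (\<lambda>_. lborel)))"
    by (intro emeasure_distr measurable_vec_PiM assms(2)) simp
  finally show ?thesis by (simp add: space_PiM vimage_def)
qed

lemma det_in_Ints:
  fixes M :: "real^'m::finite^'m"
  assumes "\<And>i j. M $ i $ j \<in> \<int>"
  shows "det M \<in> \<int>"
  unfolding det_def using assms by (intro Ints_sum Ints_mult Ints_prod) auto

definition integral_vec :: "real^'m::finite \<Rightarrow> bool" where
  "integral_vec x \<longleftrightarrow> (\<forall>i. x $ i \<in> \<int>)"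

text \<open>
  The matrices of \<open>f\<close> and \<open>h\<close> are integral and their product is the identity, so their determinants are
  integers with product 1.
\<close>

lemma measure_unimodular_image_wellorder:
  fixes f h :: "(real, 'm::{finite,wellorder}) vec \<Rightarrow> (real, 'm) vec"
  assumes f: "linear f" "\<And>x. integral_vec x \<Longrightarrow> integral_vec (f x)"
    and h: "linear h" "\<And>x. integral_vec x \<Longrightarrow> integral_vec (h x)"
    and fh: "\<And>x. f (h x) = x" and X: "compact X"
  shows "measure lborel (f ` X) = measure lborel X"
proof -
  have ax: "integral_vec (axis j 1 :: (real, 'm) vec)" for j
    by (auto simp: integral_vec_def axis_def)
  have "det (matrix f) \<in> \<int>" "det (matrix h) \<in> \<int>"
    using f(2)[OF ax] h(2)[OF ax] by (auto intro!: det_in_Ints simp: matrix_def integral_vec_def)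
  then obtain a b :: int where ab: "det (matrix f) = of_int a" "det (matrix h) = of_int b"
    by (auto elim!: Ints_cases)
  have "matrix f ** matrix h = mat 1"
    using fh by (simp add: matrix_compose[OF h(1) f(1), symmetric] o_def matrix_id_mat_1 flip: id_def)
  then have "det (matrix f) * det (matrix h) = 1" by (metis det_mul det_I)
  then have "of_int (a * b) = (of_int 1 :: real)" by (simp add: ab)
  then have "a * b = 1" by (simp only: of_int_eq_iff)
  then have "\<bar>a\<bar> = 1" using abs_zmult_eq_1[of a b] by simp
  then have det: "\<bar>det (matrix f)\<bar> = 1" by (simp add: ab flip: of_int_abs)
  have "measure lebesgue (f ` X) = \<bar>det (matrix f)\<bar> * measure lebesgue X"
    using X by (intro measure_linear_image[OF f(1)] lmeasurable_compact)
  moreover have "compact (f ` X)"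
    using X f(1) by (intro compact_continuous_image linear_continuous_on) (auto simp: linear_linear)
  ultimately show ?thesis
    using det X by (simp add: measure_completion borel_compact)
qed

lemma measure_unimodular_image:
  fixes f h :: "(real, 'n::{finite,linorder}) vec \<Rightarrow> (real, 'n) vec"
  assumes f: "linear f" "\<And>x. integral_vec x \<Longrightarrow> integral_vec (f x)"
    and h: "linear h" "\<And>x. integral_vec x \<Longrightarrow> integral_vec (h x)"
    and fh: "\<And>x. f (h x) = x" and X: "compact X"
  shows "measure lborel (f ` X) = measure lborel X"
proof -
  define \<phi> :: "(real, 'n) vec \<Rightarrow> (real, 'n fin_wo) vec" where "\<phi> x = (\<chi> i. x $ of_wo i)" for x
  define \<psi> :: "(real, 'n fin_wo) vec \<Rightarrow> (real, 'n) vec" where "\<psi> y = (\<chi> i. y $ to_wo i)" for y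
  have inv: "\<psi> (\<phi> x) = x" "\<phi> (\<psi> y) = y" for x y
    by (simp_all add: \<phi>_def \<psi>_def to_wo_inverse of_wo_inverse vec_eq_iff)
  have lin: "linear \<phi>" "linear \<psi>"
    by (auto simp: \<phi>_def \<psi>_def linear_iff vec_eq_iff)
  have int: "integral_vec x \<Longrightarrow> integral_vec (\<phi> x)" "integral_vec y \<Longrightarrow> integral_vec (\<psi> y)" for x y
    by (auto simp: integral_vec_def \<phi>_def \<psi>_def)
  have cont: "compact (g ` Y)" if "linear g" "compact Y"
    for g :: "'x::euclidean_space \<Rightarrow> 'y::euclidean_space" and Y
    using that by (intro compact_continuous_image linear_continuous_on) (auto simp: linear_linear)
  have pres: "measure lborel (\<phi> ` Y) = measure lborel Y" if "compact Y" for Y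
  proof -
    have "(\<chi> i. p (of_wo i)) \<in> \<phi> ` Y \<longleftrightarrow> (\<chi> i. p i) \<in> Y" for p
    proof -
      have "(\<chi> i. p (of_wo i)) = \<phi> (\<chi> i. p i)" by (simp add: \<phi>_def)
      then show ?thesis using inv(1) by (metis image_iff)
    qed
    then show ?thesis
      using emeasure_lborel_eq_PiM[OF bij_of_wo, of "\<phi> ` Y"] emeasure_lborel_eq_PiM[of id Y] cont[OF lin(1) that] that
      by (simp add: measure_def borel_compact)
  qed
  have "\<phi> ` (f ` X) = (\<phi> \<circ> f \<circ> \<psi>) ` (\<phi> ` X)" by (simp add: image_image inv)
  then have "measure lborel (\<phi> ` (f ` X)) = measure lborel ((\<phi> \<circ> f \<circ> \<psi>) ` (\<phi> ` X))" by simp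
  also have "\<dots> = measure lborel (\<phi> ` X)"
  proof (rule measure_unimodular_image_wellorder[where h="\<phi> \<circ> h \<circ> \<psi>"])
    show "linear (\<phi> \<circ> f \<circ> \<psi>)" "linear (\<phi> \<circ> h \<circ> \<psi>)"
      using lin f(1) h(1) by (auto intro!: linear_compose)
  qed (use f(2) h(2) int inv fh cont[OF lin(1) X] in auto)
  finally show ?thesis using pres[OF X] pres[OF cont[OF f(1) X]] by simp
qed

text \<open>
  Thickening a set that is a graph over the first coordinates by a unit segment turns its volume in
  dimension \<open>n - 1\<close> into a volume in dimension \<open>n\<close>; this covers the case \<open>n = 1\<close> uniformly.
\<close>

definition prism :: "((real, 'n::{finite,linorder}) vec) set \<Rightarrow> ((real, 'n) vec) set" where
  "prism P = (\<lambda>(x, t). x + t *\<^sub>R last_axis) ` (P \<times> {0..1})"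

lemma compact_prism: "compact P \<Longrightarrow> compact (prism P)"
  unfolding prism_def by (intro compact_continuous_image compact_Times) (auto intro!: continuous_intros simp: case_prod_beta)

text \<open>
  By Fubini: over each point of the projection of \<open>P\<close>, the prism is a segment of length 1 in the last
  coordinate. In the applications \<open>P\<close> is a polytope, with \<open>c = k\<close> and \<open>s = 1\<close>, or a standard simplex in the
  hyperplane where the last coordinate vanishes, with \<open>c = s = 0\<close>.
\<close>

lemma measure_prism:
  fixes P :: "((real, 'n::{finite,linorder}) vec) set" and c s :: real
  assumes P: "compact P"
    and last: "\<And>x. x \<in> P \<Longrightarrow> x $ Max UNIV = c - s * (\<Sum>i\<in>UNIV - {Max UNIV}. x $ i)"
  shows "measure (\<Pi>\<^sub>M i\<in>UNIV - {Max (UNIV :: 'n set)}. (lborel :: real measure)) (drop_last_coord ` P)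
      = measure lborel (prism P)"
proof -
  let ?m = "Max UNIV :: 'n" and ?J = "UNIV - {Max UNIV :: 'n}"
  let ?Q = "\<Pi>\<^sub>M i\<in>?J. (lborel :: real measure)"
  define z where "z q = c - s * (\<Sum>i\<in>?J. q i)" for q :: "'n \<Rightarrow> real"
  define ext where "ext q = (\<chi> i. if i = ?m then z q else q i)" for q
  have z_meas: "z \<in> borel_measurable ?Q"
    unfolding z_def[abs_def] by (auto intro!: borel_measurable_diff borel_measurable_times borel_measurable_sum measurable_component_singleton)
  have ext_meas: "ext \<in> borel_measurable ?Q"
  proof (subst borel_measurable_euclidean_space, intro ballI)
    fix b :: "(real, 'n) vec" assume "b \<in> Basis"
    then obtain i where b: "b = axis i 1" by (auto simp: Basis_vec_def)
    show "(\<lambda>q. ext q \<bullet> b) \<in> borel_measurable ?Q"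
      unfolding b using z_meas by (cases "i = ?m") (auto simp: inner_axis ext_def intro!: measurable_component_singleton)
  qed
  have ext_drop: "ext (drop_last_coord x) = x" if "x \<in> P" for x
  proof -
    have "z (drop_last_coord x) = x $ ?m"
      using last[OF that] by (simp add: z_def drop_last_coord_def)
    then show ?thesis by (simp add: ext_def vec_eq_iff drop_last_coord_def)
  qed
  have drop_ext: "drop_last_coord (ext q) = q" if "q \<in> space ?Q" for q
    using that by (auto simp: drop_last_coord_def ext_def space_PiM PiE_iff extensional_def restrict_def)
  have img: "drop_last_coord ` P = {q \<in> space ?Q. ext q \<in> P}"
  proof
    show "drop_last_coord ` P \<subseteq> {q \<in> space ?Q. ext q \<in> P}"
      using ext_drop by (auto simp: space_PiM drop_last_coord_def)
    show "{q \<in> space ?Q. ext q \<in> P} \<subseteq> drop_last_coord ` P"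
      using drop_ext by force
  qed
  have P_meas: "P \<in> sets borel" using P by (simp add: borel_compact)
  have img_meas: "{q \<in> space ?Q. ext q \<in> P} \<in> sets ?Q"
    using measurable_sets[OF ext_meas P_meas] by (simp add: vimage_def Int_def conj_commute)
  have pr_meas: "prism P \<in> sets borel" using compact_prism[OF P] by (simp add: borel_compact)
  let ?E = "{f :: 'n \<Rightarrow> real. (\<chi> i. f i) \<in> prism P}"
  have E: "?E \<in> sets (Pi\<^sub>M (insert ?m ?J) (\<lambda>_. lborel))"
    using measurable_sets[OF measurable_vec_PiM[of id "insert ?m ?J"] pr_meas]
    by (simp add: vimage_def space_PiM insert_absorb)
  have mem: "q(?m := y) \<in> ?E \<longleftrightarrow> ext q \<in> P \<and> y \<in> {z q..z q + 1}" for q y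
  proof -
    have eq: "(\<chi> i. (q(?m := y)) i) = ext q + (y - z q) *\<^sub>R last_axis"
      by (simp add: vec_eq_iff ext_def axis_def)
    have "x = ext q \<and> t = y - z q" if "x \<in> P" "ext q + (y - z q) *\<^sub>R last_axis = x + t *\<^sub>R last_axis" for x t
    proof -
      have off: "ext q $ i = x $ i" if "i \<noteq> ?m" for i
        using arg_cong[OF \<open>ext q + _ = _\<close>, of "\<lambda>v. v $ i"] that by (simp add: axis_def)
      have "z q = x $ ?m"
        unfolding last[OF \<open>x \<in> P\<close>] z_def using off by (auto simp: ext_def intro!: sum.cong)
      then have "x = ext q" using off by (auto simp: vec_eq_iff ext_def)
      then show ?thesis
        using arg_cong[OF \<open>ext q + _ = _\<close>, of "\<lambda>v. v $ ?m"] by (simp add: axis_def)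
    qed
    then have "ext q + (y - z q) *\<^sub>R last_axis \<in> prism P \<Longrightarrow> ext q \<in> P \<and> y - z q \<in> {0..1}"
      unfolding prism_def by (auto simp del: atLeastAtMost_iff)
    moreover have "ext q + (y - z q) *\<^sub>R last_axis \<in> prism P" if "ext q \<in> P" "y - z q \<in> {0..1}"
      unfolding prism_def using that by (intro image_eqI[of _ _ "(ext q, y - z q)"]) auto
    ultimately have "ext q + (y - z q) *\<^sub>R last_axis \<in> prism P \<longleftrightarrow> ext q \<in> P \<and> y - z q \<in> {0..1}"
      by blast
    then show ?thesis unfolding mem_Collect_eq eq by auto
  qed
  have "emeasure lborel (prism P) = emeasure (Pi\<^sub>M (insert ?m ?J) (\<lambda>_. lborel)) ?E"
    using emeasure_lborel_eq_PiM[of id "prism P"] pr_meas by (simp add: insert_absorb)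
  also have "\<dots> = (\<integral>\<^sup>+f. indicator ?E f \<partial>Pi\<^sub>M (insert ?m ?J) (\<lambda>_. lborel))"
    using E by simp
  also have "\<dots> = (\<integral>\<^sup>+q. (\<integral>\<^sup>+y. indicator ?E (q(?m := y)) \<partial>lborel) \<partial>?Q)"
    using E by (intro lborel_product.product_nn_integral_insert) auto
  also have "\<dots> = (\<integral>\<^sup>+q. indicator {q \<in> space ?Q. ext q \<in> P} q \<partial>?Q)"
  proof (rule nn_integral_cong)
    fix q assume q: "q \<in> space ?Q"
    have "(\<integral>\<^sup>+y. indicator ?E (q(?m := y)) \<partial>lborel) = (\<integral>\<^sup>+y. indicator {q \<in> space ?Q. ext q \<in> P} q * indicator {z q..z q + 1} y \<partial>lborel)"
      using q by (intro nn_integral_cong) (simp only: indicator_def mem, auto)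
    also have "\<dots> = indicator {q \<in> space ?Q. ext q \<in> P} q * emeasure lborel {z q..z q + 1}"
      by (rule nn_integral_cmult_indicator) simp
    finally show "(\<integral>\<^sup>+y. indicator ?E (q(?m := y)) \<partial>lborel) = indicator {q \<in> space ?Q. ext q \<in> P} q"
      by simp
  qed
  also have "\<dots> = emeasure ?Q (drop_last_coord ` P)"
    unfolding img using img_meas by simp
  finally show ?thesis by (simp add: measure_def)
qed

section \<open>Unimodularity of sorted simplices and the volume\<close>

text \<open>
  Between the members of the chain \<open>B\<close> below and above the threshold, some entry \<open>j\<close> of the counting function
  jumps from its lowest value to the next one. In the \<open>j\<close>-th moment, the coefficients above the threshold
  therefore count once more than those below.
\<close>

lemma threshold_sum_in_Ints:
  fixes B :: "'n::{finite,linorder} set set" and c :: "'n set \<Rightarrow> real"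
  assumes B: "sorted_family B" "\<And>I. I \<in> B \<Longrightarrow> card I = k"
    and total: "(\<Sum>I\<in>B. c I) \<in> \<int>"
    and moments: "\<And>j. (\<Sum>I\<in>B. c I * cnt I j) \<in> \<int>"
  shows "(\<Sum>I\<in>{I\<in>B. m \<le> height I}. c I) \<in> \<int>"
proof -
  define U where "U = {I\<in>B. m \<le> height I}"
  define D where "D = {I\<in>B. height I < m}"
  have UD: "B = U \<union> D" "U \<inter> D = {}" by (auto simp: U_def D_def)
  consider "U = {}" | "D = {}" | "U \<noteq> {}" "D \<noteq> {}" by blast
  then have "(\<Sum>I\<in>U. c I) \<in> \<int>"
  proof cases
    case 2
    then show ?thesis using total UD by simp
  next
    case 3
    have sorted: "cnt J j - cnt I j \<in> {0, 1}" if "I \<in> B" "J \<in> B" "height I \<le> height J" for I J j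
      using that B by (intro sorted_pair_height) (auto simp: sorted_family_def)
    \<comment> \<open>\<open>P\<close> and \<open>Q\<close> are the neighbours of the threshold in the chain\<close>
    have "Min (height ` U) \<in> height ` U" "Max (height ` D) \<in> height ` D"
      using 3 by (auto intro!: Min_in Max_in)
    then obtain P Q where P: "P \<in> D" "height P = Max (height ` D)" and Q: "Q \<in> U" "height Q = Min (height ` U)"
      by auto
    have "height P < height Q" using P Q by (auto simp: U_def D_def)
    have "\<exists>j. cnt Q j > cnt P j"
    proof (rule ccontr)
      assume "\<not> (\<exists>j. cnt Q j > cnt P j)"
      then have "height Q \<le> height P" unfolding height_def by (intro sum_mono) (simp add: not_less)
      then show False using \<open>height P < height Q\<close> by simp
    qed
    then obtain j where j: "cnt Q j > cnt P j" by blast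
    have "B \<noteq> {}" using P UD by blast
    then obtain M where M: "M \<in> B" "\<And>J j. J \<in> B \<Longrightarrow> cnt J j - cnt M j \<in> {0, 1}"
      using sorted_family_minimum[OF _ B] by blast
    have PQ: "cnt P j = cnt M j" "cnt Q j = cnt M j + 1"
      using j M(2)[of P j] M(2)[of Q j] P(1) Q(1) UD by auto
    have up: "cnt J j = cnt M j + 1" if "J \<in> U" for J
    proof -
      have "height Q \<le> height J" using Q that by simp
      then show ?thesis using sorted[of Q J j] M(2)[of J j] PQ Q(1) that UD by auto
    qed
    have down: "cnt J j = cnt M j" if "J \<in> D" for J
    proof -
      have "height J \<le> height P" using P that by simp
      then show ?thesis using sorted[of J P j] M(2)[of J j] PQ P(1) that UD by auto
    qed
    have "(\<Sum>I\<in>B. c I * cnt I j) = (\<Sum>I\<in>U. c I * cnt I j) + (\<Sum>I\<in>D. c I * cnt I j)"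
      unfolding UD(1) by (rule sum.union_disjoint) (use UD(2) in auto)
    also have "(\<Sum>I\<in>U. c I * cnt I j) = (\<Sum>I\<in>U. c I * cnt M j) + (\<Sum>I\<in>U. c I)"
      by (simp add: up distrib_left sum.distrib)
    also have "(\<Sum>I\<in>D. c I * cnt I j) = (\<Sum>I\<in>D. c I * cnt M j)"
      by (simp add: down)
    also have "(\<Sum>I\<in>U. c I * cnt M j) + (\<Sum>I\<in>U. c I) + (\<Sum>I\<in>D. c I * cnt M j)
        = (\<Sum>I\<in>U. c I) + ((\<Sum>I\<in>U. c I * cnt M j) + (\<Sum>I\<in>D. c I * cnt M j))" by simp
    also have "(\<Sum>I\<in>U. c I * cnt M j) + (\<Sum>I\<in>D. c I * cnt M j) = (\<Sum>I\<in>B. c I * cnt M j)"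
      unfolding UD(1) by (rule sum.union_disjoint[symmetric]) (use UD(2) in auto)
    also have "(\<Sum>I\<in>B. c I * cnt M j) = (\<Sum>I\<in>B. c I) * cnt M j" by (simp add: sum_distrib_right)
    finally have "(\<Sum>I\<in>U. c I) = (\<Sum>I\<in>B. c I * cnt I j) - (\<Sum>I\<in>B. c I) * cnt M j" by simp
    then show ?thesis using total moments[of j] by simp
  qed simp
  then show ?thesis by (simp add: U_def)
qed

text \<open>
  A coefficient is the difference of two consecutive threshold sums. This is the unimodularity of sorted
  simplices: every integral vector in the span of the differences of the vertices is an integral combination
  of them.
\<close>

lemma coefficient_in_Ints:
  fixes B :: "'n::{finite,linorder} set set" and c :: "'n set \<Rightarrow> real"
  assumes B: "sorted_family B" "\<And>I. I \<in> B \<Longrightarrow> card I = k"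
    and total: "(\<Sum>I\<in>B. c I) \<in> \<int>" and int: "integral_vec (\<Sum>I\<in>B. c I *\<^sub>R subset_vec I)" and I: "I \<in> B"
  shows "c I \<in> \<int>"
proof -
  have moments: "(\<Sum>I\<in>B. c I * cnt I j) \<in> \<int>" for j
  proof -
    have "(\<Sum>I\<in>B. c I * cnt I j) = (\<Sum>i\<le>j. (\<Sum>I\<in>B. c I *\<^sub>R subset_vec I) $ i)"
      by (subst sum_combination) (simp add: cnt_def)
    also have "\<dots> \<in> \<int>" using int unfolding integral_vec_def by (intro Ints_sum) blast
    finally show ?thesis .
  qed
  have inj: "J = I" if "J \<in> B" "height J = height I" for J
  proof (rule eq_if_cnt_eq)
    fix j
    have "sorted_pair J I" "sorted_pair I J" "card J = card I" using B I that by (auto simp: sorted_family_def)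
    then show "cnt J j = cnt I j"
      using sorted_pair_height[of I J j] sorted_pair_height[of J I j] that(2) by auto
  qed
  have "{J\<in>B. height I \<le> height J} = insert I {J\<in>B. height I + 1 \<le> height J}"
  proof (intro equalityI subsetI)
    fix J assume J: "J \<in> {J\<in>B. height I \<le> height J}"
    then show "J \<in> insert I {J\<in>B. height I + 1 \<le> height J}"
      using inj[of J] by (cases "height J = height I") auto
  qed (use I in auto)
  then have "(\<Sum>J\<in>{J\<in>B. height I \<le> height J}. c J) = c I + (\<Sum>J\<in>{J\<in>B. height I + 1 \<le> height J}. c J)"
    by simp
  then have "c I = (\<Sum>J\<in>{J\<in>B. height I \<le> height J}. c J) - (\<Sum>J\<in>{J\<in>B. height I + 1 \<le> height J}. c J)"
    by simp
  also have "\<dots> \<in> \<int>" by (intro Ints_diff threshold_sum_in_Ints[OF B total moments])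
  finally show ?thesis .
qed

lemma measure_standard_prism:
  fixes D :: "(real, 'n::{finite,linorder}) vec set"
  defines "D \<equiv> {x. x $ Max UNIV = 0 \<and> (\<forall>i. 0 \<le> x $ i) \<and> (\<Sum>i\<in>UNIV. x $ i) \<le> 1}"
  shows "compact D" "measure lborel (prism D) = 1 / fact (CARD('n) - 1)"
proof -
  let ?m = "Max UNIV :: 'n" and ?J = "UNIV - {Max UNIV :: 'n}"
  let ?Q = "\<Pi>\<^sub>M i\<in>?J. (lborel :: real measure)"
  have "closed {x :: (real, 'n) vec. x $ ?m = 0}"
    by (intro closed_Collect_eq continuous_intros)
  moreover have "closed {x :: (real, 'n) vec. \<forall>i. 0 \<le> x $ i}"
    by (intro closed_Collect_all closed_Collect_le continuous_intros)
  moreover have "closed {x :: (real, 'n) vec. (\<Sum>i\<in>UNIV. x $ i) \<le> 1}"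
    by (intro closed_Collect_le continuous_intros)
  ultimately have "closed D" unfolding D_def by (auto intro!: closed_Collect_conj)
  moreover have "bounded D"
    unfolding bounded_iff
  proof (intro exI ballI)
    fix x assume x: "x \<in> D"
    have "norm x \<le> (\<Sum>i\<in>UNIV. \<bar>x $ i\<bar>)" by (rule norm_le_l1_cart)
    also have "\<dots> \<le> 1" using x by (simp add: D_def)
    finally show "norm x \<le> 1" .
  qed
  ultimately show D: "compact D" by (simp add: compact_eq_bounded_closed)
  have "drop_last_coord ` D = {f. (\<forall>i\<in>?J. 0 \<le> f i) \<and> sum f ?J \<le> 1} \<inter> space ?Q"
  proof
    show "drop_last_coord ` D \<subseteq> {f. (\<forall>i\<in>?J. 0 \<le> f i) \<and> sum f ?J \<le> 1} \<inter> space ?Q"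
    proof
      fix f assume "f \<in> drop_last_coord ` D"
      then obtain x where x: "x \<in> D" "f = drop_last_coord x" by blast
      have "sum f ?J = (\<Sum>i\<in>UNIV. x $ i)"
        using x by (subst sum.remove[of UNIV ?m]) (auto simp: D_def drop_last_coord_def)
      then show "f \<in> {f. (\<forall>i\<in>?J. 0 \<le> f i) \<and> sum f ?J \<le> 1} \<inter> space ?Q"
        using x by (auto simp: D_def drop_last_coord_def space_PiM)
    qed
    show "{f. (\<forall>i\<in>?J. 0 \<le> f i) \<and> sum f ?J \<le> 1} \<inter> space ?Q \<subseteq> drop_last_coord ` D"
    proof
      fix f assume f: "f \<in> {f. (\<forall>i\<in>?J. 0 \<le> f i) \<and> sum f ?J \<le> 1} \<inter> space ?Q"
      let ?x = "\<chi> i. if i = ?m then 0 else f i"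
      have "(\<Sum>i\<in>UNIV. ?x $ i) = sum f ?J"
        by (subst sum.remove[of UNIV ?m]) auto
      then have "?x \<in> D" using f by (auto simp: D_def)
      moreover have "f = drop_last_coord ?x"
        using f by (auto simp: drop_last_coord_def space_PiM PiE_iff extensional_def restrict_def)
      ultimately show "f \<in> drop_last_coord ` D" by blast
    qed
  qed
  then have "emeasure ?Q (drop_last_coord ` D) = ennreal (1 / fact (card ?J))"
    using emeasure_std_simplex_aux[of ?J 1] by simp
  moreover have "card ?J = CARD('n) - 1" by (simp add: card_Diff_singleton)
  ultimately have "measure ?Q (drop_last_coord ` D) = 1 / fact (CARD('n) - 1)"
    by (simp add: measure_def)
  then show "measure lborel (prism D) = 1 / fact (CARD('n) - 1)"
    using measure_prism[OF D, of 0 0] by (simp add: D_def)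
qed

text \<open>
  The map \<open>L\<close> sends the standard simplex to the translated simplex and fixes the last axis, so it maps prism to
  prism. It is invertible over the integers by \<open>coefficient_in_Ints\<close> and therefore preserves volume.
\<close>

lemma measure_prism_full_simplex:
  fixes B :: "'n::{finite,linorder} set set"
  assumes B: "sorted_family B" "\<And>I. I \<in> B \<Longrightarrow> card I = k" "card B = CARD('n)" and k: "0 < k"
  shows "measure lborel (prism (subset_polytope B)) = 1 / fact (CARD('n) - 1)"
proof -
  let ?m = "Max UNIV :: 'n"
  obtain \<gamma> :: "'n \<Rightarrow> 'n set" where \<gamma>: "bij_betw \<gamma> UNIV B"
    using finite_same_card_bij[of "UNIV :: 'n set" B] B(3) by auto
  have \<gamma>B: "\<gamma> j \<in> B" for j using \<gamma> by (auto simp: bij_betw_def)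
  define L where "L u = (\<Sum>j\<in>UNIV. u $ j *\<^sub>R (subset_vec (\<gamma> j) - subset_vec (\<gamma> ?m))) + u $ ?m *\<^sub>R last_axis"
    for u :: "(real, 'n) vec"
  define D where "D = {x :: (real, 'n) vec. x $ ?m = 0 \<and> (\<forall>i. 0 \<le> x $ i) \<and> (\<Sum>i\<in>UNIV. x $ i) \<le> 1}"
  have linL: "linear L"
    by (rule linearI) (simp_all add: L_def scaleR_left_distrib sum.distrib scaleR_right.sum scaleR_right_distrib)
  have intL: "integral_vec (L u)" if "integral_vec u" for u
  proof -
    have "L u $ i \<in> \<int>" for i
      using that by (auto simp: L_def integral_vec_def subset_vec_nth axis_def intro!: Ints_add Ints_sum Ints_mult Ints_diff)
    then show ?thesis by (simp add: integral_vec_def)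
  qed
  \<comment> \<open>so \<open>L\<close> maps the integral vectors onto themselves\<close>
  have "\<exists>v. integral_vec v \<and> L v = axis i 1" for i
  proof -
    have inj: "inj_on subset_vec B" using inj_subset_vec by (rule inj_on_subset) simp
    have "UNIV \<subseteq> span (subset_vec ` B)"
      using independent_sorted[OF B(1,2) k] B(3) card_image[OF inj]
      by (intro card_ge_dim_independent) auto
    then have "axis i 1 - last_axis \<in> range (\<lambda>u. \<Sum>v\<in>subset_vec ` B. u v *\<^sub>R v)"
      by (subst span_finite[symmetric]) auto
    then obtain u where u: "axis i 1 - last_axis = (\<Sum>v\<in>subset_vec ` B. u v *\<^sub>R v)" by (rule imageE)
    define c where "c I = u (subset_vec I)" for I
    have c: "(\<Sum>I\<in>B. c I *\<^sub>R subset_vec I) = axis i 1 - last_axis"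
      unfolding u c_def using inj by (simp add: sum.reindex)
    have "(\<Sum>j\<in>UNIV. (axis i 1 - last_axis :: (real, 'n) vec) $ j) = 0"
      unfolding inner_axis_sum[symmetric] by (simp add: inner_diff_right inner_axis)
    then have "(\<Sum>I\<in>B. c I * real (card I)) = 0"
      using sum_combination[of c B UNIV] c by simp
    moreover have "(\<Sum>I\<in>B. c I * real (card I)) = (\<Sum>I\<in>B. c I) * real k"
      using B(2) by (simp add: sum_distrib_right)
    ultimately have sum_c: "(\<Sum>I\<in>B. c I) = 0" using k by simp
    have "integral_vec (axis i 1 - last_axis :: (real, 'n) vec)"
      by (auto simp: integral_vec_def axis_def)
    then have c_int: "c I \<in> \<int>" if "I \<in> B" for I
      using coefficient_in_Ints[OF B(1,2), of c I] sum_c c that by simp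
    let ?v = "\<chi> j. if j = ?m then 1 else c (\<gamma> j)"
    have "L ?v = (\<Sum>j\<in>UNIV. c (\<gamma> j) *\<^sub>R (subset_vec (\<gamma> j) - subset_vec (\<gamma> ?m))) + last_axis"
      unfolding L_def by (intro arg_cong2[where f="(+)"] sum.cong) auto
    also have "(\<Sum>j\<in>UNIV. c (\<gamma> j) *\<^sub>R (subset_vec (\<gamma> j) - subset_vec (\<gamma> ?m)))
        = (\<Sum>I\<in>B. c I *\<^sub>R (subset_vec I - subset_vec (\<gamma> ?m)))"
      by (rule sum.reindex_bij_betw[OF \<gamma>])
    also have "\<dots> = (\<Sum>I\<in>B. c I *\<^sub>R subset_vec I) - (\<Sum>I\<in>B. c I) *\<^sub>R subset_vec (\<gamma> ?m)"
      by (simp add: scaleR_right_diff_distrib sum_subtractf scaleR_left.sum)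
    finally have "L ?v = axis i 1" by (simp add: c sum_c)
    moreover have "integral_vec ?v" using c_int \<gamma>B by (auto simp: integral_vec_def)
    ultimately show ?thesis by blast
  qed
  then obtain v where v: "\<And>i. integral_vec (v i)" "\<And>i. L (v i) = axis i 1" by metis
  define h where "h x = (\<Sum>i\<in>UNIV. x $ i *\<^sub>R v i)" for x :: "(real, 'n) vec"
  have linh: "linear h"
    by (rule linearI) (simp_all add: h_def scaleR_left_distrib sum.distrib scaleR_right.sum)
  have inth: "integral_vec (h x)" if "integral_vec x" for x
    using that v(1) by (auto simp: integral_vec_def h_def intro!: Ints_sum Ints_mult)
  have Lh: "L (h x) = x" for x
    by (simp add: h_def linear_sum[OF linL] linear_scale[OF linL] v(2) vec_eq_iff axis_def if_distrib cong: if_cong)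
  have poly: "subset_polytope B = (+) (subset_vec (\<gamma> ?m)) ` L ` D"
  proof
    show "subset_polytope B \<subseteq> (+) (subset_vec (\<gamma> ?m)) ` L ` D"
    proof
      fix x assume "x \<in> subset_polytope B"
      then obtain w where w: "represents B x w" by (auto simp: mem_subset_polytope_iff)
      define u where "u = (\<chi> j. if j = ?m then 0 else w (\<gamma> j))"
      have sum_w: "(\<Sum>j\<in>UNIV. w (\<gamma> j)) = 1"
        using w unfolding sum.reindex_bij_betw[OF \<gamma>, of w]
        by (subst sum.mono_neutral_left[of UNIV B]) (auto simp: represents_def)
      have "(\<Sum>j\<in>UNIV. u $ j) \<le> (\<Sum>j\<in>UNIV. w (\<gamma> j))"
        using w by (intro sum_mono) (auto simp: u_def represents_def)
      then have "u \<in> D" using w sum_w by (auto simp: D_def u_def represents_def)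
      have "L u = (\<Sum>j\<in>UNIV. w (\<gamma> j) *\<^sub>R (subset_vec (\<gamma> j) - subset_vec (\<gamma> ?m)))"
        unfolding L_def by (simp add: u_def) (intro sum.cong, auto)
      also have "\<dots> = (\<Sum>j\<in>UNIV. w (\<gamma> j) *\<^sub>R subset_vec (\<gamma> j)) - subset_vec (\<gamma> ?m)"
        using sum_w by (simp add: scaleR_right_diff_distrib sum_subtractf flip: scaleR_left.sum)
      also have "(\<Sum>j\<in>UNIV. w (\<gamma> j) *\<^sub>R subset_vec (\<gamma> j)) = (\<Sum>I\<in>B. w I *\<^sub>R subset_vec I)"
        by (rule sum.reindex_bij_betw[OF \<gamma>])
      also have "\<dots> = (\<Sum>I\<in>UNIV. w I *\<^sub>R subset_vec I)"
        using w by (intro sum.mono_neutral_left) (auto simp: represents_def)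
      also have "\<dots> = x" using w by (simp add: represents_def)
      finally have "x = subset_vec (\<gamma> ?m) + L u" by simp
      then show "x \<in> (+) (subset_vec (\<gamma> ?m)) ` L ` D" using \<open>u \<in> D\<close> by blast
    qed
    show "(+) (subset_vec (\<gamma> ?m)) ` L ` D \<subseteq> subset_polytope B"
    proof clarify
      fix u assume u: "u \<in> D"
      define w where "w j = (if j = ?m then 1 - (\<Sum>i\<in>UNIV. u $ i) else u $ j)" for j
      have w_u: "w j = u $ j + (if j = ?m then 1 - (\<Sum>i\<in>UNIV. u $ i) else 0)" for j
        using u by (simp add: w_def D_def)
      have sum_w: "(\<Sum>j\<in>UNIV. w j) = 1" by (simp add: w_u sum.distrib)
      have "(\<Sum>j\<in>UNIV. w j *\<^sub>R subset_vec (\<gamma> j)) \<in> subset_polytope B"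
        unfolding subset_polytope_def
      proof (rule convex_sum)
        show "0 \<le> w j" for j using u by (auto simp: w_def D_def)
      qed (use sum_w \<gamma>B in \<open>auto simp: hull_inc\<close>)
      moreover have "L u = (\<Sum>j\<in>UNIV. w j *\<^sub>R (subset_vec (\<gamma> j) - subset_vec (\<gamma> ?m)))"
        unfolding L_def using u by (simp add: D_def) (intro sum.cong, auto simp: w_def)
      then have "subset_vec (\<gamma> ?m) + L u = (\<Sum>j\<in>UNIV. w j *\<^sub>R subset_vec (\<gamma> j))"
        using sum_w by (simp add: scaleR_right_diff_distrib sum_subtractf flip: scaleR_left.sum)
      ultimately show "subset_vec (\<gamma> ?m) + L u \<in> subset_polytope B" by simp
    qed
  qed
  have "L last_axis = last_axis"
    by (simp add: L_def axis_def if_distrib[of "\<lambda>x. x *\<^sub>R _"] cong: if_cong)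
  then have "prism (subset_polytope B) = (+) (subset_vec (\<gamma> ?m)) ` L ` prism D"
    unfolding poly prism_def
    by (auto simp: image_iff linear_add[OF linL] linear_scale[OF linL] add.assoc split: prod.splits; force)
  moreover note D = measure_standard_prism[where 'n='n, folded D_def]
  moreover have "compact (L ` prism D)"
    using compact_prism[OF D(1)] linL
    by (intro compact_continuous_image linear_continuous_on) (auto simp: linear_linear)
  moreover have "measure lborel (L ` prism D) = measure lborel (prism D)"
    by (rule measure_unimodular_image[OF linL intL linh inth Lh compact_prism[OF D(1)]])
  ultimately show ?thesis
    using measure_translation[of "subset_vec (\<gamma> ?m)" "L ` prism D"] compact_translation[of "L ` prism D" "subset_vec (\<gamma> ?m)"]
    by (simp add: measure_completion borel_compact)
qed

context sort_closed_family
begin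

definition full_simplices :: "'n set set set" where
  "full_simplices = {B. B \<subseteq> S \<and> sorted_family B \<and> card B = CARD('n)}"

text \<open>
  By uniqueness of sorted representations two simplices meet in the simplex of their common vertices, which
  has fewer than \<open>n\<close> of them.
\<close>

lemma negligible_prism_Int:
  assumes "A \<in> full_simplices" "B \<in> full_simplices" "A \<noteq> B"
  shows "negligible (prism (subset_polytope A) \<inter> prism (subset_polytope B))"
proof (rule negligible_subset)
  have AB: "A \<subseteq> S" "B \<subseteq> S" "sorted_family A" "sorted_family B" using assms by (auto simp: full_simplices_def)
  have "A \<inter> B \<subset> A"
  proof (rule psubsetI)
    show "A \<inter> B \<noteq> A"
    proof
      assume "A \<inter> B = A"
      then have "A = B" using assms by (intro card_subset_eq) (auto simp: full_simplices_def)
      then show False using assms by simp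
    qed
  qed simp
  then have "card (A \<inter> B) < CARD('n)" using assms psubset_card_mono[of A "A \<inter> B"] by (simp add: full_simplices_def)
  then show "negligible (cylinder (subset_polytope (A \<inter> B)))"
    using AB card_S by (intro negligible_cylinder[OF _ k]) auto
  show "prism (subset_polytope A) \<inter> prism (subset_polytope B) \<subseteq> cylinder (subset_polytope (A \<inter> B))"
  proof
    fix z assume "z \<in> prism (subset_polytope A) \<inter> prism (subset_polytope B)"
    then have z: "z \<in> prism (subset_polytope A)" "z \<in> prism (subset_polytope B)" by auto
    obtain x s where x: "x \<in> subset_polytope A" "z = x + s *\<^sub>R last_axis"
      using z(1) by (auto simp: prism_def)
    obtain y t where y: "y \<in> subset_polytope B" "z = y + t *\<^sub>R last_axis"
      using z(2) by (auto simp: prism_def)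
    have xy: "(\<Sum>i\<in>UNIV. x $ i) = real k" "(\<Sum>i\<in>UNIV. y $ i) = real k"
      using AB card_S x(1) y(1) by (blast intro: sum_subset_polytope)+
    have "(\<Sum>i\<in>UNIV. z $ i) = real k + s" unfolding x(2) sum_add_axis xy ..
    moreover have "(\<Sum>i\<in>UNIV. z $ i) = real k + t" unfolding y(2) sum_add_axis xy ..
    ultimately have "s = t" by simp
    then have "x = y" using x(2) y(2) by simp
    obtain v w where v: "represents A x v" and w: "represents B x w"
      using x(1) y(1) \<open>x = y\<close> by (auto simp: mem_subset_polytope_iff)
    have "v = w"
    proof (rule sorted_representation_unique[OF card_S k])
      show "represents S x v" "represents S x w" using v w AB by (auto simp: represents_def)
      show "sorted_family {I. v I \<noteq> 0}" "sorted_family {I. w I \<noteq> 0}"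
        using v w AB by (auto simp: represents_def intro: sorted_family_subset)
    qed
    then have "represents (A \<inter> B) x v" using v w by (auto simp: represents_def)
    then show "z \<in> cylinder (subset_polytope (A \<inter> B))"
      unfolding cylinder_def using x(2) by (auto simp: mem_subset_polytope_iff)
  qed
qed

lemma normalized_volume_eq: "normalized_volume (subset_polytope S) = real (card full_simplices)"
proof -
  let ?f = "\<lambda>B. prism (subset_polytope B)"
  have mono: "subset_polytope B \<subseteq> subset_polytope S" if "B \<in> full_simplices" for B
    using that unfolding subset_polytope_def full_simplices_def by (intro hull_mono) auto
  have "subset_polytope S = (\<Union>B\<in>full_simplices. subset_polytope B)"
  proof (intro equalityI subsetI)
    fix x assume "x \<in> subset_polytope S"
    then obtain B where "B \<subseteq> S" "sorted_family B" "card B = CARD('n)" "x \<in> subset_polytope B"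
      by (rule mem_full_simplex)
    then show "x \<in> (\<Union>B\<in>full_simplices. subset_polytope B)" by (auto simp: full_simplices_def)
  qed (use mono in blast)
  then have union: "?f S = (\<Union>B\<in>full_simplices. ?f B)"
    unfolding prism_def by blast
  have comp: "compact (?f B)" for B by (intro compact_prism compact_subset_polytope)
  have leb: "measure lborel (?f B) = measure lebesgue (?f B)" for B
    using borel_compact[OF comp] by (intro measure_completion[symmetric]) simp
  have "measure lebesgue (\<Union>B\<in>full_simplices. ?f B) = (\<Sum>B\<in>full_simplices. measure lebesgue (?f B))"
  proof (rule measure_negligible_finite_Union_image)
    show "pairwise (\<lambda>A B. negligible (?f A \<inter> ?f B)) full_simplices"
      using negligible_prism_Int by (auto simp: pairwise_def)
  qed (use comp lmeasurable_compact in auto)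
  also have "\<dots> = (\<Sum>B\<in>full_simplices. 1 / fact (CARD('n) - 1))"
  proof (rule sum.cong)
    fix B assume "B \<in> full_simplices"
    then show "measure lebesgue (?f B) = 1 / fact (CARD('n) - 1)"
      unfolding leb[symmetric] using card_S by (intro measure_prism_full_simplex[OF _ _ _ k]) (auto simp: full_simplices_def)
  qed simp
  finally have "measure lborel (?f S) = real (card full_simplices) / fact (CARD('n) - 1)"
    by (simp add: union[symmetric] leb)
  moreover have "x $ Max UNIV = real k - 1 * (\<Sum>i\<in>UNIV - {Max UNIV}. x $ i)" if "x \<in> subset_polytope S" for x
    using sum_subset_polytope[OF card_S that] sum.remove[of UNIV "Max UNIV" "\<lambda>i. x $ i"] by simp
  ultimately show ?thesis
    using measure_prism[OF compact_subset_polytope, of S "real k" 1] by (simp add: normalized_volume_def)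
qed

end

section \<open>Arrangements of largest minors\<close>

text \<open>
  If two of the largest minors were unsorted, one of the minors of their sorting would be larger. Conversely
  a supporting functional tells how to scale the columns of an arbitrary matrix with positive minors.
\<close>

lemma largest_minors_arrangement_iff_sorted:
  fixes S :: "'n::{finite,linorder} set set"
  assumes kn: "CARD('k::{finite,linorder}) \<le> CARD('n)" and S: "S \<subseteq> ksubsets TYPE('k)"
    and closed: "sort_closed S" and dim: "aff_dim (subset_polytope S) = int CARD('n) - 1" and A: "\<A> \<subseteq> S"
  shows "largest_minors_arrangement TYPE('k) S \<A> \<longleftrightarrow> sorted_family \<A>"
proof
  assume "largest_minors_arrangement TYPE('k) S \<A>"
  then obtain M :: "((real, 'n) vec, 'k) vec" where M: "M \<in> positive_grassmannian"
    and eq: "\<And>I J. I \<in> \<A> \<Longrightarrow> J \<in> \<A> \<Longrightarrow> maximal_minor M I = maximal_minor M J"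
    and less: "\<And>I J. I \<in> \<A> \<Longrightarrow> J \<in> S - \<A> \<Longrightarrow> maximal_minor M J < maximal_minor M I"
    unfolding largest_minors_arrangement_def by blast
  have pos: "maximal_minor M I > 0" if "I \<in> S" for I
    using M S that by (auto simp: positive_grassmannian_def)
  have max: "ln (maximal_minor M J) \<le> ln (maximal_minor M I)" if "I \<in> \<A>" "J \<in> S" for I J
  proof (cases "J \<in> \<A>")
    case True
    then show ?thesis using eq[OF that(1)] by simp
  next
    case False
    then have "maximal_minor M J < maximal_minor M I" using less that by blast
    moreover have "maximal_minor M I > 0" "maximal_minor M J > 0" using pos that A by blast+
    ultimately show ?thesis by simp
  qed
  show "sorted_family \<A>"
    unfolding sorted_family_def
  proof (intro ballI, rule ccontr)
    fix I J assume IJ: "I \<in> \<A>" "J \<in> \<A>" and "\<not> sorted_pair I J"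
    moreover have "card I = CARD('k)" "card J = CARD('k)"
      using IJ A S by (auto simp: ksubsets_def)
    ultimately have "ln (maximal_minor M I) + ln (maximal_minor M J)
        < ln (maximal_minor M (fst (sorting I J))) + ln (maximal_minor M (snd (sorting I J)))"
      using strictly_sort_concave_ln_minor[OF M] unfolding strictly_sort_concave_def by blast
    moreover have "fst (sorting I J) \<in> S" "snd (sorting I J) \<in> S"
      using closed IJ A by (auto simp: sort_closed_def)
    ultimately show False using max[OF IJ(1)] max[OF IJ(2)] by (metis add_mono not_less)
  qed
next
  assume srt: "sorted_family \<A>"
  obtain M where M: "M \<in> (positive_grassmannian :: ((real, 'n) vec, 'k) vec set)"
    using positive_grassmannian_nonempty[OF kn] .
  interpret sort_closed_family S "CARD('k)" "\<lambda>I. ln (maximal_minor M I)"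
    using S closed dim strictly_sort_concave_ln_minor[OF M]
    by unfold_locales (auto simp: ksubsets_def)
  obtain T :: "(real, 'n) vec \<Rightarrow> real" where T: "linear T"
    and zero: "\<And>I. I \<in> \<A> \<Longrightarrow> ln (maximal_minor M I) + T (subset_vec I) = 0"
    and neg: "\<And>J. J \<in> S - \<A> \<Longrightarrow> ln (maximal_minor M J) + T (subset_vec J) < 0"
    using supporting_functional[OF A srt] by blast
  define N where "N = (\<chi> i j. exp (T (axis j 1)) * M $ i $ j)"
  have N: "N \<in> positive_grassmannian"
    unfolding N_def by (rule positive_grassmannian_scale_columns[OF M kn]) simp
  have minor: "maximal_minor N I = exp (ln (maximal_minor M I) + T (subset_vec I))" if "I \<in> S" for I
  proof -
    have I: "I \<in> ksubsets TYPE('k)" using S that by blast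
    then have "maximal_minor M I > 0" using M by (simp add: positive_grassmannian_def)
    moreover have "(\<Prod>j\<in>I. exp (T (axis j 1))) = exp (T (subset_vec I))"
      by (simp add: subset_vec_def linear_sum[OF T] exp_sum)
    ultimately show ?thesis
      unfolding N_def minor_scale_columns[OF I] by (simp add: exp_add)
  qed
  show "largest_minors_arrangement TYPE('k) S \<A>"
    unfolding largest_minors_arrangement_def
  proof (intro conjI bexI ballI)
    fix I assume I: "I \<in> \<A>"
    then have one: "maximal_minor N I = 1" using minor zero A by auto
    show "maximal_minor N I = maximal_minor N J" if "J \<in> \<A>" for J
      using one minor[of J] zero[of J] that A by auto
    show "maximal_minor N J < maximal_minor N I" if "J \<in> S - \<A>" for J
      using one minor[of J] neg[of J] that by auto
  qed (use A N in auto)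
qed

theorem theorem9p5:
  fixes S :: "'n::{finite,linorder} set set"
  assumes "CARD('k::{finite,linorder}) \<le> CARD('n)"
    and "S \<subseteq> ksubsets TYPE('k)"
    and "sort_closed S"
    and "aff_dim (subset_polytope S) = int CARD('n) - 1"
  shows "(\<forall>\<A>. \<A> \<subseteq> S \<longrightarrow>
            (largest_minors_arrangement TYPE('k) S \<A> \<longleftrightarrow> sorted_family \<A>)) \<and>
         (\<forall>\<A>. maximal_largest_minors_arrangement TYPE('k) S \<A> \<longrightarrow> card \<A> = CARD('n)) \<and>
         real (card {\<A>. maximal_largest_minors_arrangement TYPE('k) S \<A>}) =
           normalized_volume (subset_polytope S)"
proof -
  note iff = largest_minors_arrangement_iff_sorted[OF assms]
  obtain M where M: "M \<in> (positive_grassmannian :: ((real, 'n) vec, 'k) vec set)"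
    using positive_grassmannian_nonempty[OF assms(1)] .
  interpret sort_closed_family S "CARD('k)" "\<lambda>I. ln (maximal_minor M I)"
    using assms strictly_sort_concave_ln_minor[OF M]
    by unfold_locales (auto simp: ksubsets_def)
  have arr: "largest_minors_arrangement TYPE('k) S \<A> \<longleftrightarrow> \<A> \<subseteq> S \<and> sorted_family \<A>" for \<A>
    using iff by (auto simp: largest_minors_arrangement_def)
  have max: "maximal_largest_minors_arrangement TYPE('k) S \<A> \<longleftrightarrow> \<A> \<in> full_simplices" for \<A>
  proof
    assume \<A>: "maximal_largest_minors_arrangement TYPE('k) S \<A>"
    then have "\<A> \<subseteq> S" "sorted_family \<A>"
      by (auto simp: maximal_largest_minors_arrangement_def arr)
    then obtain B where "\<A> \<subseteq> B" "B \<subseteq> S" "sorted_family B" "card B = CARD('n)"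
      by (rule extend_to_full_simplex)
    moreover have "B = \<A>"
      using \<A> calculation by (auto simp: maximal_largest_minors_arrangement_def arr)
    ultimately show "\<A> \<in> full_simplices" by (simp add: full_simplices_def)
  next
    assume \<A>: "\<A> \<in> full_simplices"
    have "B = \<A>" if "B \<subseteq> S" "sorted_family B" "\<A> \<subseteq> B" for B
    proof -
      have "card B \<le> card \<A>"
        using card_sorted_family_le[OF that(2) _ k] card_S that(1) \<A> by (auto simp: full_simplices_def)
      then show ?thesis using card_seteq[of B \<A>] that(3) by simp
    qed
    then show "maximal_largest_minors_arrangement TYPE('k) S \<A>"
      using \<A> by (auto simp: maximal_largest_minors_arrangement_def arr full_simplices_def)
  qed
  have "{\<A>. maximal_largest_minors_arrangement TYPE('k) S \<A>} = full_simplices"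
    using max by blast
  then have "real (card {\<A>. maximal_largest_minors_arrangement TYPE('k) S \<A>}) =
      normalized_volume (subset_polytope S)"
    by (simp add: normalized_volume_eq)
  moreover have "card \<A> = CARD('n)" if "maximal_largest_minors_arrangement TYPE('k) S \<A>" for \<A>
    using that by (simp add: max full_simplices_def)
  ultimately show ?thesis using iff by blast
qed

end
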